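(* Let $n\geqslant3$, let $\psi_0,\psi_1,\psi_2\in L^2(\mathbb{R}^n)\cap L^{1,1}(\mathbb{R}^n)$ and assume $|P_{\psi_2}|\neq0$. Then the solution $\psi$ to the linear Blackstock Cauchy problem $$\begin{cases}(\partial_t-\kappa\Delta)(\psi_{tt}-\Delta\psi-\delta\Delta\psi_t)+\kappa(\gamma-1)(b\nu-\kappa)\Delta^2\psi_t=0, & x\in\mathbb{R}^n,\ t>0,\\ \psi(0,x)=\psi_0(x),\ \psi_t(0,x)=\psi_1(x),\ \psi_{tt}(0,x)=\psi_2(x), & x\in\mathbb{R}^n,\end{cases}$$ fulfills, for all $t\gg1$ (that is, for all sufficiently large $t$), the optimal estimate $$\widetilde{\mathcal D}_n(t)\,|P_{\psi_2}|\lesssim\|\psi(t,\cdot)\|_{L^2}\lesssim\widetilde{\mathcal D}_n(t)\left(\|\psi_0\|_{L^2\cap L^{1,1}}+\|\psi_1\|_{L^2\cap L^{1,1}}+\|\psi_2\|_{L^2\cap L^{1,1}}\right).$$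
   Context: Parameters: $b>0$, $\nu>0$, $\gamma\in(1,5/3]$, $\delta:=b\nu+(\gamma-1)\kappa$, and $0<\kappa\ll1$, i.e. $\kappa>0$ is sufficiently small with respect to the other parameters. The solution is obtained by solving, for each $\xi$, the linear third-order ODE in $t$ satisfied by the partial Fourier transform $\widehat\psi(t,\xi)$ with data $\widehat\psi_0,\widehat\psi_1,\widehat\psi_2$. $L^{1,1}$ is the space of $f\in L^1(\mathbb{R}^n)$ with $\|f\|_{L^{1,1}}:=\int_{\mathbb{R}^n}(1+|x|)|f(x)|\,\mathrm{d}x<\infty$; $\|f\|_{L^2\cap L^{1,1}}$ is the sum of the two norms; $P_f:=\int_{\mathbb{R}^n}f(x)\,\mathrm{d}x$. The function $\widetilde{\mathcal D}_n$ is defined, for $t\geqslant 0$, by $$\widetilde{\mathcal D}_n(1+t):=\begin{cases}(1+t)^{2-\frac n2}&\text{if }n\leqslant3,\\(\ln(\mathrm{e}+t))^{\frac12}&\text{if }n=4,\\(1+t)^{1-\frac n4}&\text{if }n\geqslant5.\end{cases}$$ $A\lesssim B$ means $A\leqslant CB$ with a constant $C>0$ independent of $t$ and of the initial data (it may depend on $n$ and on the parameters, including $\kappa$). How large $t$ has to be may depend on the initial data. *)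

theory Defs
  imports "HOL-Analysis.Analysis"
begin

text \<open>
  Functions are complex-valued and Lebesgue measurable; real-valued functions are included
  as a special case.  Elements of the Lebesgue spaces are represented by functions, and all
  notions below are insensitive to changes on null sets.
\<close>

definition in_L2 :: "('a::euclidean_space \<Rightarrow> complex) \<Rightarrow> bool" where
  "in_L2 f \<longleftrightarrow> f \<in> borel_measurable lebesgue \<and> integrable lebesgue (\<lambda>x. (cmod (f x))\<^sup>2)"

definition L2_norm :: "('a::euclidean_space \<Rightarrow> complex) \<Rightarrow> real" where
  "L2_norm f = sqrt (LINT x|lebesgue. (cmod (f x))\<^sup>2)"

definition in_L11 :: "('a::euclidean_space \<Rightarrow> complex) \<Rightarrow> bool" where
  "in_L11 f \<longleftrightarrow> integrable lebesgue f \<and> integrable lebesgue (\<lambda>x. (1 + norm x) * cmod (f x))"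

definition L11_norm :: "('a::euclidean_space \<Rightarrow> complex) \<Rightarrow> real" where
  "L11_norm f = (LINT x|lebesgue. (1 + norm x) * cmod (f x))"

definition L2_L11_norm :: "('a::euclidean_space \<Rightarrow> complex) \<Rightarrow> real" where
  "L2_L11_norm f = L2_norm f + L11_norm f"

definition mean_P :: "('a::euclidean_space \<Rightarrow> complex) \<Rightarrow> complex" where
  "mean_P f = (LINT x|lebesgue. f x)"

text \<open>
  The Fourier transform of an integrable function.  The choice of a normalising factor is
  immaterial below, since the same transform is used for the data and for the solution.
\<close>

definition fourier_L1 :: "('a::euclidean_space \<Rightarrow> complex) \<Rightarrow> 'a \<Rightarrow> complex" where
  "fourier_L1 f \<xi> = (LINT x|lebesgue. exp (- \<i> * complex_of_real (x \<bullet> \<xi>)) * f x)"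

text \<open>
  The Fourier--Plancherel transform: \<open>g\<close> is (a representative of) the \<open>L\<^sup>2\<close> limit of the
  transforms of the truncations of \<open>f\<close> to balls.  The distance is measured by a nonnegative
  integral in the extended reals, so that no junk value of the Bochner integral can enter.
\<close>

definition is_fourier_L2 ::
    "('a::euclidean_space \<Rightarrow> complex) \<Rightarrow> ('a \<Rightarrow> complex) \<Rightarrow> bool" where
  "is_fourier_L2 f g \<longleftrightarrow> in_L2 f \<and> in_L2 g \<and>
     ((\<lambda>R::real. \<integral>\<^sup>+ \<xi>. ennreal ((cmod (g \<xi> -
          fourier_L1 (\<lambda>x. indicator (cball 0 R) x * f x) \<xi>))\<^sup>2) \<partial>lebesgue)
        \<longlongrightarrow> 0) at_top"

definition blackstock_delta :: "real \<Rightarrow> real \<Rightarrow> real \<Rightarrow> real \<Rightarrow> real" where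
  "blackstock_delta b \<nu> \<gamma> \<kappa> = b * \<nu> + (\<gamma> - 1) * \<kappa>"

text \<open>
  The linear Blackstock equation on the Fourier side at a frequency of modulus \<open>r\<close>, where
  \<open>\<Delta>\<close> becomes multiplication by \<open>-r\<^sup>2\<close>.  The functions \<open>v1\<close>, \<open>v2\<close>, \<open>v3\<close> are the
  successive time derivatives of \<open>v\<close> on the half-line (one-sided at \<open>0\<close>).  The first two
  lines of the equation are \<open>(\<partial>\<^sub>t + \<kappa> r\<^sup>2)(v'' + r\<^sup>2 v + \<delta> r\<^sup>2 v')\<close>, the third one is the
  symbol of \<open>\<kappa> (\<gamma> - 1) (b \<nu> - \<kappa>) \<Delta>\<^sup>2 \<partial>\<^sub>t\<close>.
\<close>

definition blackstock_ode ::
    "real \<Rightarrow> real \<Rightarrow> real \<Rightarrow> real \<Rightarrow> real \<Rightarrow> complex \<Rightarrow> complex \<Rightarrow> complex \<Rightarrow> (real \<Rightarrow> complex) \<Rightarrow> bool" where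
  "blackstock_ode b \<nu> \<gamma> \<kappa> r a0 a1 a2 v \<longleftrightarrow>
     (let \<delta> = blackstock_delta b \<nu> \<gamma> \<kappa> in
      \<exists>v1 v2 v3 :: real \<Rightarrow> complex.
        (\<forall>t\<ge>0. (v has_vector_derivative v1 t) (at t within {0..}) \<and>
               (v1 has_vector_derivative v2 t) (at t within {0..}) \<and>
               (v2 has_vector_derivative v3 t) (at t within {0..})) \<and>
        (\<forall>t>0. (v3 t + of_real (r\<^sup>2) * v1 t + of_real (\<delta> * r\<^sup>2) * v2 t)
               + of_real (\<kappa> * r\<^sup>2) * (v2 t + of_real (r\<^sup>2) * v t + of_real (\<delta> * r\<^sup>2) * v1 t)
               + of_real (\<kappa> * (\<gamma> - 1) * (b * \<nu> - \<kappa>) * r ^ 4) * v1 t = 0) \<and>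
        v 0 = a0 \<and> v1 0 = a1 \<and> v2 0 = a2)"

text \<open>
  \<open>\<psi>\<close> is the solution of the linear Blackstock Cauchy problem: its partial Fourier transform
  \<open>u t \<xi>\<close> solves, for each frequency \<open>\<xi>\<close>, the corresponding initial value problem in \<open>t\<close>.
\<close>

definition blackstock_solution ::
    "real \<Rightarrow> real \<Rightarrow> real \<Rightarrow> real \<Rightarrow> ('a::euclidean_space \<Rightarrow> complex) \<Rightarrow> ('a \<Rightarrow> complex) \<Rightarrow>
     ('a \<Rightarrow> complex) \<Rightarrow> (real \<Rightarrow> 'a \<Rightarrow> complex) \<Rightarrow> bool" where
  "blackstock_solution b \<nu> \<gamma> \<kappa> \<psi>0 \<psi>1 \<psi>2 \<psi> \<longleftrightarrow>
     (\<exists>u :: real \<Rightarrow> 'a \<Rightarrow> complex.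
        (\<forall>\<xi>. blackstock_ode b \<nu> \<gamma> \<kappa> (norm \<xi>)
               (fourier_L1 \<psi>0 \<xi>) (fourier_L1 \<psi>1 \<xi>) (fourier_L1 \<psi>2 \<xi>) (\<lambda>t. u t \<xi>)) \<and>
        (\<forall>t\<ge>0. is_fourier_L2 (\<psi> t) (u t)))"

text \<open>
  The growth function is prescribed through its values at \<open>s = 1 + t\<close> with \<open>t \<ge> 0\<close>, so the
  logarithm \<open>ln (e + t)\<close> becomes \<open>ln (e + (s - 1))\<close>.
\<close>

definition D_tilde :: "nat \<Rightarrow> real \<Rightarrow> real" where
  "D_tilde n s =
     (if n \<le> 3 then s powr (2 - real n / 2)
      else if n = 4 then sqrt (ln (exp 1 + (s - 1)))
      else s powr (1 - real n / 4))"

end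

theory Submission
  imports Defs "HOL-Probability.Characteristic_Functions"
begin

text \<open>
  After a Fourier transform the solution is governed, at each frequency of modulus \<open>r\<close>, by a
  third-order equation in time.  For \<open>r\<close> bounded away from zero a Lyapunov functional that is
  uniform in \<open>r\<close> gives exponential decay.  For small \<open>r\<close> the cubic symbol has one real root close to
  \<open>-\<kappa> r\<^sup>2\<close> and a conjugate pair close to \<open>-\<delta> r\<^sup>2 / 2 \<plusminus> i r\<close>, and the solution equals the third datum
  times \<open>(exp (-\<kappa> r\<^sup>2 t) - exp (-\<delta> r\<^sup>2 t / 2) cos (r t)) / r\<^sup>2\<close>, up to an error that is smaller by one factor \<open>r\<close>.
  Replacing the third datum by its value at frequency zero, the mean of \<open>\<psi>2\<close>, costs a factor \<open>r\<close> as well,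
  so that the leading profile alone determines the rate, and its norm is a one-dimensional radial
  integral.  The profile cannot cancel: since \<open>\<kappa> < \<delta> / 2\<close>, the diffusion term dominates the
  wave term.  The contributing region is \<open>r \<sim> 1 / t\<close> for \<open>n = 3\<close>, \<open>1 / t \<le> r \<le> 1 / \<surd>t\<close> for
  \<open>n = 4\<close> and \<open>r \<sim> 1 / \<surd>t\<close> for \<open>n \<ge> 5\<close>.  Since only comparability of the norms of a function and
  of its transform matters, Plancherel's theorem is needed only up to constants.
\<close>

section \<open>The Plancherel inequalities\<close>

text \<open>Two conditions hide in the smallness of \<kappa>. The first, \<kappa> \<le> b \<nu>, is
  a sign condition that keeps the real root on one side of -\<kappa> r^2: at that point the symbol
  is a multiple of (\<gamma> - 1) (b \<nu> - \<kappa>) r^6. The second, 2 \<kappa> < b \<nu>, yields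
  \<kappa> < \<delta> / 2. Explicit roots are trusted only near zero frequency; elsewhere they may
  collide, a formula that divides by their differences is then not uniform, and an energy argument
  takes its place. An error that gains one factor r gains 1 / t in the squared norm, so the profile
  dominates only once t exceeds a multiple of the squared ratio between the norm of the data and the
  mean of \<psi>2. This is how the waiting time comes to depend on the data while the constants do
  not. The Plancherel bounds rest on Gaussian damping: the upper one is a Schur test, the lower one
  comes from equality for bounded continuous functions and density.\<close>

lemma sigma_finite_lebesgue: "sigma_finite_measure (lebesgue :: 'a::euclidean_space measure)"
proof
  obtain A :: "'a set set" where "countable A" "A \<subseteq> sets lborel" "\<Union>A = space lborel"
      "\<forall>a\<in>A. emeasure lborel a \<noteq> \<infinity>"
    using lborel.sigma_finite_countable by blast
  then show "\<exists>A :: 'a set set. countable A \<and> A \<subseteq> sets lebesgue \<and> \<Union>A = space lebesgue \<and>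
      (\<forall>a\<in>A. emeasure lebesgue a \<noteq> \<infinity>)"
    by (intro exI[of _ A]) (auto intro: sets_completionI_sets)
qed

interpretation lebesgue: sigma_finite_measure "lebesgue :: 'a::euclidean_space measure"
  by (rule sigma_finite_lebesgue)

interpretation lebesgue_pair: pair_sigma_finite
  "lebesgue :: 'a::euclidean_space measure" "lebesgue :: 'b::euclidean_space measure" ..

text \<open>The product of two completed measures need not be complete, so measurability of a kernel
  is pulled back from the Borel sets of the product space through the two coordinate maps. The
  functions to be transformed are only Lebesgue measurable, which is why kernels are treated over
  \<open>lebesgue\<close>.\<close>

lemma measurable_lebesgue_pair:
  assumes "K \<in> borel_measurable borel"
  shows "K \<in> borel_measurable (lebesgue \<Otimes>\<^sub>M lebesgue :: ('a::euclidean_space \<times> 'b::euclidean_space) measure)"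
proof -
  have "(\<lambda>z. (fst z, snd z)) \<in> (lebesgue \<Otimes>\<^sub>M lebesgue :: ('a \<times> 'b) measure) \<rightarrow>\<^sub>M borel \<Otimes>\<^sub>M borel"
    by (intro measurable_Pair measurable_compose[OF measurable_fst, of "\<lambda>x. x"]
        measurable_compose[OF measurable_snd, of "\<lambda>x. x"] measurable_completion) auto
  then have "(\<lambda>z. z) \<in> (lebesgue \<Otimes>\<^sub>M lebesgue :: ('a \<times> 'b) measure) \<rightarrow>\<^sub>M borel"
    by (simp add: borel_prod)
  from measurable_compose[OF this assms] show ?thesis .
qed

lemma integrable_kernel:
  fixes f :: "'a::euclidean_space \<Rightarrow> complex" and g :: "'b::euclidean_space \<Rightarrow> complex"
  assumes f: "integrable lebesgue f" and g: "integrable lebesgue g"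
    and K: "K \<in> borel_measurable borel" and M: "\<And>z. cmod (K z) \<le> M"
  shows "integrable (lebesgue \<Otimes>\<^sub>M lebesgue) (\<lambda>z. f (fst z) * K z * g (snd z))"
proof -
  note [measurable] = borel_measurable_integrable[OF f] borel_measurable_integrable[OF g]
    measurable_lebesgue_pair[OF K]
  have "integrable (lebesgue \<Otimes>\<^sub>M lebesgue) (\<lambda>z. f (fst z) * g (snd z))"
    using f g by (intro lebesgue_pair.Fubini_integrable) (auto simp: norm_mult)
  then have "integrable (lebesgue \<Otimes>\<^sub>M lebesgue) (\<lambda>z. M *\<^sub>R (f (fst z) * g (snd z)))"
    by (rule integrable_scaleR_right)
  then show ?thesis
  proof (rule Bochner_Integration.integrable_bound)
    show "AE z in lebesgue \<Otimes>\<^sub>M lebesgue. norm (f (fst z) * K z * g (snd z))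
        \<le> norm (M *\<^sub>R (f (fst z) * g (snd z)))"
    proof (rule AE_I2)
      fix z
      have "cmod (K z) \<le> \<bar>M\<bar>" using M[of z] by simp
      from mult_left_mono[OF this, of "norm (f (fst z) * g (snd z))"]
      show "norm (f (fst z) * K z * g (snd z)) \<le> norm (M *\<^sub>R (f (fst z) * g (snd z)))"
        by (simp add: norm_mult mult_ac)
    qed
  qed measurable
qed

text \<open>Integrability comes from \<open>f\<close> and \<open>g\<close> alone. In this form a
  Fourier kernel, bounded but not integrable, is moved from one factor to the other.\<close>

lemma Fubini_kernel:
  fixes f :: "'a::euclidean_space \<Rightarrow> complex" and g :: "'b::euclidean_space \<Rightarrow> complex"
  assumes f: "integrable lebesgue f" and g: "integrable lebesgue g"
    and K: "K \<in> borel_measurable borel" and M: "\<And>z. cmod (K z) \<le> M"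
  shows "(LINT x|lebesgue. f x * (LINT y|lebesgue. K (x, y) * g y))
       = (LINT y|lebesgue. (LINT x|lebesgue. K (x, y) * f x) * g y)"
proof -
  have "integrable (lebesgue \<Otimes>\<^sub>M lebesgue) (case_prod (\<lambda>x y. f x * K (x, y) * g y))"
    using integrable_kernel[OF assms] by (simp add: case_prod_beta')
  from lebesgue_pair.Fubini_integral[OF this]
  have "(LINT x|lebesgue. LINT y|lebesgue. f x * (K (x, y) * g y))
      = (LINT y|lebesgue. LINT x|lebesgue. (K (x, y) * f x) * g y)"
    by (simp add: mult_ac)
  then show ?thesis by simp
qed

section \<open>The Gaussian and its Fourier transform\<close>

definition gauss :: "'a::euclidean_space \<Rightarrow> real" where
  "gauss x = exp (- (norm x)\<^sup>2 / 2)"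

lemma gauss_measurable [measurable]: "gauss \<in> borel_measurable borel"
  unfolding gauss_def by measurable

lemma gauss_pos: "0 < gauss x" and gauss_le_1: "gauss x \<le> 1"
  by (auto simp: gauss_def)

lemma gauss_minus [simp]: "gauss (- x) = gauss x"
  by (simp add: gauss_def)

lemma continuous_gauss: "continuous_on UNIV gauss"
  unfolding gauss_def by (intro continuous_intros) auto

lemma cnj_measurable [measurable]: "cnj \<in> borel_measurable borel"
  by (intro borel_measurable_continuous_onI continuous_intros)

lemma gauss_lebesgue_measurable [measurable]:
  "(\<lambda>x::'a::euclidean_space. gauss (c *\<^sub>R x)) \<in> borel_measurable lebesgue"
  by (rule measurable_completion) simp

text \<open>Since \<open>gauss 0 = 1\<close>, wide dilations are summability factors. The scales
  form a sequence so that Fatou's lemma and dominated convergence apply.\<close>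

lemma gauss_scaled_tendsto_1: "(\<lambda>k. gauss ((1 / real (Suc k)) *\<^sub>R x)) \<longlonglongrightarrow> 1"
proof -
  have "(\<lambda>k. (1 / real (Suc k)) *\<^sub>R x) \<longlonglongrightarrow> 0 *\<^sub>R x"
    by (intro tendsto_intros LIMSEQ_inverse_real_of_nat[unfolded inverse_eq_divide])
  then have "(\<lambda>k. (1 / real (Suc k)) *\<^sub>R x) \<longlonglongrightarrow> 0" by simp
  from continuous_on_tendsto_compose[OF continuous_gauss this]
  show ?thesis by (simp add: gauss_def)
qed

text \<open>This is the characteristic function of the standard normal law, with the density
  normalisation \<open>sqrt (2 * pi)\<close> undone.\<close>

lemma fourier_gauss_real:
  shows "integrable lborel (\<lambda>x::real. exp (\<i> * of_real (t * x)) * of_real (exp (- x\<^sup>2 / 2)))"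
    and "(LINT x|lborel. exp (\<i> * of_real (t * x)) * of_real (exp (- x\<^sup>2 / 2)))
        = of_real (sqrt (2 * pi) * exp (- t\<^sup>2 / 2))"
proof -
  have eq: "exp (\<i> * of_real (t * x)) * of_real (exp (- x\<^sup>2 / 2))
      = sqrt (2 * pi) *\<^sub>R (std_normal_density x *\<^sub>R iexp (t * x))" for x
    by (simp add: std_normal_density_def scaleR_conv_of_real)
  have "integrable lborel (\<lambda>x. std_normal_density x)"
    by simp
  then have int: "integrable lborel (\<lambda>x. std_normal_density x *\<^sub>R iexp (t * x))"
    by (rule Bochner_Integration.integrable_bound) auto
  then show "integrable lborel (\<lambda>x::real. exp (\<i> * of_real (t * x)) * of_real (exp (- x\<^sup>2 / 2)))"
    unfolding eq by (rule integrable_scaleR_right)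
  have "(LINT x|lborel. std_normal_density x *\<^sub>R iexp (t * x)) = char std_normal_distribution t"
    unfolding char_def by (subst integral_density) auto
  then show "(LINT x|lborel. exp (\<i> * of_real (t * x)) * of_real (exp (- x\<^sup>2 / 2)))
        = of_real (sqrt (2 * pi) * exp (- t\<^sup>2 / 2))"
    unfolding eq integral_scaleR_right char_std_normal_distribution
    by (simp add: scaleR_conv_of_real)
qed

text \<open>Fubini for products of one-variable functions: \<open>lborel_eq\<close> presents
  Lebesgue measure as the image of a product measure under the map that rebuilds a vector from its
  coordinates.\<close>

lemma
  fixes F :: "'a::euclidean_space \<Rightarrow> real \<Rightarrow> complex"
  assumes "\<And>b. b \<in> Basis \<Longrightarrow> integrable lborel (F b)"
  shows integrable_lborel_prod_Basis: "integrable lborel (\<lambda>x::'a. \<Prod>b\<in>Basis. F b (x \<bullet> b))"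
    and integral_lborel_prod_Basis:
      "(LINT x|lborel. (\<Prod>b\<in>Basis. F b (x \<bullet> b))) = (\<Prod>b\<in>Basis. LINT s|lborel. F b s)"
proof -
  interpret P: product_sigma_finite "\<lambda>_::'a. lborel :: real measure" ..
  let ?T = "\<lambda>f. \<Sum>b\<in>Basis. f b *\<^sub>R (b::'a)"
  have [measurable]: "F b \<in> borel_measurable borel" if "b \<in> Basis" for b
    using borel_measurable_integrable[OF assms[OF that]] by simp
  have T: "?T \<in> measurable (\<Pi>\<^sub>M b\<in>Basis. lborel) borel"
    by measurable
  have eq: "(\<Prod>b\<in>Basis. F b (?T f \<bullet> b)) = (\<Prod>b\<in>Basis. F b (f b))" for f
    by (rule prod.cong) auto
  show "integrable lborel (\<lambda>x::'a. \<Prod>b\<in>Basis. F b (x \<bullet> b))"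
    by (subst lborel_eq, subst integrable_distr_eq[OF T])
       (auto simp: eq intro!: P.product_integrable_prod assms borel_measurable_prod)
  show "(LINT x|lborel. (\<Prod>b\<in>Basis. F b (x \<bullet> b))) = (\<Prod>b\<in>Basis. LINT s|lborel. F b s)"
    by (subst lborel_eq, subst integral_distr[OF T])
       (auto simp: eq intro!: P.product_integral_prod assms borel_measurable_prod)
qed

text \<open>The character and the Gaussian both factor over the coordinates, which reduces the
  transform to the one-dimensional one.\<close>

lemma
  fixes z :: "'a::euclidean_space"
  shows integrable_fourier_gauss_aux:
      "integrable lborel (\<lambda>x::'a. exp (- \<i> * of_real (x \<bullet> z)) * of_real (gauss x))"
    and fourier_gauss: "fourier_L1 (\<lambda>x. of_real (gauss x)) z
        = of_real (sqrt (2 * pi) ^ DIM('a) * gauss z)"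
proof -
  define F where "F = (\<lambda>(b::'a) s. exp (\<i> * of_real (- (z \<bullet> b) * s)) * complex_of_real (exp (- s\<^sup>2 / 2)))"
  have "exp (- \<i> * of_real (x \<bullet> z)) * of_real (gauss x) = (\<Prod>b\<in>Basis. F b (x \<bullet> b))" for x
  proof -
    have "x \<bullet> z = (\<Sum>b\<in>Basis. (z \<bullet> b) * (x \<bullet> b))"
      by (subst euclidean_inner) (simp add: mult.commute)
    moreover have "(norm x)\<^sup>2 = (\<Sum>b\<in>Basis. (x \<bullet> b)\<^sup>2)"
      by (subst power2_norm_eq_inner, subst euclidean_inner) (simp add: power2_eq_square)
    ultimately show ?thesis
      unfolding F_def gauss_def prod.distrib
      by (simp add: exp_sum[symmetric] sum_negf sum_distrib_left sum_divide_distrib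
          flip: of_real_prod)
  qed
  then have eq: "(\<lambda>x. exp (- \<i> * of_real (x \<bullet> z)) * of_real (gauss x)) = (\<lambda>x. \<Prod>b\<in>Basis. F b (x \<bullet> b))"
    by blast
  have int: "integrable lborel (F b)" for b
    unfolding F_def by (rule fourier_gauss_real)
  show "integrable lborel (\<lambda>x::'a. exp (- \<i> * of_real (x \<bullet> z)) * of_real (gauss x))"
    unfolding eq by (rule integrable_lborel_prod_Basis[OF int])
  have "fourier_L1 (\<lambda>x. of_real (gauss x)) z
      = (LINT x|lborel. exp (- \<i> * of_real (x \<bullet> z)) * complex_of_real (gauss x))"
    unfolding fourier_L1_def by (rule integral_completion) measurable
  also have "\<dots> = (\<Prod>b\<in>Basis. LINT s|lborel. F b s)"
    unfolding eq by (rule integral_lborel_prod_Basis[OF int])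
  also have "\<dots> = (\<Prod>b\<in>(Basis::'a set). of_real (sqrt (2 * pi) * exp (- (z \<bullet> b)\<^sup>2 / 2)))"
    unfolding F_def fourier_gauss_real by simp
  also have "\<dots> = of_real (sqrt (2 * pi) ^ DIM('a) * gauss z)"
  proof -
    have "(norm z)\<^sup>2 = (\<Sum>b\<in>Basis. (z \<bullet> b)\<^sup>2)"
      by (subst power2_norm_eq_inner, subst euclidean_inner) (simp add: power2_eq_square)
    then show ?thesis
      by (simp add: gauss_def prod.distrib exp_sum[symmetric] sum_negf sum_divide_distrib
          flip: of_real_prod of_real_mult)
  qed
  finally show "fourier_L1 (\<lambda>x. of_real (gauss x)) z = of_real (sqrt (2 * pi) ^ DIM('a) * gauss z)" .
qed

lemma integrable_gauss: "integrable lebesgue (gauss :: 'a::euclidean_space \<Rightarrow> real)"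
proof -
  have "integrable lborel (\<lambda>x::'a. complex_of_real (gauss x))"
    using integrable_fourier_gauss_aux[of "0::'a"] by simp
  then have "integrable lborel (gauss :: 'a \<Rightarrow> real)"
    by (simp add: complex_of_real_integrable_eq)
  then show ?thesis by (subst integrable_completion) auto
qed

lemma integral_gauss: "(LINT x|lebesgue. gauss (x::'a::euclidean_space)) = sqrt (2 * pi) ^ DIM('a)"
proof -
  have "complex_of_real (LINT x|lebesgue. gauss (x::'a)) = fourier_L1 (\<lambda>x. of_real (gauss x)) (0::'a)"
    unfolding fourier_L1_def by (simp add: integral_complex_of_real)
  also have "\<dots> = of_real (sqrt (2 * pi) ^ DIM('a))"
    by (simp only: fourier_gauss) (simp add: gauss_def)
  finally show ?thesis using of_real_eq_iff by blast
qed

section \<open>Affine changes of variables\<close>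

lemma
  fixes s :: real and t :: "'a::euclidean_space"
  assumes s: "s \<noteq> 0"
  shows lebesgue_affine_eq: "lebesgue = density (distr lebesgue lebesgue (\<lambda>x::'a. t + s *\<^sub>R x)) (\<lambda>_. ennreal (\<bar>s\<bar> ^ DIM('a)))"
    and measurable_affine_lebesgue: "(\<lambda>x::'a. t + s *\<^sub>R x) \<in> lebesgue \<rightarrow>\<^sub>M lebesgue"
proof -
  have eq: "t + (\<Sum>j\<in>Basis. (s * (x \<bullet> j)) *\<^sub>R j) = t + s *\<^sub>R x" for x :: 'a
    by (simp add: euclidean_representation flip: scaleR_scaleR scaleR_sum_right)
  show "lebesgue = density (distr lebesgue lebesgue (\<lambda>x::'a. t + s *\<^sub>R x)) (\<lambda>_. ennreal (\<bar>s\<bar> ^ DIM('a)))"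
    using lebesgue_affine_euclidean[of "\<lambda>_. s" t] s by (simp add: eq)
  show "(\<lambda>x::'a. t + s *\<^sub>R x) \<in> lebesgue \<rightarrow>\<^sub>M lebesgue"
    using lebesgue_affine_measurable[of "\<lambda>_. s" t] s by (simp add: eq)
qed

text \<open>The factor may be negative: convolutions are unfolded below by y = x - s w, that is,
  with translation x and factor -s.\<close>

lemma integral_lebesgue_affine:
  fixes f :: "'a::euclidean_space \<Rightarrow> complex"
  assumes s: "s \<noteq> 0" and [measurable]: "f \<in> borel_measurable lebesgue"
  shows "(LINT x|lebesgue. f x) = \<bar>s\<bar> ^ DIM('a) *\<^sub>R (LINT x|lebesgue. f (t + s *\<^sub>R x))"
proof -
  note [measurable] = measurable_affine_lebesgue[OF s, of t]
  show ?thesis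
    by (subst lebesgue_affine_eq[OF s, of t])
       (subst integral_density, simp_all add: integral_distr)
qed

lemma nn_integral_lebesgue_affine:
  fixes f :: "'a::euclidean_space \<Rightarrow> ennreal"
  assumes s: "s \<noteq> 0" and [measurable]: "f \<in> borel_measurable lebesgue"
  shows "(\<integral>\<^sup>+x. f x \<partial>lebesgue) = ennreal (\<bar>s\<bar> ^ DIM('a)) * (\<integral>\<^sup>+x. f (t + s *\<^sub>R x) \<partial>lebesgue)"
proof -
  note [measurable] = measurable_affine_lebesgue[OF s, of t]
  show ?thesis
    by (subst lebesgue_affine_eq[OF s, of t])
       (subst nn_integral_density, simp_all add: nn_integral_distr nn_integral_cmult)
qed

section \<open>The Plancherel identity with Gaussian damping\<close>

lemma measurable_fourier_kernel:
  "(\<lambda>z. exp (c * complex_of_real (fst z \<bullet> snd z))) \<in> borel_measurable (borel :: ('a::euclidean_space \<times> 'a) measure)"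
  by (intro borel_measurable_continuous_onI continuous_intros)

lemma cmod_exp_i_real [simp]: "cmod (exp (- (\<i> * complex_of_real x))) = 1"
  using norm_exp_i_times[of "-x"] by simp

lemma fourier_L1_measurable [measurable]:
  fixes f :: "'a::euclidean_space \<Rightarrow> complex"
  assumes [measurable]: "f \<in> borel_measurable lebesgue"
  shows "fourier_L1 f \<in> borel_measurable lebesgue"
proof -
  note [measurable] = measurable_lebesgue_pair[OF measurable_fourier_kernel[of "-\<i>", where 'a='a]]
  have "case_prod (\<lambda>\<xi> x. exp (- \<i> * complex_of_real (x \<bullet> \<xi>)) * f x)
      = (\<lambda>z. exp (- \<i> * complex_of_real (fst z \<bullet> snd z)) * f (snd z))"
    by (simp add: case_prod_beta' inner_commute)
  also have "\<dots> \<in> borel_measurable (lebesgue \<Otimes>\<^sub>M lebesgue)"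
    by measurable
  finally show ?thesis
    unfolding fourier_L1_def[abs_def] by (rule lebesgue.borel_measurable_lebesgue_integral)
qed

lemma integrable_fourier_integrand:
  assumes "integrable lebesgue f"
  shows "integrable lebesgue (\<lambda>x. exp (- \<i> * complex_of_real (x \<bullet> \<xi>)) * f x)"
proof (rule Bochner_Integration.integrable_bound[OF assms])
  have [measurable]: "(\<lambda>x. exp (- \<i> * complex_of_real (x \<bullet> \<xi>))) \<in> borel_measurable lebesgue"
    by (intro measurable_completion) simp
  note [measurable] = borel_measurable_integrable[OF assms]
  show "(\<lambda>x. exp (- \<i> * complex_of_real (x \<bullet> \<xi>)) * f x) \<in> borel_measurable lebesgue"
    by measurable
qed (simp add: norm_mult)

lemma cmod_fourier_L1_le:
  "cmod (fourier_L1 f \<xi>) \<le> (LINT x|lebesgue. cmod (f x))"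
proof -
  have "cmod (fourier_L1 f \<xi>) \<le> (LINT x|lebesgue. cmod (exp (- \<i> * complex_of_real (x \<bullet> \<xi>)) * f x))"
    unfolding fourier_L1_def by (rule integral_norm_bound)
  then show ?thesis by (simp add: norm_mult)
qed

lemma fourier_gauss_scaled:
  fixes z :: "'a::euclidean_space"
  assumes s: "s > 0"
  shows "fourier_L1 (\<lambda>x. of_real (gauss (s *\<^sub>R x))) z
      = of_real ((sqrt (2 * pi) / s) ^ DIM('a) * gauss (z /\<^sub>R s))"
proof -
  have "fourier_L1 (\<lambda>x. of_real (gauss (s *\<^sub>R x))) z = \<bar>1 / s\<bar> ^ DIM('a) *\<^sub>R
      (LINT x|lebesgue. exp (- \<i> * complex_of_real ((0 + (1 / s) *\<^sub>R x) \<bullet> z)) * of_real (gauss (s *\<^sub>R (0 + (1 / s) *\<^sub>R x))))"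
    unfolding fourier_L1_def using s
    by (intro integral_lebesgue_affine measurable_completion) auto
  also have "(LINT x|lebesgue. exp (- \<i> * complex_of_real ((0 + (1 / s) *\<^sub>R x) \<bullet> z)) * of_real (gauss (s *\<^sub>R (0 + (1 / s) *\<^sub>R x))))
      = fourier_L1 (\<lambda>x. of_real (gauss x)) (z /\<^sub>R s)"
    unfolding fourier_L1_def using s by (simp add: divide_inverse mult.commute)
  finally show ?thesis
    using s by (simp add: fourier_gauss scaleR_conv_of_real power_divide)
qed

lemma integrable_gauss_scaled:
  assumes s: "s > 0"
  shows "integrable lebesgue (\<lambda>x::'a::euclidean_space. complex_of_real (gauss (s *\<^sub>R x)))"
proof (rule integrableI_bounded)
  have "(\<integral>\<^sup>+x. ennreal (gauss (x::'a)) \<partial>lebesgue)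
      = ennreal (\<bar>s\<bar> ^ DIM('a)) * (\<integral>\<^sup>+x. ennreal (gauss (0 + s *\<^sub>R (x::'a))) \<partial>lebesgue)"
    using s by (intro nn_integral_lebesgue_affine measurable_completion) auto
  moreover have "(\<integral>\<^sup>+x. ennreal (gauss (x::'a)) \<partial>lebesgue) < \<infinity>"
    using integrable_gauss[where 'a='a] by (simp add: integrable_iff_bounded gauss_def)
  ultimately have "(\<integral>\<^sup>+x. ennreal (gauss (s *\<^sub>R (x::'a))) \<partial>lebesgue) < \<infinity>"
    using s by (auto simp: ennreal_mult_less_top)
  then show "(\<integral>\<^sup>+x. ennreal (norm (complex_of_real (gauss (s *\<^sub>R (x::'a))))) \<partial>lebesgue) < \<infinity>"
    by (simp add: gauss_def)
qed (intro measurable_completion, simp)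

text \<open>The factor \<open>gauss (s *\<^sub>R \<xi>)\<close> makes the multiple integral
  absolutely convergent. Write the squared modulus as the transform times its conjugate; two uses of
  Fubini move both exponentials onto the Gaussian, whose transform is a kernel that concentrates on
  the diagonal x = y as s tends to 0.\<close>

lemma Plancherel_gauss:
  fixes f :: "'a::euclidean_space \<Rightarrow> complex"
  assumes f: "integrable lebesgue f" and s: "s > 0"
  shows "(LINT \<xi>|lebesgue. complex_of_real ((cmod (fourier_L1 f \<xi>))\<^sup>2 * gauss (s *\<^sub>R \<xi>)))
       = (LINT x|lebesgue. f x * (LINT y|lebesgue. cnj (f y) *
            of_real ((sqrt (2 * pi) / s) ^ DIM('a) * gauss ((x - y) /\<^sub>R s))))"
proof -
  define g where "g \<xi> = complex_of_real (gauss (s *\<^sub>R \<xi>))" for \<xi> :: 'a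
  have g: "integrable lebesgue g"
    unfolding g_def by (rule integrable_gauss_scaled[OF s])
  note [measurable] = borel_measurable_integrable[OF f] borel_measurable_integrable[OF g]
  define M where "M = (LINT x|lebesgue. cmod (f x))"
  have gf: "integrable lebesgue (\<lambda>\<xi>. cnj (fourier_L1 f \<xi>) * g \<xi>)"
  proof (rule Bochner_Integration.integrable_bound[OF integrable_scaleR_right[OF g, of M]])
    have "cmod (fourier_L1 f \<xi>) \<le> \<bar>M\<bar>" for \<xi>
      using cmod_fourier_L1_le[of f \<xi>] by (simp add: M_def)
    then show "AE x in lebesgue. cmod (cnj (fourier_L1 f x) * g x) \<le> cmod (M *\<^sub>R g x)"
      by (intro AE_I2) (simp add: norm_mult mult_right_mono)
  qed measurable
  have K: "cmod (exp (- \<i> * complex_of_real (fst z \<bullet> snd z))) \<le> 1"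
    and K': "cmod (exp (\<i> * complex_of_real (fst z \<bullet> snd z))) \<le> 1" for z :: "'a \<times> 'a"
    by auto
  have inner: "(LINT \<xi>|lebesgue. exp (- \<i> * complex_of_real (x \<bullet> \<xi>)) * (cnj (fourier_L1 f \<xi>) * g \<xi>))
      = (LINT y|lebesgue. cnj (f y) * of_real ((sqrt (2 * pi) / s) ^ DIM('a) * gauss ((x - y) /\<^sub>R s)))" for x
  proof -
    have cnjf: "cnj (fourier_L1 f \<xi>) = (LINT y|lebesgue. exp (\<i> * complex_of_real (y \<bullet> \<xi>)) * cnj (f y))" for \<xi>
      unfolding fourier_L1_def Bochner_Integration.integral_cnj[symmetric] by (simp add: exp_cnj)
    have int: "integrable lebesgue (\<lambda>x. cnj (f x))" using f by simp
    have Gs: "(LINT \<xi>|lebesgue. exp (\<i> * complex_of_real (y \<bullet> \<xi>)) * (exp (- \<i> * complex_of_real (\<xi> \<bullet> x)) * g \<xi>))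
        = of_real ((sqrt (2 * pi) / s) ^ DIM('a) * gauss ((x - y) /\<^sub>R s))" for y
      unfolding fourier_gauss_scaled[OF s, symmetric] fourier_L1_def g_def mult.assoc[symmetric] exp_add[symmetric]
      by (rule arg_cong[where f="integral\<^sup>L lebesgue"])
         (auto simp: inner_diff_right inner_commute algebra_simps)
    have "(LINT \<xi>|lebesgue. exp (- \<i> * complex_of_real (x \<bullet> \<xi>)) * (cnj (fourier_L1 f \<xi>) * g \<xi>))
      = (LINT \<xi>|lebesgue. (LINT y|lebesgue. exp (\<i> * complex_of_real (y \<bullet> \<xi>)) * cnj (f y)) *
           (exp (- \<i> * complex_of_real (\<xi> \<bullet> x)) * g \<xi>))"
      unfolding cnjf by (simp add: mult_ac inner_commute)
    also have "\<dots> = (LINT y|lebesgue. cnj (f y) * (LINT \<xi>|lebesgue. exp (\<i> * complex_of_real (y \<bullet> \<xi>)) *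
           (exp (- \<i> * complex_of_real (\<xi> \<bullet> x)) * g \<xi>)))"
      using Fubini_kernel[OF int integrable_fourier_integrand[OF g, of x] measurable_fourier_kernel[of "\<i>"] K']
      by simp
    finally show ?thesis unfolding Gs .
  qed
  have "(LINT \<xi>|lebesgue. complex_of_real ((cmod (fourier_L1 f \<xi>))\<^sup>2 * gauss (s *\<^sub>R \<xi>)))
      = (LINT \<xi>|lebesgue. (LINT x|lebesgue. exp (- \<i> * complex_of_real (x \<bullet> \<xi>)) * f x) * (cnj (fourier_L1 f \<xi>) * g \<xi>))"
    unfolding fourier_L1_def[symmetric] g_def mult.assoc[symmetric] complex_norm_square[symmetric] by simp
  also have "\<dots> = (LINT x|lebesgue. f x * (LINT \<xi>|lebesgue. exp (- \<i> * complex_of_real (x \<bullet> \<xi>)) * (cnj (fourier_L1 f \<xi>) * g \<xi>)))"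
    using Fubini_kernel[OF f gf measurable_fourier_kernel[of "-\<i>"] K] by simp
  finally show ?thesis unfolding inner .
qed

text \<open>Extended values allow the inequalities below to be stated before square integrability is
  known.\<close>

definition L2sq :: "('a::euclidean_space \<Rightarrow> complex) \<Rightarrow> ennreal" where
  "L2sq f = (\<integral>\<^sup>+x. ennreal ((cmod (f x))\<^sup>2) \<partial>lebesgue)"

text \<open>The substitution y = x - s w turns the kernel into a multiple of the plain Gaussian. Its
  mass depends on neither s nor x and is the source of the constant
  \<open>(2 * pi) ^ DIM('a)\<close> in the Plancherel estimates.\<close>

lemma nn_integral_gauss_kernel:
  fixes x :: "'a::euclidean_space"
  assumes s: "s > 0"
  shows "(\<integral>\<^sup>+y. ennreal ((sqrt (2 * pi) / s) ^ DIM('a) * gauss ((x - y) /\<^sub>R s)) \<partial>lebesgue) = ennreal ((2 * pi) ^ DIM('a))"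
proof -
  have "(\<integral>\<^sup>+y. ennreal ((sqrt (2 * pi) / s) ^ DIM('a) * gauss ((x - y) /\<^sub>R s)) \<partial>lebesgue)
      = ennreal (\<bar>-s\<bar> ^ DIM('a)) * (\<integral>\<^sup>+w. ennreal ((sqrt (2 * pi) / s) ^ DIM('a) * gauss ((x - (x + (-s) *\<^sub>R w)) /\<^sub>R s)) \<partial>lebesgue)"
    using s by (intro nn_integral_lebesgue_affine measurable_completion) auto
  also have "\<dots> = ennreal (s ^ DIM('a)) * (ennreal ((sqrt (2 * pi) / s) ^ DIM('a)) * (\<integral>\<^sup>+w. ennreal (gauss (w::'a)) \<partial>lebesgue))"
    using s by (simp add: ennreal_mult gauss_pos less_imp_le nn_integral_cmult measurable_completion)
  also have "(\<integral>\<^sup>+w. ennreal (gauss (w::'a)) \<partial>lebesgue) = ennreal (sqrt (2 * pi) ^ DIM('a))"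
    by (subst nn_integral_eq_integral[OF integrable_gauss])
       (auto simp: integral_gauss gauss_pos less_imp_le)
  also have "ennreal (s ^ DIM('a)) * (ennreal ((sqrt (2 * pi) / s) ^ DIM('a)) * ennreal (sqrt (2 * pi) ^ DIM('a)))
      = ennreal ((2 * pi) ^ DIM('a))"
  proof -
    have "s * (sqrt (2 * pi) / s * sqrt (2 * pi)) = 2 * pi" using s by simp
    then have "s ^ DIM('a) * ((sqrt (2 * pi) / s) ^ DIM('a) * sqrt (2 * pi) ^ DIM('a)) = (2 * pi) ^ DIM('a)"
      by (simp only: power_mult_distrib[symmetric])
    then show ?thesis
      using s by (subst ennreal_mult[symmetric] ennreal_mult[symmetric], simp, simp)+ (simp only:)
  qed
  finally show ?thesis .
qed

text \<open>A function that is not integrable has Bochner integral 0, so that case is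
  trivial.\<close>

lemma ennreal_norm_integral_le:
  fixes f :: "'a \<Rightarrow> complex"
  shows "ennreal (cmod (integral\<^sup>L M f)) \<le> (\<integral>\<^sup>+x. ennreal (cmod (f x)) \<partial>M)"
  by (cases "integrable M f") (auto simp: integral_norm_bound_ennreal not_integrable_integral_eq)

text \<open>A Schur test followed by Fatou's lemma. By \<open>Plancherel_gauss\<close> the damped
  norm of the transform is a quadratic form in \<open>f\<close> whose kernel is nonnegative,
  symmetric and of the same mass in each variable. Bounding the product of two values of |f| by half
  the sum of their squares gives that mass times \<open>L2sq f\<close>, uniformly in the damping,
  which is then removed.\<close>

lemma Plancherel_le:
  fixes f :: "'a::euclidean_space \<Rightarrow> complex"
  assumes f: "integrable lebesgue f"
  shows "L2sq (fourier_L1 f) \<le> ennreal ((2 * pi) ^ DIM('a)) * L2sq f"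
proof -
  note [measurable] = borel_measurable_integrable[OF f]
  let ?C = "ennreal ((2 * pi) ^ DIM('a))"
  have main: "(\<integral>\<^sup>+\<xi>. ennreal ((cmod (fourier_L1 f \<xi>))\<^sup>2 * gauss (s *\<^sub>R \<xi>)) \<partial>lebesgue) \<le> ?C * L2sq f"
    if s: "s > 0" for s
  proof -
    define G where "G z = (sqrt (2 * pi) / s) ^ DIM('a) * gauss ((fst z - snd z) /\<^sub>R s)" for z :: "'a \<times> 'a"
    have Gnn: "0 \<le> G z" for z using s by (simp add: G_def gauss_pos less_imp_le)
    have [measurable]: "G \<in> borel_measurable (lebesgue \<Otimes>\<^sub>M lebesgue)"
      unfolding G_def[abs_def] gauss_def
      by (intro measurable_lebesgue_pair borel_measurable_continuous_onI continuous_intros) auto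
    have [measurable]: "(\<lambda>y. G (x, y)) \<in> borel_measurable lebesgue" for x
      unfolding G_def by (rule measurable_completion) simp
    have split_G: "ennreal (r\<^sup>2 / 2 * G z) = ennreal (r\<^sup>2 / 2) * ennreal (G z)" for r z
      by (rule ennreal_mult) (simp_all add: Gnn)
    have hG: "cmod (cnj (f y) * of_real (G (x, y))) = cmod (f y) * G (x, y)" for x y
      by (simp add: norm_mult Gnn)
    have G1: "(\<integral>\<^sup>+y. ennreal (G (x, y)) \<partial>lebesgue) = ?C" for x
      unfolding G_def using nn_integral_gauss_kernel[OF s, of x] by simp
    have G2: "(\<integral>\<^sup>+x. ennreal (G (x, y)) \<partial>lebesgue) = ?C" for y
    proof -
      have "G (x, y) = G (y, x)" for x
        using gauss_minus[of "(x - y) /\<^sub>R s"] unfolding G_def fst_conv snd_conv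
        by (metis minus_diff_eq scaleR_minus_right)
      then show ?thesis using G1[of y] by simp
    qed
    have int: "integrable lebesgue (\<lambda>\<xi>. (cmod (fourier_L1 f \<xi>))\<^sup>2 * gauss (s *\<^sub>R \<xi>))"
    proof (rule Bochner_Integration.integrable_bound[OF integrable_scaleR_right[OF integrable_gauss_scaled[OF s], of "(LINT x|lebesgue. cmod (f x))\<^sup>2"]])
      show "AE x in lebesgue. norm ((cmod (fourier_L1 f x))\<^sup>2 * gauss (s *\<^sub>R x))
          \<le> norm ((LINT x|lebesgue. cmod (f x))\<^sup>2 *\<^sub>R complex_of_real (gauss (s *\<^sub>R x)))"
        by (intro AE_I2) (auto simp: abs_mult intro!: mult_right_mono power_mono cmod_fourier_L1_le)
      show "(\<lambda>\<xi>. (cmod (fourier_L1 f \<xi>))\<^sup>2 * gauss (s *\<^sub>R \<xi>)) \<in> borel_measurable lebesgue"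
        by measurable
    qed
    have "(\<integral>\<^sup>+\<xi>. ennreal ((cmod (fourier_L1 f \<xi>))\<^sup>2 * gauss (s *\<^sub>R \<xi>)) \<partial>lebesgue)
        = ennreal (LINT \<xi>|lebesgue. (cmod (fourier_L1 f \<xi>))\<^sup>2 * gauss (s *\<^sub>R \<xi>))"
      by (rule nn_integral_eq_integral[OF int]) (simp add: gauss_pos less_imp_le)
    also have "\<dots> \<le> ennreal (cmod (complex_of_real (LINT \<xi>|lebesgue. (cmod (fourier_L1 f \<xi>))\<^sup>2 * gauss (s *\<^sub>R \<xi>))))"
      by (intro ennreal_leI) simp
    also have "complex_of_real (LINT \<xi>|lebesgue. (cmod (fourier_L1 f \<xi>))\<^sup>2 * gauss (s *\<^sub>R \<xi>))
        = (LINT x|lebesgue. f x * (LINT y|lebesgue. cnj (f y) * of_real (G (x, y))))"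
      unfolding integral_complex_of_real[symmetric] G_def fst_conv snd_conv
      by (rule Plancherel_gauss[OF f s])
    also have "ennreal (cmod \<dots>) \<le> (\<integral>\<^sup>+x. ennreal (cmod (f x)) *
        (\<integral>\<^sup>+y. ennreal (cmod (cnj (f y) * of_real (G (x, y)))) \<partial>lebesgue) \<partial>lebesgue)"
      by (rule order_trans[OF ennreal_norm_integral_le], rule nn_integral_mono)
         (subst norm_mult, subst ennreal_mult, simp_all only: norm_ge_zero mult_left_mono ennreal_norm_integral_le zero_le)
    also have "\<dots> = (\<integral>\<^sup>+x. \<integral>\<^sup>+y. ennreal (cmod (f x) * (cmod (f y) * G (x, y))) \<partial>lebesgue \<partial>lebesgue)"
      unfolding hG by (rule nn_integral_cong, subst nn_integral_cmult[symmetric])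
         (simp_all only: ennreal_mult[OF norm_ge_zero mult_nonneg_nonneg[OF norm_ge_zero Gnn]], measurable)
    also have "\<dots> \<le> (\<integral>\<^sup>+x. \<integral>\<^sup>+y. ennreal ((cmod (f x))\<^sup>2 / 2 * G (x, y)) + ennreal ((cmod (f y))\<^sup>2 / 2 * G (x, y)) \<partial>lebesgue \<partial>lebesgue)"
    proof (intro nn_integral_mono)
      fix x y
      have "cmod (f x) * cmod (f y) \<le> (cmod (f x))\<^sup>2 / 2 + (cmod (f y))\<^sup>2 / 2"
        using sum_squares_bound[of "cmod (f x)" "cmod (f y)"] by simp
      from mult_right_mono[OF this Gnn[of "(x,y)"]]
      have le: "cmod (f x) * (cmod (f y) * G (x, y))
          \<le> (cmod (f x))\<^sup>2 / 2 * G (x, y) + (cmod (f y))\<^sup>2 / 2 * G (x, y)"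
        by (simp only: ring_distribs mult.assoc)
      have "0 \<le> (cmod (f x))\<^sup>2 / 2 * G (x, y)" "0 \<le> (cmod (f y))\<^sup>2 / 2 * G (x, y)"
        by (simp_all only: mult_nonneg_nonneg Gnn zero_le_power2 divide_nonneg_pos zero_less_numeral)
      then show "ennreal (cmod (f x) * (cmod (f y) * G (x, y)))
          \<le> ennreal ((cmod (f x))\<^sup>2 / 2 * G (x, y)) + ennreal ((cmod (f y))\<^sup>2 / 2 * G (x, y))"
        using ennreal_leI[OF le] by (simp only: ennreal_plus)
    qed
    also have "\<dots> = (\<integral>\<^sup>+x. \<integral>\<^sup>+y. ennreal ((cmod (f x))\<^sup>2 / 2 * G (x, y)) \<partial>lebesgue \<partial>lebesgue)
        + (\<integral>\<^sup>+x. \<integral>\<^sup>+y. ennreal ((cmod (f y))\<^sup>2 / 2 * G (x, y)) \<partial>lebesgue \<partial>lebesgue)"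
      by (subst nn_integral_add[symmetric], measurable, subst nn_integral_add, simp_all)
    also have "(\<integral>\<^sup>+x. \<integral>\<^sup>+y. ennreal ((cmod (f y))\<^sup>2 / 2 * G (x, y)) \<partial>lebesgue \<partial>lebesgue)
        = (\<integral>\<^sup>+y. \<integral>\<^sup>+x. ennreal ((cmod (f y))\<^sup>2 / 2 * G (x, y)) \<partial>lebesgue \<partial>lebesgue)"
      by (rule lebesgue_pair.Fubini'[symmetric]) simp
    also have "\<dots> = (\<integral>\<^sup>+y. ?C * ennreal ((cmod (f y))\<^sup>2 / 2) \<partial>lebesgue)"
      unfolding split_G by (rule nn_integral_cong, subst nn_integral_cmult, measurable) (simp only: G2 mult.commute)
    also have "(\<integral>\<^sup>+x. \<integral>\<^sup>+y. ennreal ((cmod (f x))\<^sup>2 / 2 * G (x, y)) \<partial>lebesgue \<partial>lebesgue)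
        = (\<integral>\<^sup>+y. ?C * ennreal ((cmod (f y))\<^sup>2 / 2) \<partial>lebesgue)"
      unfolding split_G by (rule nn_integral_cong, subst nn_integral_cmult, measurable) (simp only: G1 mult.commute)
    also have "(\<integral>\<^sup>+y. ?C * ennreal ((cmod (f y))\<^sup>2 / 2) \<partial>lebesgue) + (\<integral>\<^sup>+y. ?C * ennreal ((cmod (f y))\<^sup>2 / 2) \<partial>lebesgue)
        = (\<integral>\<^sup>+y. ?C * ennreal ((cmod (f y))\<^sup>2) \<partial>lebesgue)"
      by (subst nn_integral_add[symmetric], measurable)
         (simp only: distrib_left[symmetric] ennreal_plus[symmetric] divide_nonneg_pos zero_less_numeral zero_le_power2 field_sum_of_halves)
    also have "\<dots> = ?C * L2sq f"
      by (simp add: L2sq_def nn_integral_cmult)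
    finally show ?thesis .
  qed
  have lim: "(\<lambda>k. ennreal ((cmod (fourier_L1 f \<xi>))\<^sup>2 * gauss ((1 / real (Suc k)) *\<^sub>R \<xi>))) \<longlonglongrightarrow> ennreal ((cmod (fourier_L1 f \<xi>))\<^sup>2)" for \<xi>
    using tendsto_mult_left[OF gauss_scaled_tendsto_1[of \<xi>], of "(cmod (fourier_L1 f \<xi>))\<^sup>2"] by simp
  have "L2sq (fourier_L1 f) = (\<integral>\<^sup>+\<xi>. liminf (\<lambda>k. ennreal ((cmod (fourier_L1 f \<xi>))\<^sup>2 * gauss ((1 / real (Suc k)) *\<^sub>R \<xi>))) \<partial>lebesgue)"
    unfolding L2sq_def by (intro nn_integral_cong) (simp only: lim_imp_Liminf[OF _ lim] trivial_limit_sequentially not_False_eq_True)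
  also have "\<dots> \<le> liminf (\<lambda>k. \<integral>\<^sup>+\<xi>. ennreal ((cmod (fourier_L1 f \<xi>))\<^sup>2 * gauss ((1 / real (Suc k)) *\<^sub>R \<xi>)) \<partial>lebesgue)"
    by (intro nn_integral_liminf) measurable
  also have "\<dots> \<le> liminf (\<lambda>k::nat. ?C * L2sq f)"
    by (intro Liminf_mono always_eventually allI main) simp
  also have "\<dots> = ?C * L2sq f"
    by (rule Liminf_const) simp
  finally show ?thesis .
qed

section \<open>From bounded continuous functions to all square integrable ones\<close>

lemma integrable_cmod_sq_iff:
  assumes "f \<in> borel_measurable lebesgue"
  shows "integrable lebesgue (\<lambda>x. (cmod (f x))\<^sup>2) \<longleftrightarrow> L2sq f < \<infinity>"
  using assms by (auto simp: L2sq_def integrable_iff_bounded)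

lemma L2sq_eq_integral:
  assumes "integrable lebesgue (\<lambda>x. (cmod (f x))\<^sup>2)"
  shows "L2sq f = ennreal (LINT x|lebesgue. (cmod (f x))\<^sup>2)"
  unfolding L2sq_def by (rule nn_integral_eq_integral[OF assms]) simp

text \<open>Continuity makes the mollified function converge at every point, and the bound
  \<open>M\<close> dominates it, so both sides of \<open>Plancherel_gauss\<close> converge as the
  damping disappears. The upper inequality supplies the dominating function on the frequency
  side.\<close>

lemma Plancherel_continuous:
  fixes f :: "'a::euclidean_space \<Rightarrow> complex"
  assumes f: "integrable lebesgue f" and cont: "continuous_on UNIV f" and M: "\<And>x. cmod (f x) \<le> M"
  shows "L2sq (fourier_L1 f) = ennreal ((2 * pi) ^ DIM('a)) * L2sq f"
proof -
  note [measurable] = borel_measurable_integrable[OF f]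
  have [measurable]: "f \<in> borel_measurable borel"
    by (rule borel_measurable_continuous_onI[OF cont])
  have Mnn: "0 \<le> M" using M[of 0] norm_ge_zero order_trans by blast
  \<comment> \<open>\<open>c\<close> is the integral of the Gaussian. One factor \<open>c\<close>
    stems from the normalisation of the kernel, the other from integrating the Gaussian, so their
    product is the Plancherel constant.\<close>
  define c where "c = sqrt (2 * pi) ^ DIM('a)"
  have cc: "c * c = (2 * pi) ^ DIM('a)"
    unfolding c_def power_mult_distrib[symmetric] by (simp only: real_sqrt_mult_self abs_of_nonneg[OF mult_nonneg_nonneg[OF zero_le_numeral pi_ge_zero]])
  define s where "s k = 1 / real (Suc k)" for k
  have s: "0 < s k" for k by (simp add: s_def)
  have s0: "s \<longlonglongrightarrow> 0"
    unfolding s_def using LIMSEQ_inverse_real_of_nat by (simp add: inverse_eq_divide)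
  have f2: "integrable lebesgue (\<lambda>x. (cmod (f x))\<^sup>2)"
  proof (rule Bochner_Integration.integrable_bound[OF integrable_scaleR_right[OF f, of M]])
    show "AE x in lebesgue. norm ((cmod (f x))\<^sup>2) \<le> norm (M *\<^sub>R f x)"
      using M Mnn by (intro AE_I2) (simp add: power2_eq_square mult_right_mono)
  qed measurable
  then have "L2sq f < \<infinity>" by (simp add: integrable_cmod_sq_iff)
  then have "L2sq (fourier_L1 f) < \<infinity>"
    using Plancherel_le[OF f] by (simp add: ennreal_mult_less_top order_le_less_trans)
  then have hat2: "integrable lebesgue (\<lambda>x. (cmod (fourier_L1 f x))\<^sup>2)"
    by (simp add: integrable_cmod_sq_iff)
  define I where "I k x = (LINT y|lebesgue. cnj (f y) *
      of_real ((sqrt (2 * pi) / s k) ^ DIM('a) * gauss ((x - y) /\<^sub>R s k)))" for k x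
  \<comment> \<open>After y = x - s w the weight no longer depends on \<open>k\<close>; only the
    argument of \<open>f\<close> does, as dominated convergence requires.\<close>
  have I_eq: "I k x = (LINT w|lebesgue. cnj (f (x - s k *\<^sub>R w)) * of_real (c * gauss w))" for k x
  proof -
    have "I k x = \<bar>- s k\<bar> ^ DIM('a) *\<^sub>R (LINT w|lebesgue. cnj (f (x + (- s k) *\<^sub>R w)) *
        of_real ((sqrt (2 * pi) / s k) ^ DIM('a) * gauss ((x - (x + (- s k) *\<^sub>R w)) /\<^sub>R s k)))"
      unfolding I_def using s[of k] by (intro integral_lebesgue_affine measurable_completion) auto
    also have "\<dots> = (LINT w|lebesgue. \<bar>- s k\<bar> ^ DIM('a) *\<^sub>R (cnj (f (x + (- s k) *\<^sub>R w)) *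
        of_real ((sqrt (2 * pi) / s k) ^ DIM('a) * gauss ((x - (x + (- s k) *\<^sub>R w)) /\<^sub>R s k))))"
      by simp
    also have "\<dots> = (LINT w|lebesgue. cnj (f (x - s k *\<^sub>R w)) * of_real (c * gauss w))"
      using s[of k] by (intro Bochner_Integration.integral_cong refl)
        (simp add: scaleR_conv_of_real power_divide c_def)
    finally show ?thesis .
  qed
  have gi: "integrable lebesgue (\<lambda>w::'a. M * (c * gauss w))"
    by (intro integrable_mult_right integrable_gauss)
  have gi_eq: "(LINT w|lebesgue. M * (c * gauss (w::'a))) = M * (c * c)"
    by (simp add: integral_gauss c_def)
  have cpos: "0 < c" by (simp add: c_def)
  have bound: "cmod (cnj (f u) * of_real (c * gauss w)) \<le> M * (c * gauss w)" for u w :: 'a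
    using M[of u] cpos gauss_pos[of w]
    by (simp add: norm_mult abs_mult less_imp_le mult_right_mono)
  have I_lim: "(\<lambda>k. I k x) \<longlonglongrightarrow> cnj (f x) * of_real (c * c)" for x
  proof -
    have "(\<lambda>k. I k x) \<longlonglongrightarrow> (LINT w|lebesgue. cnj (f x) * of_real (c * gauss (w::'a)))"
      unfolding I_eq
    proof (rule integral_dominated_convergence[where w="\<lambda>w. M * (c * gauss w)"])
      show "AE w in lebesgue. (\<lambda>k. cnj (f (x - s k *\<^sub>R w)) * of_real (c * gauss w))
          \<longlonglongrightarrow> cnj (f x) * of_real (c * gauss w)"
      proof (intro AE_I2 tendsto_intros)
        fix w
        have "(\<lambda>k. x - s k *\<^sub>R w) \<longlonglongrightarrow> x - 0 *\<^sub>R w"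
          by (intro tendsto_intros s0)
        then have "(\<lambda>k. x - s k *\<^sub>R w) \<longlonglongrightarrow> x" by simp
        from continuous_on_tendsto_compose[OF cont this]
        show "(\<lambda>k. f (x - s k *\<^sub>R w)) \<longlonglongrightarrow> f x" by simp
      qed
      show "AE w in lebesgue. cmod (cnj (f (x - s k *\<^sub>R w)) * of_real (c * gauss w)) \<le> M * (c * gauss w)" for k
        by (intro AE_I2 bound)
    qed (use gi in \<open>auto intro!: measurable_completion\<close>)
    also have "(LINT w|lebesgue. cnj (f x) * of_real (c * gauss (w::'a))) = cnj (f x) * of_real (c * c)"
      by (simp add: integral_gauss c_def)
    finally show ?thesis .
  qed
  have I_bound: "cmod (I k x) \<le> M * (c * c)" for k x
  proof -
    have "cmod (I k x) \<le> (LINT w|lebesgue. M * (c * gauss (w::'a)))"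
      unfolding I_eq using cpos Mnn
      by (intro order_trans[OF integral_norm_bound integral_mono'[OF gi bound]])
         (simp add: gauss_pos less_imp_le)
    then show ?thesis unfolding gi_eq .
  qed
  have I_meas [measurable]: "I k \<in> borel_measurable lebesgue" for k
  proof -
    have [measurable]: "(\<lambda>z::'a\<times>'a. gauss ((fst z - snd z) /\<^sub>R s k)) \<in> borel_measurable (lebesgue \<Otimes>\<^sub>M lebesgue)"
      unfolding gauss_def
      by (intro measurable_lebesgue_pair borel_measurable_continuous_onI continuous_intros) auto
    have [measurable]: "(\<lambda>y. cnj (f y)) \<in> borel_measurable lebesgue"
      by (intro measurable_completion) simp
    have "(\<lambda>(x, y). cnj (f y) * of_real ((sqrt (2 * pi) / s k) ^ DIM('a) * gauss ((x - y) /\<^sub>R s k)))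
      = (\<lambda>z. cnj (f (snd z)) * of_real ((sqrt (2 * pi) / s k) ^ DIM('a) * gauss ((fst z - snd z) /\<^sub>R s k)))"
      by (simp add: case_prod_beta')
    also have "\<dots> \<in> borel_measurable (lebesgue \<Otimes>\<^sub>M lebesgue)"
      by measurable
    finally show ?thesis
      unfolding I_def[abs_def] by (rule lebesgue.borel_measurable_lebesgue_integral)
  qed
  have lim1: "(\<lambda>k. LINT x|lebesgue. f x * I k x) \<longlonglongrightarrow> (LINT x|lebesgue. f x * (cnj (f x) * of_real (c * c)))"
  proof (rule integral_dominated_convergence[where w="\<lambda>x. cmod (f x) * (M * (c * c))"])
    show "AE x in lebesgue. (\<lambda>k. f x * I k x) \<longlonglongrightarrow> f x * (cnj (f x) * of_real (c * c))"
      by (intro AE_I2 tendsto_intros I_lim)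
    show "AE x in lebesgue. cmod (f x * I k x) \<le> cmod (f x) * (M * (c * c))" for k
      using I_bound by (intro AE_I2) (simp add: norm_mult mult_left_mono)
    show "integrable lebesgue (\<lambda>x. cmod (f x) * (M * (c * c)))"
      by (intro integrable_mult_left integrable_norm f)
    show "(\<lambda>x. f x * (cnj (f x) * of_real (c * c))) \<in> borel_measurable lebesgue"
      by (intro measurable_completion) simp
  qed measurable
  have "(\<lambda>k. LINT x|lebesgue. f x * I k x) \<longlonglongrightarrow> (LINT \<xi>|lebesgue. complex_of_real ((cmod (fourier_L1 f \<xi>))\<^sup>2))"
    unfolding I_def Plancherel_gauss[OF f s, symmetric]
  proof (rule integral_dominated_convergence[where w="\<lambda>\<xi>. (cmod (fourier_L1 f \<xi>))\<^sup>2"])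
    show "AE \<xi> in lebesgue. (\<lambda>k. complex_of_real ((cmod (fourier_L1 f \<xi>))\<^sup>2 * gauss (s k *\<^sub>R \<xi>)))
        \<longlonglongrightarrow> complex_of_real ((cmod (fourier_L1 f \<xi>))\<^sup>2)"
    proof (intro AE_I2 tendsto_of_real)
      fix \<xi> :: 'a
      from tendsto_mult_left[OF gauss_scaled_tendsto_1[of \<xi>], of "(cmod (fourier_L1 f \<xi>))\<^sup>2"]
      show "(\<lambda>k. (cmod (fourier_L1 f \<xi>))\<^sup>2 * gauss (s k *\<^sub>R \<xi>)) \<longlonglongrightarrow> (cmod (fourier_L1 f \<xi>))\<^sup>2"
        by (simp add: s_def)
    qed
    show "AE \<xi> in lebesgue. cmod (complex_of_real ((cmod (fourier_L1 f \<xi>))\<^sup>2 * gauss (s k *\<^sub>R \<xi>))) \<le> (cmod (fourier_L1 f \<xi>))\<^sup>2" for k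
      by (intro AE_I2, simp only: norm_of_real abs_mult)
        (simp add: gauss_pos less_imp_le mult_left_le gauss_le_1)
    show "integrable lebesgue (\<lambda>\<xi>. (cmod (fourier_L1 f \<xi>))\<^sup>2)" by (rule hat2)
  qed measurable
  moreover have "f x * (cnj (f x) * of_real (c * c)) = complex_of_real ((c * c) * (cmod (f x))\<^sup>2)" for x
    by (simp only: mult.assoc[symmetric] complex_norm_square[symmetric] of_real_mult[symmetric])
       (simp only: mult_ac)
  ultimately have "(LINT \<xi>|lebesgue. complex_of_real ((cmod (fourier_L1 f \<xi>))\<^sup>2))
      = (LINT x|lebesgue. complex_of_real ((c * c) * (cmod (f x))\<^sup>2))"
    using LIMSEQ_unique[OF _ lim1] by (simp only:)
  then have "(LINT \<xi>|lebesgue. (cmod (fourier_L1 f \<xi>))\<^sup>2) = (c * c) * (LINT x|lebesgue. (cmod (f x))\<^sup>2)"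
    unfolding integral_complex_of_real of_real_eq_iff by simp
  then show ?thesis
    unfolding L2sq_eq_integral[OF f2] L2sq_eq_integral[OF hat2] cc
    by (simp only: ennreal_mult[OF zero_le_power[OF mult_nonneg_nonneg[OF zero_le_numeral pi_ge_zero]]
        Bochner_Integration.integral_nonneg[OF zero_le_power2]])
qed

text \<open>The factor 2 is the price of avoiding square roots in the extended reals. Its repeated
  use produces the constants 4 and 8 in the Plancherel bounds below.\<close>

lemma L2sq_add_le:
  assumes [measurable]: "f \<in> borel_measurable lebesgue" "g \<in> borel_measurable lebesgue"
    and h: "\<And>x. h x = f x + g x"
  shows "L2sq h \<le> 2 * L2sq f + 2 * L2sq g"
proof -
  have "L2sq h \<le> (\<integral>\<^sup>+x. 2 * ennreal ((cmod (f x))\<^sup>2) + 2 * ennreal ((cmod (g x))\<^sup>2) \<partial>lebesgue)"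
    unfolding L2sq_def
  proof (rule nn_integral_mono)
    fix x
    have "(cmod (h x))\<^sup>2 \<le> (cmod (f x) + cmod (g x))\<^sup>2"
      unfolding h by (intro power_mono norm_triangle_ineq norm_ge_zero)
    also have "\<dots> \<le> 2 * (cmod (f x))\<^sup>2 + 2 * (cmod (g x))\<^sup>2"
      using sum_squares_bound[of "cmod (f x)" "cmod (g x)"] by (simp add: power2_sum)
    finally show "ennreal ((cmod (h x))\<^sup>2) \<le> 2 * ennreal ((cmod (f x))\<^sup>2) + 2 * ennreal ((cmod (g x))\<^sup>2)"
      by (simp add: ennreal_mult[symmetric] ennreal_plus[symmetric] ennreal_leI
          flip: ennreal_numeral del: ennreal_plus)
  qed
  also have "\<dots> = 2 * L2sq f + 2 * L2sq g"
    unfolding L2sq_def by (simp add: nn_integral_add nn_integral_cmult)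
  finally show ?thesis .
qed

lemma integrable_bounded_support:
  fixes f :: "'a::euclidean_space \<Rightarrow> complex"
  assumes [measurable]: "f \<in> borel_measurable lebesgue"
    and M: "\<And>x. cmod (f x) \<le> M" and supp: "\<And>x. r < norm x \<Longrightarrow> f x = 0"
  shows "integrable lebesgue f"
proof (rule Bochner_Integration.integrable_bound)
  show "integrable lebesgue (\<lambda>x. M *\<^sub>R indicator (cball (0::'a) r) x :: real)"
    by (intro integrable_scaleR_right) (simp add: integrable_indicator_iff emeasure_lborel_cball_finite[unfolded infinity_ennreal_def])
  show "AE x in lebesgue. norm (f x) \<le> norm (M *\<^sub>R indicator (cball (0::'a) r) x :: real)"
    using M supp by (intro AE_I2) (auto simp: indicator_def not_le intro: order_trans[OF _ abs_ge_self])
qed fact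


text \<open>First \<open>f\<close> is truncated in size and support. The truncation is an almost
  everywhere limit of continuous functions; forcing these to respect essentially the same size and
  support gives a common dominating function.\<close>

lemma L2_dense_continuous:
  fixes f :: "'a::euclidean_space \<Rightarrow> complex"
  assumes [measurable]: "f \<in> borel_measurable lebesgue" and f2: "L2sq f < \<infinity>" and e: "0 < (e::real)"
  obtains h M where "continuous_on UNIV h" "\<And>x. cmod (h x) \<le> M" "integrable lebesgue h"
    "L2sq (\<lambda>x. f x - h x) \<le> ennreal e"
proof -
  \<comment> \<open>There are two errors, truncation and approximation, and
    \<open>L2sq_add_le\<close> doubles each of them.\<close>
  define e4 where "e4 = ennreal (e / 4)"
  have e4: "0 < e4" "4 * e4 = ennreal e"
    using e by (simp_all add: e4_def ennreal_mult[symmetric] flip: ennreal_numeral)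
  define F where "F k x = (if norm x \<le> real k \<and> cmod (f x) \<le> real k then f x else 0)" for k :: nat and x
  have F_meas [measurable]: "F k \<in> borel_measurable lebesgue" for k
  proof -
    have [measurable]: "(\<lambda>x::'a. norm x) \<in> borel_measurable lebesgue"
      by (rule measurable_completion) simp
    show ?thesis unfolding F_def[abs_def] by measurable
  qed
  have "(\<lambda>k. L2sq (\<lambda>x. f x - F k x)) \<longlonglongrightarrow> nn_integral lebesgue (\<lambda>_::'a. 0)"
    unfolding L2sq_def
  proof (rule nn_integral_dominated_convergence[where w="\<lambda>x. ennreal ((cmod (f x))\<^sup>2)"])
    show "AE x in lebesgue. (\<lambda>k. ennreal ((cmod (f x - F k x))\<^sup>2)) \<longlonglongrightarrow> 0"
    proof (intro AE_I2 tendsto_eventually)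
      fix x
      have "\<forall>\<^sub>F k in sequentially. max (norm x) (cmod (f x)) \<le> real k"
        by (rule eventually_compose_filterlim[OF eventually_ge_at_top filterlim_real_sequentially])
      then show "\<forall>\<^sub>F k in sequentially. ennreal ((cmod (f x - F k x))\<^sup>2) = 0"
        by eventually_elim (simp add: F_def)
    qed
    show "AE x in lebesgue. ennreal ((cmod (f x - F k x))\<^sup>2) \<le> ennreal ((cmod (f x))\<^sup>2)" for k
      by (intro AE_I2) (simp add: F_def)
    show "(\<integral>\<^sup>+x. ennreal ((cmod (f x))\<^sup>2) \<partial>lebesgue) < \<infinity>"
      using f2 by (simp add: L2sq_def)
  qed measurable
  then have "(\<lambda>k. L2sq (\<lambda>x. f x - F k x)) \<longlonglongrightarrow> 0" by simp
  from order_tendstoD(2)[OF this e4(1)] obtain k where k: "L2sq (\<lambda>x. f x - F k x) < e4"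
    by (auto simp: eventually_sequentially)
  have "F k measurable_on UNIV"
    by (rule lebesgue_measurable_imp_measurable_on) auto
  then obtain N g where N: "negligible N" and g: "\<And>n. continuous_on UNIV (g n)"
    and lim: "\<And>x. x \<notin> N \<Longrightarrow> (\<lambda>n. g n x) \<longlonglongrightarrow> F k x"
    unfolding measurable_on_def by auto
  \<comment> \<open>A continuous cutoff, equal to 1 on the ball of radius \<open>k\<close> that
    carries \<open>F k\<close> and to 0 outside the ball of radius \<open>k + 1\<close>.\<close>
  define cut where "cut x = max 0 (min 1 (real k + 1 - norm x))" for x :: 'a
  \<comment> \<open>The nearest-point retraction onto a disc is continuous and fixes the values of
    \<open>F k\<close>, so it bounds the approximants without changing their limit.\<close>
  define clip :: "complex \<Rightarrow> complex" where "clip = closest_point (cball 0 (real k))"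
  define h where "h n x = cut x *\<^sub>R clip (g n x)" for n x
  have clip_cont: "continuous_on UNIV clip"
    unfolding clip_def by (rule continuous_on_closest_point) auto
  have clip_bound: "cmod (clip z) \<le> real k" for z
    using closest_point_in_set[of "cball (0::complex) (real k)" z] by (auto simp: clip_def)
  have clip_id: "clip z = z" if "cmod z \<le> real k" for z
    using that by (simp add: clip_def closest_point_self)
  have h_cont: "continuous_on UNIV (h n)" for n
    unfolding h_def[abs_def] cut_def
    by (intro continuous_intros continuous_on_compose2[OF clip_cont g]) auto
  have h_meas [measurable]: "h n \<in> borel_measurable lebesgue" for n
    by (intro measurable_completion) (simp add: borel_measurable_continuous_onI[OF h_cont])
  have h_bound: "cmod (h n x) \<le> real k" for n x
    using mult_mono[of "\<bar>cut x\<bar>" 1 "cmod (clip (g n x))" "real k"] clip_bound[of "g n x"]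
    by (simp add: h_def cut_def)
  have h_supp: "h n x = 0" if "real k + 1 < norm x" for n x
    using that by (simp add: h_def cut_def)
  have h_int: "integrable lebesgue (h n)" for n
    by (rule integrable_bounded_support[OF h_meas h_bound h_supp])
  have F_bound: "cmod (F k x) \<le> real k" for x by (simp add: F_def)
  have F_supp: "F k x = 0" if "real k < norm x" for x using that by (simp add: F_def)
  have "(\<lambda>n. L2sq (\<lambda>x. F k x - h n x)) \<longlonglongrightarrow> nn_integral lebesgue (\<lambda>_::'a. 0)"
    unfolding L2sq_def
  proof (rule nn_integral_dominated_convergence[where w="\<lambda>x. ennreal ((2 * real k)\<^sup>2) * indicator (cball 0 (real k + 1)) x"])
    have "AE x in lebesgue. x \<notin> N"
      using N by (intro AE_not_in) (simp add: negligible_iff_null_sets)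
    then show "AE x in lebesgue. (\<lambda>n. ennreal ((cmod (F k x - h n x))\<^sup>2)) \<longlonglongrightarrow> 0"
    proof eventually_elim
      case (elim x)
      have "(\<lambda>n. clip (g n x)) \<longlonglongrightarrow> clip (F k x)"
        using continuous_on_tendsto_compose[OF clip_cont lim[OF elim]] by simp
      then have "(\<lambda>n. h n x) \<longlonglongrightarrow> cut x *\<^sub>R F k x"
        unfolding h_def clip_id[OF F_bound] by (intro tendsto_intros)
      also have "cut x *\<^sub>R F k x = F k x"
        using F_supp[of x] by (cases "real k < norm x") (auto simp: cut_def)
      finally have "(\<lambda>n. ennreal ((cmod (F k x - h n x))\<^sup>2)) \<longlonglongrightarrow> ennreal ((cmod (F k x - F k x))\<^sup>2)"
        by (intro tendsto_ennrealI tendsto_intros)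
      then show ?case by simp
    qed
    show "AE x in lebesgue. ennreal ((cmod (F k x - h n x))\<^sup>2) \<le> ennreal ((2 * real k)\<^sup>2) * indicator (cball 0 (real k + 1)) x" for n
    proof (rule AE_I2)
      fix x
      have "cmod (F k x - h n x) \<le> 2 * real k"
        using norm_triangle_ineq4[of "F k x" "h n x"] F_bound[of x] h_bound[of n x] by simp
      from power_mono[OF this norm_ge_zero, of 2]
      show "ennreal ((cmod (F k x - h n x))\<^sup>2) \<le> ennreal ((2 * real k)\<^sup>2) * indicator (cball 0 (real k + 1)) x"
        using F_supp[of x] h_supp[of x n] by (auto simp: indicator_def ennreal_leI not_le)
    qed
    show "(\<integral>\<^sup>+x. ennreal ((2 * real k)\<^sup>2) * indicator (cball (0::'a) (real k + 1)) x \<partial>lebesgue) < \<infinity>"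
      using emeasure_lborel_cball_finite[of "0::'a" "real k + 1"]
      by (simp add: nn_integral_cmult_indicator ennreal_mult_less_top)
    have "cball (0::'a) (real k + 1) \<in> sets lebesgue" by simp
    note [measurable] = borel_measurable_indicator[OF this]
    show "(\<lambda>x::'a. ennreal ((2 * real k)\<^sup>2) * indicator (cball 0 (real k + 1)) x) \<in> borel_measurable lebesgue"
      by measurable
  qed measurable
  then have "(\<lambda>n. L2sq (\<lambda>x. F k x - h n x)) \<longlonglongrightarrow> 0" by simp
  from order_tendstoD(2)[OF this e4(1)] obtain n where n: "L2sq (\<lambda>x. F k x - h n x) < e4"
    by (auto simp: eventually_sequentially)
  have "L2sq (\<lambda>x. f x - h n x) \<le> 2 * L2sq (\<lambda>x. f x - F k x) + 2 * L2sq (\<lambda>x. F k x - h n x)"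
    by (rule L2sq_add_le) auto
  also have "\<dots> \<le> 2 * e4 + 2 * e4"
    using k n by (intro add_mono mult_left_mono) auto
  also have "\<dots> = 4 * e4" by (simp flip: distrib_right)
  also note e4(2)
  finally show thesis
    using that[OF h_cont h_bound h_int] by blast
qed

text \<open>Equality holds for a bounded continuous \<open>h\<close> close to \<open>f\<close>.
  Passing from \<open>f\<close> to \<open>h\<close>, and from the transform of \<open>h\<close> back
  to that of \<open>f\<close>, costs a factor 2 each time, hence 4. The difference is counted 4 + 2
  times, which explains the accuracy \<open>\<epsilon> / (6 * C)\<close>.\<close>

lemma Plancherel_ge:
  fixes f :: "'a::euclidean_space \<Rightarrow> complex"
  assumes f: "integrable lebesgue f" and f2: "L2sq f < \<infinity>"
  shows "ennreal ((2 * pi) ^ DIM('a)) * L2sq f \<le> 4 * L2sq (fourier_L1 f)"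
proof (rule ennreal_le_epsilon)
  fix \<epsilon> :: real assume \<epsilon>: "0 < \<epsilon>"
  define C where "C = (2 * pi) ^ DIM('a)"
  have C: "0 < C" by (simp add: C_def)
  note [measurable] = borel_measurable_integrable[OF f]
  obtain h M where h: "continuous_on UNIV h" "\<And>x. cmod (h x) \<le> M" "integrable lebesgue h"
    and close: "L2sq (\<lambda>x. f x - h x) \<le> ennreal (\<epsilon> / (6 * C))"
    using L2_dense_continuous[of f "\<epsilon> / (6 * C)"] f2 \<epsilon> C by auto
  note [measurable] = borel_measurable_integrable[OF h(3)]
  have "L2sq f \<le> 2 * L2sq h + 2 * L2sq (\<lambda>x. f x - h x)"
    by (rule L2sq_add_le) auto
  then have "C * L2sq f \<le> C * (2 * L2sq h + 2 * L2sq (\<lambda>x. f x - h x))"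
    by (rule mult_left_mono) simp
  also have "\<dots> = 2 * (C * L2sq h) + 2 * (C * L2sq (\<lambda>x. f x - h x))"
    by (simp add: distrib_left mult_ac)
  also have "C * L2sq h = L2sq (fourier_L1 h)"
    unfolding C_def by (rule Plancherel_continuous[OF h(3,1,2), symmetric])
  also have "L2sq (fourier_L1 h) \<le> 2 * L2sq (fourier_L1 f) + 2 * L2sq (fourier_L1 (\<lambda>x. h x - f x))"
  proof (rule L2sq_add_le)
    show "fourier_L1 h \<xi> = fourier_L1 f \<xi> + fourier_L1 (\<lambda>x. h x - f x) \<xi>" for \<xi>
      unfolding fourier_L1_def right_diff_distrib
      by (subst Bochner_Integration.integral_diff) (simp_all only: integrable_fourier_integrand f h diff_add_cancel add_diff_cancel_left' add_diff_eq)
  qed measurable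
  also have "L2sq (fourier_L1 (\<lambda>x. h x - f x)) \<le> C * L2sq (\<lambda>x. h x - f x)"
    unfolding C_def by (rule Plancherel_le) (intro Bochner_Integration.integrable_diff f h)
  also have "L2sq (\<lambda>x. h x - f x) = L2sq (\<lambda>x. f x - h x)"
    unfolding L2sq_def by (simp add: norm_minus_commute)
  also have "2 * (2 * L2sq (fourier_L1 f) + 2 * (ennreal C * L2sq (\<lambda>x. f x - h x))) + 2 * (ennreal C * L2sq (\<lambda>x. f x - h x))
      = 4 * L2sq (fourier_L1 f) + ennreal (6 * C) * L2sq (\<lambda>x. f x - h x)"
  proof -
    have "2 * (2 * a + 2 * b) + 2 * b = 4 * a + 6 * b" for a b :: ennreal
    proof -
      have "2 * (2 * a + 2 * b) + 2 * b = 4 * a + (4 * b + 2 * b)"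
        by (simp add: distrib_left mult.assoc[symmetric] add.assoc)
      also have "4 * b + 2 * b = 6 * b" by (simp flip: distrib_right)
      finally show ?thesis .
    qed
    then show ?thesis using C by (simp add: ennreal_mult mult.assoc)
  qed
  also have "ennreal (6 * C) * L2sq (\<lambda>x. f x - h x) \<le> ennreal (6 * C) * ennreal (\<epsilon> / (6 * C))"
    using close by (intro mult_left_mono) auto
  also have "ennreal (6 * C) * ennreal (\<epsilon> / (6 * C)) = ennreal \<epsilon>"
    using C \<epsilon> by (simp flip: ennreal_mult)
  finally show "ennreal ((2 * pi) ^ DIM('a)) * L2sq f \<le> 4 * L2sq (fourier_L1 f) + ennreal \<epsilon>"
    unfolding C_def by (simp add: mult_left_mono add_mono)
qed


text \<open>The truncations to balls are integrable, so the preceding inequalities apply to them;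
  they converge to \<open>f\<close> in mean square while their transforms converge to
  \<open>g\<close> by definition. One more use of \<open>L2sq_add_le\<close> turns the constants 1
  and 4 into 2 and 8.\<close>

lemma is_fourier_L2_bounds:
  fixes f g :: "'a::euclidean_space \<Rightarrow> complex"
  assumes fg: "is_fourier_L2 f g"
  shows "L2sq g \<le> ennreal (2 * (2 * pi) ^ DIM('a)) * L2sq f"
    and "ennreal ((2 * pi) ^ DIM('a)) * L2sq f \<le> 8 * L2sq g"
proof -
  define C where "C = (2 * pi) ^ DIM('a)"
  have C: "0 < C" by (simp add: C_def)
  from fg have f: "in_L2 f" and g: "in_L2 g" by (auto simp: is_fourier_L2_def)
  then have [measurable]: "f \<in> borel_measurable lebesgue" "g \<in> borel_measurable lebesgue"
    by (auto simp: in_L2_def)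
  have f2: "integrable lebesgue (\<lambda>x. (cmod (f x))\<^sup>2)" using f by (simp add: in_L2_def)
  define F where "F R x = indicator (cball 0 R) x * f x" for R :: real and x
  define D where "D R = L2sq (\<lambda>\<xi>. g \<xi> - fourier_L1 (F R) \<xi>)" for R
  have D0: "(D \<longlongrightarrow> 0) at_top"
    using fg unfolding is_fourier_L2_def D_def[abs_def] L2sq_def F_def by simp
  have F_meas [measurable]: "F R \<in> borel_measurable lebesgue" for R
  proof -
    have "cball (0::'a) R \<in> sets lebesgue" by simp
    note [measurable] = borel_measurable_indicator[OF this]
    show ?thesis unfolding F_def[abs_def] by measurable
  qed
  have F_int: "integrable lebesgue (F R)" for R
  proof (rule Bochner_Integration.integrable_bound[OF Bochner_Integration.integrable_add[OF _ f2]])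
    show "integrable lebesgue (\<lambda>x. indicator (cball (0::'a) R) x :: real)"
      by (simp add: integrable_indicator_iff emeasure_lborel_cball_finite[unfolded infinity_ennreal_def])
    \<comment> \<open>On a ball of finite measure, t \<le> 1 + t^2 turns square integrability into
      integrability.\<close>
    have "t \<le> 1 + t\<^sup>2" for t :: real
      using sum_squares_bound[of t 1] zero_le_power2[of t] unfolding power_one mult_1_right by linarith
    then show "AE x in lebesgue. cmod (F R x) \<le> norm (indicator (cball 0 R) x + (cmod (f x))\<^sup>2)"
      by (intro AE_I2) (auto simp: F_def indicator_def)
  qed measurable
  have F_le: "L2sq (F R) \<le> L2sq f" for R
    unfolding L2sq_def by (intro nn_integral_mono) (simp add: F_def indicator_def)
  have f_fin: "L2sq f < \<infinity>" using f2 by (simp add: integrable_cmod_sq_iff)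
  have F_fin: "L2sq (F R) < \<infinity>" for R using F_le f_fin by (rule order_le_less_trans)
  show "L2sq g \<le> ennreal (2 * C) * L2sq f"
  proof (rule tendsto_lowerbound)
    have "((\<lambda>R. 2 * D R + ennreal (2 * C) * L2sq f) \<longlongrightarrow> 2 * 0 + ennreal (2 * C) * L2sq f) at_top"
      by (intro tendsto_add ennreal_tendsto_cmult D0 tendsto_const) auto
    then show "((\<lambda>R. 2 * D R + ennreal (2 * C) * L2sq f) \<longlongrightarrow> ennreal (2 * C) * L2sq f) at_top"
      by simp
    show "\<forall>\<^sub>F R in at_top. L2sq g \<le> 2 * D R + ennreal (2 * C) * L2sq f"
    proof (intro always_eventually allI)
      fix R
      have "L2sq g \<le> 2 * D R + 2 * L2sq (fourier_L1 (F R))"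
        unfolding D_def by (rule L2sq_add_le) auto
      also have "L2sq (fourier_L1 (F R)) \<le> C * L2sq (F R)"
        unfolding C_def by (rule Plancherel_le[OF F_int])
      also have "\<dots> \<le> C * L2sq f" by (intro mult_left_mono F_le) simp
      also have "2 * (C * L2sq f) = ennreal (2 * C) * L2sq f"
        using C by (simp add: ennreal_mult mult.assoc)
      finally show "L2sq g \<le> 2 * D R + ennreal (2 * C) * L2sq f"
        by (simp add: mult_left_mono add_left_mono)
    qed
  qed simp
  have mono: "C * L2sq f \<le> 8 * L2sq g"
  proof (rule tendsto_le)
    have "(\<lambda>k. L2sq (F (real k))) \<longlonglongrightarrow> L2sq f"
      unfolding L2sq_def
    proof (rule nn_integral_dominated_convergence[where w="\<lambda>x. ennreal ((cmod (f x))\<^sup>2)"])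
      show "AE x in lebesgue. (\<lambda>k. ennreal ((cmod (F (real k) x))\<^sup>2)) \<longlonglongrightarrow> ennreal ((cmod (f x))\<^sup>2)"
      proof (intro AE_I2 tendsto_eventually)
        fix x :: 'a
        have "\<forall>\<^sub>F k in sequentially. norm x \<le> real k"
          by (rule eventually_compose_filterlim[OF eventually_ge_at_top filterlim_real_sequentially])
        then show "\<forall>\<^sub>F k in sequentially. ennreal ((cmod (F (real k) x))\<^sup>2) = ennreal ((cmod (f x))\<^sup>2)"
          by eventually_elim (simp add: F_def)
      qed
      show "AE x in lebesgue. ennreal ((cmod (F (real k) x))\<^sup>2) \<le> ennreal ((cmod (f x))\<^sup>2)" for k
        by (intro AE_I2) (simp add: F_def indicator_def)
      show "(\<integral>\<^sup>+x. ennreal ((cmod (f x))\<^sup>2) \<partial>lebesgue) < \<infinity>"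
        using f_fin by (simp add: L2sq_def)
    qed measurable
    then show "(\<lambda>k. ennreal C * L2sq (F (real k))) \<longlonglongrightarrow> ennreal C * L2sq f"
      by (intro ennreal_tendsto_cmult) auto
    have "(\<lambda>k. D (real k)) \<longlonglongrightarrow> 0"
      by (rule filterlim_compose[OF D0 filterlim_real_sequentially])
    then have "(\<lambda>k. 8 * L2sq g + 8 * D (real k)) \<longlonglongrightarrow> 8 * L2sq g + 8 * 0"
      by (intro tendsto_add ennreal_tendsto_cmult tendsto_const) auto
    then show "(\<lambda>k. 8 * L2sq g + 8 * D (real k)) \<longlonglongrightarrow> 8 * L2sq g" by simp
    show "\<forall>\<^sub>F k in sequentially. ennreal C * L2sq (F (real k)) \<le> 8 * L2sq g + 8 * D (real k)"
    proof (intro always_eventually allI)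
      fix k
      have "ennreal C * L2sq (F (real k)) \<le> 4 * L2sq (fourier_L1 (F (real k)))"
        unfolding C_def by (rule Plancherel_ge[OF F_int F_fin])
      also have "L2sq (fourier_L1 (F (real k))) \<le> 2 * L2sq g + 2 * L2sq (\<lambda>\<xi>. fourier_L1 (F (real k)) \<xi> - g \<xi>)"
        by (rule L2sq_add_le) auto
      also have "L2sq (\<lambda>\<xi>. fourier_L1 (F (real k)) \<xi> - g \<xi>) = D (real k)"
        unfolding D_def L2sq_def by (simp add: norm_minus_commute)
      also have "4 * (2 * L2sq g + 2 * D (real k)) = 8 * L2sq g + 8 * D (real k)"
        by (simp add: distrib_left mult.assoc[symmetric])
      finally show "ennreal C * L2sq (F (real k)) \<le> 8 * L2sq g + 8 * D (real k)"
        by (simp add: mult_left_mono)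
    qed
  qed simp
  then show "ennreal C * L2sq f \<le> 8 * L2sq g" .
qed

section \<open>Exponential decay away from zero frequency\<close>

text \<open>The integrating factor makes the product constant. The equation is given for t > 0 only,
  so 0 enters as an exceptional point at which continuity takes over.\<close>

lemma linear_ode_unique:
  fixes f f' :: "real \<Rightarrow> complex"
  assumes cont: "continuous_on {0..} f"
    and deriv: "\<And>t. t > 0 \<Longrightarrow> (f has_vector_derivative \<mu> * f t) (at t)"
    and t: "t \<ge> 0"
  shows "f t = exp (\<mu> * of_real t) * f 0"
proof -
  define g where "g s = exp (- \<mu> * of_real s) * f s" for s
  have "g t = f 0"
  proof (rule has_derivative_zero_unique_strong_interval[where k="{0}" and a=0 and b=t])
    show "continuous_on {0..t} g"
      unfolding g_def by (intro continuous_intros continuous_on_subset[OF cont]) auto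
    fix s assume "s \<in> {0..t} - {0}"
    then have s: "s > 0" by auto
    have "(g has_vector_derivative (exp (- \<mu> * of_real s) * (\<mu> * f s) + (exp (- \<mu> * of_real s) * (- \<mu>)) * f s)) (at s)"
      unfolding g_def
      by (rule has_vector_derivative_mult[OF _ deriv[OF s]], rule has_vector_derivative_real_field)
         (auto intro!: derivative_eq_intros)
    then have "(g has_vector_derivative 0) (at s)" by (simp add: algebra_simps)
    then show "(g has_derivative (\<lambda>h. 0)) (at s within {0..t})"
      by (auto simp: has_vector_derivative_def intro: has_derivative_at_withinI)
  qed (use t in \<open>auto simp: g_def\<close>)
  then have "exp (\<mu> * of_real t) * (exp (- \<mu> * of_real t) * f t) = exp (\<mu> * of_real t) * f 0"
    by (simp add: g_def)
  then show ?thesis by (simp add: mult.assoc[symmetric] exp_add[symmetric])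
qed

lemma exp_decay:
  fixes L L' :: "real \<Rightarrow> real"
  assumes cont: "continuous_on {0..} L"
    and deriv: "\<And>t. t > 0 \<Longrightarrow> (L has_real_derivative L' t) (at t)"
    and le: "\<And>t. t > 0 \<Longrightarrow> L' t \<le> - c * L t"
    and t: "t \<ge> 0"
  shows "L t \<le> exp (- c * t) * L 0"
proof -
  have "exp (c * t) * L t \<le> exp (c * 0) * L 0"
  proof (rule DERIV_nonpos_imp_decreasing_open[OF t])
    fix s assume "0 < s" "s < t"
    then have "((\<lambda>s. exp (c * s) * L s) has_real_derivative exp (c * s) * (c * L s + L' s)) (at s)"
      by (auto intro!: derivative_eq_intros deriv simp: algebra_simps)
    moreover have "exp (c * s) * (c * L s + L' s) \<le> 0"
      using le[OF \<open>0 < s\<close>] by (intro mult_nonneg_nonpos) auto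
    ultimately show "\<exists>y. ((\<lambda>s. exp (c * s) * L s) has_real_derivative y) (at s) \<and> y \<le> 0"
      by blast
  qed (intro continuous_intros continuous_on_subset[OF cont], auto)
  then have "exp (- c * t) * (exp (c * t) * L t) \<le> exp (- c * t) * L 0"
    by (intro mult_left_mono) auto
  then show ?thesis by (simp add: mult.assoc[symmetric] exp_add[symmetric])
qed

text \<open>Every constraint on the small parameter of the Lyapunov functional has this form. Stated
  with a filter, finitely many of them can be met at once without an explicit minimum.\<close>

lemma small_parameter:
  fixes k b :: real
  assumes "k > 0" "b > 0"
  shows "\<forall>\<^sub>F \<epsilon> in at_right 0. \<epsilon> * k \<le> b"
proof -
  have "\<forall>\<^sub>F \<epsilon> in at_right 0. \<epsilon> < b / k"
    using assms by (intro eventually_at_right_real[THEN eventually_mono, of 0 "b / k"]) auto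
  then show ?thesis by eventually_elim (use assms in \<open>simp add: field_simps\<close>)
qed

text \<open>
  The scaled unknowns are \<open>y = v\<close>, \<open>p = v'\<close>, \<open>s = v'' / R\<close> for \<open>v''' + a R v'' + (R + m R\<^sup>2) v' + \<kappa> R\<^sup>2 v = 0\<close>.
  The terms of \<open>L\<close> without \<open>\<epsilon>\<close> and \<open>\<eta>\<close> come from multiplying the equation by \<open>v'' + a R v'\<close> and
  dissipate \<open>p\<close> only; the \<open>\<epsilon>\<close> and \<open>\<eta>\<close> corrections make \<open>s\<close> and \<open>y\<close> dissipate as well.  \<open>L'\<close> is the
  derivative of \<open>L\<close> along solutions.
\<close>

lemma Lyapunov_estimates:
  fixes a \<kappa> m R0 :: real
  assumes pos: "\<kappa> > 0" "m > 0" "a > \<kappa>" "R0 > 0"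
  shows "\<exists>\<epsilon> \<eta> c C1 C2. 0 < c \<and> 0 < C1 \<and> 0 < C2 \<and> (\<forall>R\<ge>R0. \<forall>y p s.
    (let S = s\<^sup>2 + p\<^sup>2 + R * y\<^sup>2;
         L = (s + a * p)\<^sup>2 / 2 + (m + 1 / R) / 2 * p\<^sup>2 + \<kappa> * y * p + a * \<kappa> * R / 2 * y\<^sup>2
             - \<epsilon> * (p * s + \<kappa> * R / 2 * y\<^sup>2) + \<eta> * (y * (s + a * p) + (R * m + 1) / 2 * y\<^sup>2);
         L' = - (a * R * m + (a - \<kappa>)) * p\<^sup>2 - \<epsilon> * R * s\<^sup>2 + \<epsilon> * R * (a * p * s + (m + 1 / R) * p\<^sup>2)
             + \<eta> * (p * s + a * p\<^sup>2) - \<eta> * \<kappa> * R * y\<^sup>2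
     in C1 * S \<le> L \<and> L \<le> C2 * S \<and> L' \<le> - c * L))"
proof -
  define \<delta> where "\<delta> = a - \<kappa>"
  \<comment> \<open>Control of s^2 has to come from (s + a p)^2. Only the share
    \<open>\<theta>\<close> of that square is spent, so that the loss
    \<open>\<theta> * a\<^sup>2 * p\<^sup>2\<close> stays below half of the available
    \<open>m * p\<^sup>2\<close>.\<close>
  define \<theta> where "\<theta> = min 1 (m / (2 * a\<^sup>2))"
  have a: "0 < a" and \<delta>: "0 < \<delta>" using pos by (auto simp: \<delta>_def)
  have \<theta>: "0 < \<theta>" "\<theta> \<le> 1" "\<theta> * a\<^sup>2 \<le> m / 2"
    using pos a by (auto simp: \<theta>_def min_def field_simps)
  \<comment> \<open>\<open>P\<close> collects all coefficients of p^2 that the corrections add to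
    the derivative of the functional; the constraint \<open>\<epsilon> * P \<le> a * m / 2\<close>
    leaves half of the basic dissipation.\<close>
  define P where "P = m + 1 / R0 + a\<^sup>2 + 1 / 4 + a / 2"
  have P: "0 < P" using pos a by (auto simp: P_def intro!: add_pos_pos)
  have "\<forall>\<^sub>F \<epsilon> in at_right 0. \<epsilon> > 0 \<and> \<epsilon> * (1 + R0) \<le> \<theta> / 4 \<and> \<epsilon> * (1 + R0 * a\<^sup>2) \<le> m / 4
      \<and> \<epsilon> * (\<kappa> + 1 / 2) \<le> \<kappa> * \<delta> / 2 \<and> \<epsilon> * P \<le> a * m / 2"
    using pos a \<delta> \<theta> P
    by (intro eventually_conj small_parameter eventually_at_right_less) (auto intro!: add_pos_nonneg add_pos_pos)
  then obtain \<epsilon> where \<epsilon>: "\<epsilon> > 0" "\<epsilon> * (1 + R0) \<le> \<theta> / 4" "\<epsilon> * (1 + R0 * a\<^sup>2) \<le> m / 4"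
      "\<epsilon> * (\<kappa> + 1 / 2) \<le> \<kappa> * \<delta> / 2" "\<epsilon> * P \<le> a * m / 2"
    using eventually_happens'[OF trivial_limit_at_right_real] by blast
  \<comment> \<open>With this choice \<eta> \<le> \<epsilon> R / 2 for every R \<ge> R0. The cross
    terms of the \<eta> correction are thus absorbed by the dissipation of s and p, and \<eta> y^2
    is absorbed by \<epsilon> R y^2.\<close>
  define \<eta> where "\<eta> = \<epsilon> * R0 / 2"
  have \<eta>: "\<eta> > 0" using \<epsilon> pos by (simp add: \<eta>_def)
  \<comment> \<open>Half of each main coefficient of s^2, p^2 and R y^2 is left after the \<epsilon>
    and \<eta> corrections.\<close>
  define C1 where "C1 = min (\<theta> / 8) (min (m / 8) (\<kappa> * \<delta> / 4))"
  define C2 where "C2 = 1 + a\<^sup>2 + (m + 1 / R0) / 2 + 1 / (2 * R0) + \<kappa>\<^sup>2 / 2 + a * \<kappa> / 2 + \<epsilon> / 2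
      + \<eta> * (1 + a\<^sup>2) + \<epsilon> / 4 + \<eta> * m / 2 + \<epsilon> / 4"
  define c2 where "c2 = min (a * m / 2) (min (\<epsilon> / 2) (\<eta> * \<kappa>))"
  \<comment> \<open>The dissipation controls R (s^2 + p^2 + y^2), which is at least
    \<open>min R0 1\<close> times the energy; dividing by \<open>C2\<close> expresses this through
    the functional.\<close>
  define c where "c = c2 * min R0 1 / C2"
  have C1: "0 < C1" using pos \<delta> \<theta> by (simp add: C1_def)
  have C2: "0 < C2" unfolding C2_def using pos a \<epsilon> \<eta> by (auto intro!: add_pos_pos mult_pos_pos add_pos_nonneg)
  have c2: "0 < c2" using pos a \<epsilon> \<eta> by (simp add: c2_def)
  have c: "0 < c" using c2 C2 pos by (simp add: c_def)
  have main: "C1 * S \<le> L \<and> L \<le> C2 * S \<and> L' \<le> - c * L"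
    if R: "R \<ge> R0" and S: "S = s\<^sup>2 + p\<^sup>2 + R * y\<^sup>2"
      and L: "L = (s + a * p)\<^sup>2 / 2 + (m + 1 / R) / 2 * p\<^sup>2 + \<kappa> * y * p + a * \<kappa> * R / 2 * y\<^sup>2
             - \<epsilon> * (p * s + \<kappa> * R / 2 * y\<^sup>2) + \<eta> * (y * (s + a * p) + (R * m + 1) / 2 * y\<^sup>2)"
      and L': "L' = - (a * R * m + (a - \<kappa>)) * p\<^sup>2 - \<epsilon> * R * s\<^sup>2 + \<epsilon> * R * (a * p * s + (m + 1 / R) * p\<^sup>2)
             + \<eta> * (p * s + a * p\<^sup>2) - \<eta> * \<kappa> * R * y\<^sup>2"
    for R y p s S L L'
  proof -
    have Rpos: "R > 0" using R pos by simp
    define U where "U = s + a * p"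
    define Y where "Y = R * y\<^sup>2"
    have nn: "0 \<le> s\<^sup>2" "0 \<le> p\<^sup>2" "0 \<le> Y" "0 \<le> U\<^sup>2" "0 \<le> y\<^sup>2"
      using Rpos by (auto simp: Y_def)
    have invR: "1 / R \<le> 1 / R0" using R pos by (simp add: frac_le)
    have R1: "1 \<le> R / R0" using R pos by simp
    have yY: "R0 * y\<^sup>2 \<le> Y" unfolding Y_def using R by (intro mult_right_mono) auto
    \<comment> \<open>The lower bound on the mixed term uses up exactly the p^2 / (2 R) present in
      the functional and \<kappa>^2 / 2 of the coefficient of R y^2. What remains of a \<kappa> / 2
      is \<kappa> (a - \<kappa>) / 2, and this is where a > \<kappa> gives positivity.\<close>
    have yp: "\<bar>\<kappa> * y * p\<bar> \<le> p\<^sup>2 / (2 * R) + \<kappa>\<^sup>2 / 2 * Y"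
    proof -
      have "0 \<le> (\<kappa> * R * y - p)\<^sup>2 / (2 * R)" "0 \<le> (\<kappa> * R * y + p)\<^sup>2 / (2 * R)"
        using Rpos by auto
      moreover have "(\<kappa> * R * y - p)\<^sup>2 / (2 * R) = p\<^sup>2 / (2 * R) + \<kappa>\<^sup>2 / 2 * Y - \<kappa> * y * p"
        "(\<kappa> * R * y + p)\<^sup>2 / (2 * R) = p\<^sup>2 / (2 * R) + \<kappa>\<^sup>2 / 2 * Y + \<kappa> * y * p"
        using Rpos by (auto simp: Y_def field_simps power2_eq_square)
      ultimately show ?thesis by linarith
    qed
    have ps: "\<bar>p * s\<bar> \<le> s\<^sup>2 / 2 + p\<^sup>2 / 2"
      using sum_squares_bound[of "\<bar>p\<bar>" "\<bar>s\<bar>"] by (simp add: abs_mult)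
    have U1: "U\<^sup>2 \<ge> s\<^sup>2 / 2 - a\<^sup>2 * p\<^sup>2"
    proof -
      have "0 \<le> (s + 2 * (a * p))\<^sup>2" by simp
      then show ?thesis by (simp add: U_def power2_eq_square algebra_simps)
    qed
    have U2: "U\<^sup>2 \<le> 2 * s\<^sup>2 + 2 * a\<^sup>2 * p\<^sup>2"
    proof -
      have "0 \<le> (s - a * p)\<^sup>2" by simp
      then show ?thesis by (simp add: U_def power2_eq_square algebra_simps)
    qed
    have yU: "\<bar>y * U\<bar> \<le> y\<^sup>2 / 2 + s\<^sup>2 + a\<^sup>2 * p\<^sup>2"
      using sum_squares_bound[of "\<bar>y\<bar>" "\<bar>U\<bar>"] U2 by (simp add: abs_mult)
    have \<eta>yU: "\<bar>\<eta> * (y * U)\<bar> \<le> \<epsilon> / 4 * Y + \<eta> * s\<^sup>2 + \<eta> * a\<^sup>2 * p\<^sup>2"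
    proof -
      have "\<bar>\<eta> * (y * U)\<bar> \<le> \<eta> * (y\<^sup>2 / 2 + s\<^sup>2 + a\<^sup>2 * p\<^sup>2)"
        using mult_left_mono[OF yU, of \<eta>] \<eta> by (simp add: abs_mult)
      moreover have "\<eta> * (y\<^sup>2 / 2) \<le> \<epsilon> / 4 * Y"
        using mult_left_mono[OF yY, of "\<epsilon> / 4"] \<epsilon> by (simp add: \<eta>_def)
      ultimately show ?thesis by (simp add: algebra_simps)
    qed
    have \<epsilon>ps: "\<bar>\<epsilon> * (p * s)\<bar> \<le> \<epsilon> / 2 * s\<^sup>2 + \<epsilon> / 2 * p\<^sup>2"
      using mult_left_mono[OF ps, of \<epsilon>] \<epsilon> by (simp add: abs_mult algebra_simps)
    have L_eq: "L = U\<^sup>2 / 2 + m / 2 * p\<^sup>2 + p\<^sup>2 / (2 * R) + \<kappa> * y * p + a * \<kappa> / 2 * Y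
        - \<epsilon> * (p * s) - \<epsilon> * \<kappa> / 2 * Y + \<eta> * (y * U) + \<eta> * m / 2 * Y + \<eta> / 2 * y\<^sup>2"
      unfolding L U_def Y_def using Rpos by (simp add: field_simps)
    have \<theta>U: "U\<^sup>2 / 2 \<ge> \<theta> / 4 * s\<^sup>2 - m / 4 * p\<^sup>2"
    proof -
      have "\<theta> * (s\<^sup>2 / 2 - a\<^sup>2 * p\<^sup>2) \<le> \<theta> * U\<^sup>2" using U1 \<theta> by (intro mult_left_mono) auto
      also have "\<dots> \<le> 1 * U\<^sup>2" using \<theta> nn by (intro mult_right_mono) auto
      finally have "\<theta> * (s\<^sup>2 / 2) - (\<theta> * a\<^sup>2) * p\<^sup>2 \<le> U\<^sup>2" by (simp add: algebra_simps)
      moreover have "(\<theta> * a\<^sup>2) * p\<^sup>2 \<le> m / 2 * p\<^sup>2" using \<theta> nn by (intro mult_right_mono) auto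
      ultimately show ?thesis by (simp add: algebra_simps)
    qed
    have nn': "0 \<le> \<eta> * m / 2 * Y" "0 \<le> \<eta> / 2 * y\<^sup>2" "0 \<le> \<epsilon> * \<kappa> / 2 * Y"
      "0 \<le> \<eta> * a\<^sup>2" "0 \<le> \<eta> * m" "0 \<le> a * \<kappa>" "0 \<le> (a - \<kappa>) * p\<^sup>2"
      using \<eta> \<epsilon> pos a nn by auto
    have lower: "C1 * S \<le> L"
    proof -
      have "(\<theta> / 4 - \<epsilon> / 2 - \<eta>) * s\<^sup>2 + (m / 4 - \<epsilon> / 2 - \<eta> * a\<^sup>2) * p\<^sup>2 + (a * \<kappa> / 2 - \<kappa>\<^sup>2 / 2 - \<epsilon> * \<kappa> / 2 - \<epsilon> / 4) * Y \<le> L"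
        using \<theta>U yp \<eta>yU \<epsilon>ps nn'
        unfolding L_eq by (simp add: algebra_simps abs_le_iff)
      moreover have "C1 \<le> \<theta> / 4 - \<epsilon> / 2 - \<eta>"
        using \<epsilon>(2) unfolding C1_def \<eta>_def by (simp add: algebra_simps min_le_iff_disj)
      then have "C1 * s\<^sup>2 \<le> (\<theta> / 4 - \<epsilon> / 2 - \<eta>) * s\<^sup>2" using nn by (intro mult_right_mono)
      moreover have "C1 \<le> m / 4 - \<epsilon> / 2 - \<eta> * a\<^sup>2"
        using \<epsilon>(3) unfolding C1_def \<eta>_def by (simp add: algebra_simps min_le_iff_disj)
      then have "C1 * p\<^sup>2 \<le> (m / 4 - \<epsilon> / 2 - \<eta> * a\<^sup>2) * p\<^sup>2" using nn by (intro mult_right_mono)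
      moreover have "C1 \<le> a * \<kappa> / 2 - \<kappa>\<^sup>2 / 2 - \<epsilon> * \<kappa> / 2 - \<epsilon> / 4"
      proof -
        have "C1 \<le> \<kappa> * \<delta> / 4" by (simp add: C1_def)
        moreover have "\<kappa> * \<delta> = a * \<kappa> - \<kappa>\<^sup>2" by (simp add: \<delta>_def power2_eq_square algebra_simps)
        moreover have "\<epsilon> * (\<kappa> + 1 / 2) = \<epsilon> * \<kappa> + \<epsilon> / 2" by (simp add: algebra_simps)
        ultimately show ?thesis using \<epsilon>(4) by linarith
      qed
      then have "C1 * Y \<le> (a * \<kappa> / 2 - \<kappa>\<^sup>2 / 2 - \<epsilon> * \<kappa> / 2 - \<epsilon> / 4) * Y" using nn by (intro mult_right_mono)
      ultimately show ?thesis unfolding S Y_def[symmetric] distrib_left by linarith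
    qed
    have upper: "L \<le> C2 * S"
    proof -
      have yy: "\<eta> / 2 * y\<^sup>2 \<le> \<epsilon> / 4 * Y"
        using mult_left_mono[OF yY, of "\<epsilon> / 4"] \<epsilon> by (simp add: \<eta>_def)
      have pR: "p\<^sup>2 / (2 * R) \<le> p\<^sup>2 / (2 * R0)" using R pos by (intro divide_left_mono) auto
      have "L \<le> (s\<^sup>2 + a\<^sup>2 * p\<^sup>2) + m / 2 * p\<^sup>2 + p\<^sup>2 / (2 * R0) + (p\<^sup>2 / (2 * R0) + \<kappa>\<^sup>2 / 2 * Y) + a * \<kappa> / 2 * Y
          + (\<epsilon> / 2 * s\<^sup>2 + \<epsilon> / 2 * p\<^sup>2) + (\<epsilon> / 4 * Y + \<eta> * s\<^sup>2 + \<eta> * a\<^sup>2 * p\<^sup>2) + \<eta> * m / 2 * Y + \<epsilon> / 4 * Y"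
        using U2 yp pR \<eta>yU \<epsilon>ps yy \<epsilon> pos nn nn'
        unfolding L_eq abs_le_iff by linarith
      also have "\<dots> = (1 + \<epsilon> / 2 + \<eta>) * s\<^sup>2 + (a\<^sup>2 + (m + 1 / R0) / 2 + 1 / (2 * R0) + \<epsilon> / 2 + \<eta> * a\<^sup>2) * p\<^sup>2
          + (\<kappa>\<^sup>2 / 2 + a * \<kappa> / 2 + \<epsilon> / 4 + \<eta> * m / 2 + \<epsilon> / 4) * Y"
        by (simp add: algebra_simps add_divide_distrib)
      also have "\<dots> \<le> C2 * s\<^sup>2 + C2 * p\<^sup>2 + C2 * Y"
        using nn pos a \<epsilon> \<eta> nn'
        by (intro add_mono mult_right_mono) (auto simp: C2_def algebra_simps)
      finally show ?thesis by (simp add: S Y_def distrib_left)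
    qed
    have diss: "L' \<le> - c2 * (R * (s\<^sup>2 + p\<^sup>2 + y\<^sup>2))"
    proof -
      have \<eta>R: "\<eta> \<le> \<epsilon> * R / 2" unfolding \<eta>_def using R \<epsilon> by simp
      have \<epsilon>R: "0 < \<epsilon> * R" using \<epsilon> Rpos by simp
      have aps: "\<epsilon> * R * (a * p * s) \<le> \<epsilon> * R * (s\<^sup>2 / 4 + a\<^sup>2 * p\<^sup>2)"
      proof (rule mult_left_mono)
        have "0 \<le> (s / 2 - a * p)\<^sup>2" by simp
        then show "a * p * s \<le> s\<^sup>2 / 4 + a\<^sup>2 * p\<^sup>2" by (simp add: power2_eq_square algebra_simps)
      qed (use \<epsilon>R in simp)
      have \<eta>ps: "\<eta> * (p * s) \<le> \<epsilon> * R * (s\<^sup>2 / 4 + p\<^sup>2 / 4)"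
      proof -
        have "\<eta> * (p * s) \<le> \<eta> * \<bar>p * s\<bar>" using \<eta> by (intro mult_left_mono) auto
        also have "\<dots> \<le> (\<epsilon> * R / 2) * \<bar>p * s\<bar>" using \<eta>R by (intro mult_right_mono) auto
        also have "\<dots> \<le> (\<epsilon> * R / 2) * (s\<^sup>2 / 2 + p\<^sup>2 / 2)" using ps \<epsilon>R by (intro mult_left_mono) auto
        finally show ?thesis by (simp add: algebra_simps)
      qed
      have \<eta>ap: "\<eta> * (a * p\<^sup>2) \<le> \<epsilon> * R * (a / 2 * p\<^sup>2)"
        using mult_right_mono[OF \<eta>R, of "a * p\<^sup>2"] a nn by (simp add: algebra_simps)
      have mp: "\<epsilon> * R * ((m + 1 / R) * p\<^sup>2) \<le> \<epsilon> * R * ((m + 1 / R0) * p\<^sup>2)"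
        using invR \<epsilon>R nn by (intro mult_left_mono mult_right_mono) auto
      have "L' \<le> - (a * R * m) * p\<^sup>2 - \<epsilon> * R * s\<^sup>2 + \<epsilon> * R * (s\<^sup>2 / 4 + a\<^sup>2 * p\<^sup>2) + \<epsilon> * R * ((m + 1 / R0) * p\<^sup>2)
          + \<epsilon> * R * (s\<^sup>2 / 4 + p\<^sup>2 / 4) + \<epsilon> * R * (a / 2 * p\<^sup>2) - \<eta> * \<kappa> * R * y\<^sup>2"
        using aps \<eta>ps \<eta>ap mp nn' unfolding L' by (simp add: algebra_simps)
      also have "\<dots> = - R * ((a * m - \<epsilon> * P) * p\<^sup>2) - R * (\<epsilon> / 2 * s\<^sup>2) - R * (\<eta> * \<kappa> * y\<^sup>2)"
        by (simp add: P_def algebra_simps)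
      also have "\<dots> \<le> - R * (c2 * p\<^sup>2) - R * (c2 * s\<^sup>2) - R * (c2 * y\<^sup>2)"
      proof -
        have "R * (c2 * p\<^sup>2) \<le> R * ((a * m - \<epsilon> * P) * p\<^sup>2)" "R * (c2 * s\<^sup>2) \<le> R * (\<epsilon> / 2 * s\<^sup>2)"
          "R * (c2 * y\<^sup>2) \<le> R * (\<eta> * \<kappa> * y\<^sup>2)"
        proof -
          have "c2 \<le> a * m - \<epsilon> * P" "c2 \<le> \<epsilon> / 2" "c2 \<le> \<eta> * \<kappa>"
            using \<epsilon>(5) by (auto simp: c2_def min_le_iff_disj)
          then show "R * (c2 * p\<^sup>2) \<le> R * ((a * m - \<epsilon> * P) * p\<^sup>2)" "R * (c2 * s\<^sup>2) \<le> R * (\<epsilon> / 2 * s\<^sup>2)"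
            "R * (c2 * y\<^sup>2) \<le> R * (\<eta> * \<kappa> * y\<^sup>2)"
            using Rpos nn by (intro mult_left_mono mult_right_mono; simp)+
        qed
        then show ?thesis by linarith
      qed
      finally show ?thesis by (simp add: algebra_simps)
    qed
    have "min R0 1 * S \<le> R * (s\<^sup>2 + p\<^sup>2 + y\<^sup>2)"
    proof -
      have "min R0 1 * s\<^sup>2 \<le> R * s\<^sup>2" "min R0 1 * p\<^sup>2 \<le> R * p\<^sup>2" "min R0 1 * (R * y\<^sup>2) \<le> 1 * (R * y\<^sup>2)"
        using R nn Rpos by (intro mult_right_mono; simp)+
      then show ?thesis by (simp add: S distrib_left)
    qed
    then have "c2 * (min R0 1 * S) \<le> c2 * (R * (s\<^sup>2 + p\<^sup>2 + y\<^sup>2))" using c2 by (intro mult_left_mono) auto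
    moreover have "c * L \<le> c * (C2 * S)" using upper c by (intro mult_left_mono) auto
    moreover have "c * (C2 * S) = c2 * (min R0 1 * S)" using C2 by (simp add: c_def)
    ultimately have "L' \<le> - c * L" using diss by simp
    with lower upper show ?thesis by simp
  qed
  show ?thesis
    by (intro exI[of _ \<epsilon>] exI[of _ \<eta>] exI[of _ c] exI[of _ C1] exI[of _ C2] conjI c C1 C2 allI impI)
       (unfold Let_def, rule main[OF _ refl refl refl])
qed


text \<open>In the scaled unknown s = q / R the functional is comparable to the energy with
  constants independent of R. Dividing by R to isolate y^2 leaves the initial energy over R, which R
  \<ge> R0 bounds by the data; this produces the powers of 1 / R0 in the constant.\<close>

lemma third_order_real_decay:
  fixes a \<kappa> m R0 :: real
  assumes pos: "\<kappa> > 0" "m > 0" "a > \<kappa>" "R0 > 0"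
  shows "\<exists>c>0. \<exists>K>0. \<forall>R\<ge>R0. \<forall>y p q q' :: real \<Rightarrow> real.
    continuous_on {0..} y \<and> continuous_on {0..} p \<and> continuous_on {0..} q \<and>
    (\<forall>t>0. (y has_real_derivative p t) (at t) \<and> (p has_real_derivative q t) (at t) \<and>
       (q has_real_derivative q' t) (at t) \<and>
       q' t + a * R * q t + (R + m * R\<^sup>2) * p t + \<kappa> * R\<^sup>2 * y t = 0) \<longrightarrow>
    (\<forall>t\<ge>0. (y t)\<^sup>2 \<le> K * exp (- c * t) * ((y 0)\<^sup>2 + (p 0)\<^sup>2 + (q 0)\<^sup>2))"
proof -
  obtain \<epsilon> \<eta> c C1 C2 where c: "0 < c" and C1: "0 < C1" and C2: "0 < C2" and main: "\<forall>R\<ge>R0. \<forall>y p s.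
    (let S = s\<^sup>2 + p\<^sup>2 + R * y\<^sup>2;
         L = (s + a * p)\<^sup>2 / 2 + (m + 1 / R) / 2 * p\<^sup>2 + \<kappa> * y * p + a * \<kappa> * R / 2 * y\<^sup>2
             - \<epsilon> * (p * s + \<kappa> * R / 2 * y\<^sup>2) + \<eta> * (y * (s + a * p) + (R * m + 1) / 2 * y\<^sup>2);
         L' = - (a * R * m + (a - \<kappa>)) * p\<^sup>2 - \<epsilon> * R * s\<^sup>2 + \<epsilon> * R * (a * p * s + (m + 1 / R) * p\<^sup>2)
             + \<eta> * (p * s + a * p\<^sup>2) - \<eta> * \<kappa> * R * y\<^sup>2
     in C1 * S \<le> L \<and> L \<le> C2 * S \<and> L' \<le> - c * L)"
    using Lyapunov_estimates[OF pos] by auto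
  define K where "K = C2 / C1 * (1 + 1 / R0 + 1 / R0 ^ 3)"
  have K: "K > 0" unfolding K_def using C1 C2 pos by (intro mult_pos_pos divide_pos_pos add_pos_pos zero_less_power zero_less_one) auto
  have step: "(y t)\<^sup>2 \<le> K * exp (- c * t) * ((y 0)\<^sup>2 + (p 0)\<^sup>2 + (q 0)\<^sup>2)"
    if R: "R \<ge> R0" and cont: "continuous_on {0..} y" "continuous_on {0..} p" "continuous_on {0..} q"
      and ode: "\<forall>t>0. (y has_real_derivative p t) (at t) \<and> (p has_real_derivative q t) (at t) \<and>
       (q has_real_derivative q' t) (at t) \<and>
       q' t + a * R * q t + (R + m * R\<^sup>2) * p t + \<kappa> * R\<^sup>2 * y t = 0" and t: "t \<ge> 0"
    for R y p q q' t
  proof -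
    have Rpos: "R > 0" using R pos by simp
    define s where "s t = q t / R" for t
    define S where "S t = (s t)\<^sup>2 + (p t)\<^sup>2 + R * (y t)\<^sup>2" for t
    define L where "L t = (s t + a * p t)\<^sup>2 / 2 + (m + 1 / R) / 2 * (p t)\<^sup>2 + \<kappa> * y t * p t + a * \<kappa> * R / 2 * (y t)\<^sup>2
             - \<epsilon> * (p t * s t + \<kappa> * R / 2 * (y t)\<^sup>2) + \<eta> * (y t * (s t + a * p t) + (R * m + 1) / 2 * (y t)\<^sup>2)" for t
    define L' where "L' t = - (a * R * m + (a - \<kappa>)) * (p t)\<^sup>2 - \<epsilon> * R * (s t)\<^sup>2
             + \<epsilon> * R * (a * p t * s t + (m + 1 / R) * (p t)\<^sup>2)
             + \<eta> * (p t * s t + a * (p t)\<^sup>2) - \<eta> * \<kappa> * R * (y t)\<^sup>2" for t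
    have est: "C1 * S t \<le> L t" "L t \<le> C2 * S t" "L' t \<le> - c * L t" for t
      using main[rule_format, OF R, where y="y t" and p="p t" and s="s t"] unfolding Let_def S_def L_def L'_def by auto
    have "L t \<le> exp (- c * t) * L 0"
    proof (rule exp_decay[OF _ _ est(3) t])
      show "continuous_on {0..} L"
        unfolding L_def s_def using Rpos by (intro continuous_intros cont) auto
      fix t :: real assume t: "t > 0"
      \<comment> \<open>The third derivative of the solution divided by R, as read off from the
        equation.\<close>
      define s' where "s' = - a * R * s t - (m * R + 1) * p t - \<kappa> * R * y t"
      have "q' t = R * s'"
        using ode[rule_format, OF t] Rpos by (simp add: s'_def s_def power2_eq_square algebra_simps)
      then have s': "(s has_real_derivative s') (at t)"
        unfolding s_def using ode[rule_format, OF t] Rpos by (auto intro!: derivative_eq_intros)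
      have y': "(y has_real_derivative p t) (at t)" and p': "(p has_real_derivative R * s t) (at t)"
        using ode[rule_format, OF t] Rpos by (auto simp: s_def)
      have "(L has_real_derivative
          (s t + a * p t) * (s' + a * (R * s t)) + (m + 1 / R) * (p t * (R * s t)) + \<kappa> * (p t * p t + y t * (R * s t))
          + a * \<kappa> * R * (y t * p t) - \<epsilon> * ((R * s t) * s t + p t * s' + \<kappa> * R * (y t * p t))
          + \<eta> * (p t * (s t + a * p t) + y t * (s' + a * (R * s t)) + (R * m + 1) * (y t * p t))) (at t)"
        unfolding L_def by (rule derivative_eq_intros s' y' p' refl | simp)+ (simp add: algebra_simps)
      also have "(s t + a * p t) * (s' + a * (R * s t)) + (m + 1 / R) * (p t * (R * s t)) + \<kappa> * (p t * p t + y t * (R * s t))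
          + a * \<kappa> * R * (y t * p t) - \<epsilon> * ((R * s t) * s t + p t * s' + \<kappa> * R * (y t * p t))
          + \<eta> * (p t * (s t + a * p t) + y t * (s' + a * (R * s t)) + (R * m + 1) * (y t * p t)) = L' t"
        unfolding L'_def s'_def using Rpos by (simp add: power2_eq_square field_simps)
      finally show "(L has_real_derivative L' t) (at t)" .
    qed
    then have "C1 * S t \<le> exp (- c * t) * (C2 * S 0)"
      using est(1)[of t] mult_left_mono[OF est(2)[of 0] exp_ge_zero[of "- c * t"]] by linarith
    moreover have "R * (y t)\<^sup>2 \<le> S t" by (simp add: S_def)
    then have "C1 * (R * (y t)\<^sup>2) \<le> C1 * S t" using C1 by simp
    ultimately have "C1 * (R * (y t)\<^sup>2) \<le> exp (- c * t) * (C2 * S 0)" by simp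
    then have "(y t)\<^sup>2 \<le> exp (- c * t) * (C2 * S 0) / (C1 * R)"
      using C1 Rpos by (simp add: pos_le_divide_eq mult_ac)
    also have "\<dots> = C2 / C1 * exp (- c * t) * (S 0 / R)" using C1 Rpos by (simp add: field_simps)
    also have "\<dots> \<le> C2 / C1 * exp (- c * t) * ((1 + 1 / R0 + 1 / R0 ^ 3) * ((y 0)\<^sup>2 + (p 0)\<^sup>2 + (q 0)\<^sup>2))"
    proof (rule mult_left_mono)
      have "S 0 / R = (q 0)\<^sup>2 * (1 / R ^ 3) + (p 0)\<^sup>2 * (1 / R) + (y 0)\<^sup>2 * 1"
        using Rpos by (simp add: S_def s_def field_simps power2_eq_square power3_eq_cube)
      also have "\<dots> \<le> (q 0)\<^sup>2 * (1 / R0 ^ 3) + (p 0)\<^sup>2 * (1 / R0) + (y 0)\<^sup>2 * 1"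
        using R pos by (intro add_mono mult_left_mono frac_le power_mono) auto
      also have "\<dots> \<le> (q 0)\<^sup>2 * (1 + 1 / R0 + 1 / R0 ^ 3) + (p 0)\<^sup>2 * (1 + 1 / R0 + 1 / R0 ^ 3) + (y 0)\<^sup>2 * (1 + 1 / R0 + 1 / R0 ^ 3)"
        using pos by (intro add_mono mult_left_mono) auto
      finally show "S 0 / R \<le> (1 + 1 / R0 + 1 / R0 ^ 3) * ((y 0)\<^sup>2 + (p 0)\<^sup>2 + (q 0)\<^sup>2)"
        by (simp add: algebra_simps)
    qed (use C1 C2 in simp)
    finally show ?thesis by (simp add: K_def mult_ac)
  qed
  show ?thesis
    by (rule exI[of _ c], rule conjI[OF c], rule exI[of _ K], rule conjI[OF K], intro allI impI, elim conjE)
       (rule step; simp only:)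
qed

lemma has_vector_derivative_Re_Im:
  assumes "(f has_vector_derivative f') F"
  shows "((\<lambda>t. Re (f t)) has_vector_derivative Re f') F" "((\<lambda>t. Im (f t)) has_vector_derivative Im f') F"
  using bounded_linear.has_vector_derivative[OF bounded_linear_Re assms]
    bounded_linear.has_vector_derivative[OF bounded_linear_Im assms] by auto

text \<open>The coefficients are real, so real and imaginary parts solve the equation separately.
  Taking the square root halves the rate.\<close>

lemma third_order_decay:
  fixes a \<kappa> m R0 :: real
  assumes pos: "\<kappa> > 0" "m > 0" "a > \<kappa>" "R0 > 0"
  shows "\<exists>c>0. \<exists>C>0. \<forall>R\<ge>R0. \<forall>v v1 v2 v3 :: real \<Rightarrow> complex.
    continuous_on {0..} v \<and> continuous_on {0..} v1 \<and> continuous_on {0..} v2 \<and>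
    (\<forall>t>0. (v has_vector_derivative v1 t) (at t) \<and> (v1 has_vector_derivative v2 t) (at t) \<and>
       (v2 has_vector_derivative v3 t) (at t) \<and>
       v3 t + of_real (a * R) * v2 t + of_real (R + m * R\<^sup>2) * v1 t + of_real (\<kappa> * R\<^sup>2) * v t = 0) \<longrightarrow>
    (\<forall>t\<ge>0. cmod (v t) \<le> C * exp (- c * t) * (cmod (v 0) + cmod (v1 0) + cmod (v2 0)))"
proof -
  obtain c K where c: "0 < c" and K: "0 < K" and
    main: "\<forall>R\<ge>R0. \<forall>y p q q' :: real \<Rightarrow> real.
    continuous_on {0..} y \<and> continuous_on {0..} p \<and> continuous_on {0..} q \<and>
    (\<forall>t>0. (y has_real_derivative p t) (at t) \<and> (p has_real_derivative q t) (at t) \<and>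
       (q has_real_derivative q' t) (at t) \<and>
       q' t + a * R * q t + (R + m * R\<^sup>2) * p t + \<kappa> * R\<^sup>2 * y t = 0) \<longrightarrow>
    (\<forall>t\<ge>0. (y t)\<^sup>2 \<le> K * exp (- c * t) * ((y 0)\<^sup>2 + (p 0)\<^sup>2 + (q 0)\<^sup>2))"
    using third_order_real_decay[OF pos] by auto
  have step: "cmod (v t) \<le> sqrt K * exp (- (c / 2) * t) * (cmod (v 0) + cmod (v1 0) + cmod (v2 0))"
    if R: "R \<ge> R0" and cont: "continuous_on {0..} v" "continuous_on {0..} v1" "continuous_on {0..} v2"
      and ode: "\<forall>t>0. (v has_vector_derivative v1 t) (at t) \<and> (v1 has_vector_derivative v2 t) (at t) \<and>
       (v2 has_vector_derivative v3 t) (at t) \<and>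
       v3 t + of_real (a * R) * v2 t + of_real (R + m * R\<^sup>2) * v1 t + of_real (\<kappa> * R\<^sup>2) * v t = 0"
      and t: "t \<ge> 0" for R v v1 v2 v3 t
  proof -
    have Re: "(Re (v t))\<^sup>2 \<le> K * exp (- c * t) * ((Re (v 0))\<^sup>2 + (Re (v1 0))\<^sup>2 + (Re (v2 0))\<^sup>2)"
    proof (rule main[rule_format, OF R _ t, where q'="\<lambda>t. Re (v3 t)"], intro conjI allI impI)
      fix t :: real assume "t > 0"
      then have *: "v3 t + of_real (a * R) * v2 t + of_real (R + m * R\<^sup>2) * v1 t + of_real (\<kappa> * R\<^sup>2) * v t = 0"
        using ode by blast
      show "Re (v3 t) + a * R * Re (v2 t) + (R + m * R\<^sup>2) * Re (v1 t) + \<kappa> * R\<^sup>2 * Re (v t) = 0"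
        using arg_cong[OF *, of Re] by (simp del: of_real_mult of_real_add of_real_power)
    qed (use cont ode in \<open>auto intro!: continuous_intros has_vector_derivative_Re_Im simp: has_real_derivative_iff_has_vector_derivative\<close>)
    have Im: "(Im (v t))\<^sup>2 \<le> K * exp (- c * t) * ((Im (v 0))\<^sup>2 + (Im (v1 0))\<^sup>2 + (Im (v2 0))\<^sup>2)"
    proof (rule main[rule_format, OF R _ t, where q'="\<lambda>t. Im (v3 t)"], intro conjI allI impI)
      fix t :: real assume "t > 0"
      then have *: "v3 t + of_real (a * R) * v2 t + of_real (R + m * R\<^sup>2) * v1 t + of_real (\<kappa> * R\<^sup>2) * v t = 0"
        using ode by blast
      show "Im (v3 t) + a * R * Im (v2 t) + (R + m * R\<^sup>2) * Im (v1 t) + \<kappa> * R\<^sup>2 * Im (v t) = 0"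
        using arg_cong[OF *, of Im] by (simp del: of_real_mult of_real_add of_real_power)
    qed (use cont ode in \<open>auto intro!: continuous_intros has_vector_derivative_Re_Im simp: has_real_derivative_iff_has_vector_derivative\<close>)
    let ?N = "cmod (v 0) + cmod (v1 0) + cmod (v2 0)"
    have "(cmod (v t))\<^sup>2 \<le> K * exp (- c * t) * ((cmod (v 0))\<^sup>2 + (cmod (v1 0))\<^sup>2 + (cmod (v2 0))\<^sup>2)"
      using add_mono[OF Re Im] by (simp add: cmod_power2 algebra_simps)
    also have "\<dots> \<le> K * exp (- c * t) * ?N\<^sup>2"
      using K by (intro mult_left_mono) (auto simp: power2_eq_square algebra_simps)
    also have "\<dots> = (sqrt K * exp (- (c / 2) * t) * ?N)\<^sup>2"
    proof -
      have "exp (- c * t) = (exp (- (c / 2) * t))\<^sup>2"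
        using exp_double[of "- (c / 2) * t"] by simp
      then show ?thesis
        using K by (simp only: power_mult_distrib real_sqrt_pow2 less_imp_le)
    qed
    finally show ?thesis
      by (rule power2_le_imp_le) (simp add: less_imp_le[OF K])
  qed
  show ?thesis
    by (rule exI[of _ "c / 2"], rule conjI[OF half_gt_zero[OF c]], rule exI[of _ "sqrt K"],
        rule conjI[OF real_sqrt_gt_zero[OF K]], intro allI impI, elim conjE) (rule step; simp only:)
qed

section \<open>Asymptotics at small frequencies\<close>

text \<open>With f(x) equal to minus the symbol at -x, one has f(0) < 0 while f(\<kappa> r^2) equals
  \<kappa> (m + \<kappa>^2 - a \<kappa>) r^6 \<ge> 0, so there is a root in between. The difference
  quotient of f between that root and \<kappa> r^2 is at least r^2 / 2 for small r, which converts
  the value of order r^6 into a distance of order r^4.\<close>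

lemma cubic_root_near:
  fixes a \<kappa> m r :: real
  assumes pos: "\<kappa> > 0" "m > 0" "a > 0" and e: "a * \<kappa> \<le> m + \<kappa>\<^sup>2" and r: "r > 0" "4 * a * \<kappa> * r\<^sup>2 \<le> 1"
  obtains \<rho> where "0 < \<rho>" "\<rho> \<le> \<kappa> * r\<^sup>2" "\<kappa> * r\<^sup>2 - \<rho> \<le> 2 * \<kappa> * (m + \<kappa>\<^sup>2 - a * \<kappa>) * r ^ 4"
    "\<rho> ^ 3 - a * r\<^sup>2 * \<rho>\<^sup>2 + (r\<^sup>2 + m * r ^ 4) * \<rho> = \<kappa> * r ^ 4"
proof -
  define f where "f x = x ^ 3 - a * r\<^sup>2 * x\<^sup>2 + (r\<^sup>2 + m * r ^ 4) * x - \<kappa> * r ^ 4" for x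
  define x where "x = \<kappa> * r\<^sup>2"
  have fx: "f x = \<kappa> * (m + \<kappa>\<^sup>2 - a * \<kappa>) * r ^ 6"
    by (simp add: f_def x_def algebra_simps power2_eq_square power3_eq_cube eval_nat_numeral)
  have "\<exists>\<rho>\<ge>0. \<rho> \<le> x \<and> f \<rho> = 0"
  proof (rule IVT')
    show "f 0 \<le> 0" using pos by (simp add: f_def)
    show "0 \<le> f x" unfolding fx using pos e by simp
    show "0 \<le> x" using pos by (simp add: x_def)
    show "continuous_on {0..x} f" unfolding f_def by (intro continuous_intros)
  qed
  then obtain \<rho> where \<rho>: "0 \<le> \<rho>" "\<rho> \<le> x" "f \<rho> = 0" by blast
  have "\<rho> \<noteq> 0" using \<rho>(3) pos r by (auto simp: f_def)
  with \<rho> have \<rho>pos: "0 < \<rho>" by simp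
  have "f x - f \<rho> = (x - \<rho>) * (x\<^sup>2 + x * \<rho> + \<rho>\<^sup>2 - a * r\<^sup>2 * (x + \<rho>) + r\<^sup>2 + m * r ^ 4)"
    by (simp add: f_def algebra_simps power2_eq_square power3_eq_cube)
  moreover have "r\<^sup>2 / 2 \<le> x\<^sup>2 + x * \<rho> + \<rho>\<^sup>2 - a * r\<^sup>2 * (x + \<rho>) + r\<^sup>2 + m * r ^ 4"
  proof -
    have "a * r\<^sup>2 * (x + \<rho>) \<le> a * r\<^sup>2 * (2 * x)" using \<rho> pos by (intro mult_left_mono) auto
    also have "\<dots> = (4 * a * \<kappa> * r\<^sup>2) * r\<^sup>2 / 2" by (simp add: x_def)
    also have "\<dots> \<le> 1 * r\<^sup>2 / 2" using r by (intro divide_right_mono mult_right_mono) auto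
    finally have "a * r\<^sup>2 * (x + \<rho>) \<le> r\<^sup>2 / 2" by simp
    moreover have "0 \<le> x * \<rho>" "0 \<le> m * r ^ 4" using \<rho> pos by (auto simp: x_def)
    ultimately show ?thesis using zero_le_power2[of x] zero_le_power2[of \<rho>] by linarith
  qed
  ultimately have "(x - \<rho>) * (r\<^sup>2 / 2) \<le> \<kappa> * (m + \<kappa>\<^sup>2 - a * \<kappa>) * r ^ 6"
    using mult_left_mono[of "r\<^sup>2 / 2" _ "x - \<rho>"] \<rho> fx by simp
  also have "\<dots> = (2 * \<kappa> * (m + \<kappa>\<^sup>2 - a * \<kappa>) * r ^ 4) * (r\<^sup>2 / 2)"
    by (simp add: eval_nat_numeral)
  finally have "x - \<rho> \<le> 2 * \<kappa> * (m + \<kappa>\<^sup>2 - a * \<kappa>) * r ^ 4"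
    using r by (subst (asm) mult_le_cancel_right) auto
  then show thesis
    using that[OF \<rho>pos] \<rho> unfolding x_def f_def by simp
qed

text \<open>
  The cubic symbol is factored as \<open>(\<lambda> + \<rho>) (\<lambda>\<^sup>2 + \<beta> \<lambda> + \<eta>)\<close>; applying to \<open>v\<close> the operators that
  remove one of the three roots leaves functions that solve first-order linear equations.
\<close>

lemma third_order_solution:
  fixes v v1 v2 v3 :: "real \<Rightarrow> complex" and \<rho> \<beta> \<eta> \<omega> :: real
  assumes cont: "continuous_on {0..} v" "continuous_on {0..} v1" "continuous_on {0..} v2"
    and deriv: "\<And>t. t > 0 \<Longrightarrow> (v has_vector_derivative v1 t) (at t)"
      "\<And>t. t > 0 \<Longrightarrow> (v1 has_vector_derivative v2 t) (at t)"
      "\<And>t. t > 0 \<Longrightarrow> (v2 has_vector_derivative v3 t) (at t)"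
    and ode: "\<And>t. t > 0 \<Longrightarrow> v3 t + of_real (\<rho> + \<beta>) * v2 t + of_real (\<eta> + \<rho> * \<beta>) * v1 t + of_real (\<rho> * \<eta>) * v t = 0"
    and \<omega>: "\<omega> \<noteq> 0" "\<omega>\<^sup>2 = \<eta> - \<beta>\<^sup>2 / 4" and t: "t \<ge> 0"
  defines "w0 \<equiv> v1 0 + of_real \<rho> * v 0" and "w1 \<equiv> v2 0 + of_real \<rho> * v1 0"
    and "\<mu> \<equiv> Complex (- \<beta> / 2) \<omega>"
  shows "of_real (\<rho>\<^sup>2 - \<beta> * \<rho> + \<eta>) * v t =
    of_real (exp (- \<rho> * t)) * (v2 0 + of_real \<beta> * v1 0 + of_real \<eta> * v 0)
    - (exp (\<mu> * of_real t) * (w1 - cnj \<mu> * w0) + exp (cnj \<mu> * of_real t) * (w1 - \<mu> * w0)) / 2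
    - of_real (\<beta> / 2 - \<rho>) * ((exp (\<mu> * of_real t) * (w1 - cnj \<mu> * w0) - exp (cnj \<mu> * of_real t) * (w1 - \<mu> * w0)) / (2 * \<i> * of_real \<omega>))"
proof -
  have v2_eq: "v3 t = - (of_real (\<rho> + \<beta>) * v2 t + of_real (\<eta> + \<rho> * \<beta>) * v1 t + of_real (\<rho> * \<eta>) * v t)" if "t > 0" for t
    using ode[OF that] by (simp add: add_eq_0_iff2 add.assoc)
  \<comment> \<open>\<open>\<mu>\<close> and its conjugate are the two roots of the quadratic
    factor.\<close>
  have \<mu>: "\<mu> + cnj \<mu> = - of_real \<beta>" "\<mu> * cnj \<mu> = of_real \<eta>" "\<mu> - cnj \<mu> = 2 * \<i> * of_real \<omega>"
    using \<omega>(2) by (auto simp: \<mu>_def complex_eq_iff power2_eq_square field_simps)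
  define z where "z t = v2 t + of_real \<beta> * v1 t + of_real \<eta> * v t" for t
  define w where "w t = v1 t + of_real \<rho> * v t" for t
  define w' where "w' t = v2 t + of_real \<rho> * v1 t" for t
  have z: "z t = exp (of_real (- \<rho>) * of_real t) * z 0"
  proof (rule linear_ode_unique[OF _ _ t])
    show "continuous_on {0..} z" unfolding z_def by (intro continuous_intros cont)
    fix t :: real assume t: "t > 0"
    have "(z has_vector_derivative (v3 t + of_real \<beta> * v2 t + of_real \<eta> * v1 t)) (at t)"
      unfolding z_def by (intro has_vector_derivative_add has_vector_derivative_mult_right deriv t)
    also have "v3 t + of_real \<beta> * v2 t + of_real \<eta> * v1 t = of_real (- \<rho>) * z t"
      unfolding v2_eq[OF t] z_def by (simp add: algebra_simps)
    finally show "(z has_vector_derivative of_real (- \<rho>) * z t) (at t)" .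
  qed
  \<comment> \<open>Here \<open>l\<close> is the root being removed and \<open>k\<close> the one
    that survives; the claim is used for both orderings of the conjugate pair.\<close>
  have second: "w' t - l * w t = exp (k * of_real t) * (w1 - l * w0)"
    if kl: "k + l = - of_real \<beta>" "k * l = of_real \<eta>" for k l
  proof -
    have "w' t - l * w t = exp (k * of_real t) * (w' 0 - l * w 0)"
    proof (rule linear_ode_unique[OF _ _ t, where f="\<lambda>t. w' t - l * w t"])
      show "continuous_on {0..} (\<lambda>t. w' t - l * w t)"
        unfolding w'_def w_def by (intro continuous_intros cont)
      fix t :: real assume t: "t > 0"
      have "((\<lambda>t. w' t - l * w t) has_vector_derivative (v3 t + of_real \<rho> * v2 t - l * (v2 t + of_real \<rho> * v1 t))) (at t)"
        unfolding w'_def w_def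
        by (intro has_vector_derivative_add has_vector_derivative_diff has_vector_derivative_mult_right deriv t)
      also have "v3 t + of_real \<rho> * v2 t - l * (v2 t + of_real \<rho> * v1 t) = k * (w' t - l * w t)"
      proof -
        have \<beta>: "complex_of_real \<beta> = - (k + l)" using kl(1) by simp
        show ?thesis unfolding v2_eq[OF t] w'_def w_def of_real_add of_real_mult \<beta> kl(2)[symmetric]
          by (simp add: algebra_simps)
      qed
      finally show "((\<lambda>t. w' t - l * w t) has_vector_derivative k * (w' t - l * w t)) (at t)" .
    qed
    then show ?thesis by (simp add: w'_def w_def w0_def w1_def)
  qed
  define X where "X = exp (\<mu> * of_real t) * (w1 - cnj \<mu> * w0)"
  define Y where "Y = exp (cnj \<mu> * of_real t) * (w1 - \<mu> * w0)"
  have X: "w' t - cnj \<mu> * w t = X" unfolding X_def using \<mu> by (intro second) auto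
  have Y: "w' t - \<mu> * w t = Y" unfolding Y_def using \<mu> by (intro second) (auto simp: add.commute mult.commute)
  have "X - Y = (\<mu> - cnj \<mu>) * w t" unfolding X[symmetric] Y[symmetric] by (simp add: algebra_simps)
  then have w_eq: "w t = (X - Y) / (2 * \<i> * of_real \<omega>)" using \<omega>(1) by (simp add: \<mu>(3))
  have "X + Y = 2 * w' t - (\<mu> + cnj \<mu>) * w t" unfolding X[symmetric] Y[symmetric] by (simp add: algebra_simps)
  then have w'_eq: "w' t = (X + Y) / 2 - of_real (\<beta> / 2) * w t" by (simp add: \<mu>(1) field_simps)
  \<comment> \<open>A partial fraction identity: this combination cancels the derivatives of
    \<open>v\<close>, and the remaining coefficient is the quadratic factor evaluated at
    -\<rho>.\<close>
  have "of_real (\<rho>\<^sup>2 - \<beta> * \<rho> + \<eta>) * v t = z t - w' t - of_real (\<beta> - \<rho>) * w t"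
    by (simp add: z_def w'_def w_def algebra_simps power2_eq_square)
  also have "\<dots> = z t - (X + Y) / 2 - of_real (\<beta> / 2 - \<rho>) * w t"
    unfolding w'_eq by (simp add: algebra_simps)
  also have "z t = of_real (exp (- \<rho> * t)) * (v2 0 + of_real \<beta> * v1 0 + of_real \<eta> * v 0)"
    using z unfolding z_def by (simp add: exp_of_real[symmetric])
  finally show ?thesis unfolding w_eq X_def Y_def .
qed

section \<open>Comparing exact exponentials and phases with their models\<close>

lemma abs_exp_minus_le:
  fixes x y z :: real
  assumes "z \<le> x" "z \<le> y"
  shows "\<bar>exp (- x) - exp (- y)\<bar> \<le> \<bar>x - y\<bar> * exp (- z)"
proof -
  have *: "\<bar>exp (- x) - exp (- y)\<bar> \<le> \<bar>x - y\<bar> * exp (- z)" if "x \<le> y" "z \<le> x" for x y :: real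
  proof -
    have "exp (- x) - exp (- y) = exp (- x) * (1 - exp (- (y - x)))"
      by (simp add: right_diff_distrib exp_add[symmetric])
    also have "\<dots> \<le> exp (- z) * (y - x)"
    proof (rule mult_mono)
      show "1 - exp (- (y - x)) \<le> y - x" using exp_ge_add_one_self[of "- (y - x)"] by linarith
    qed (use that in auto)
    finally show ?thesis using that by (simp add: mult.commute)
  qed
  show ?thesis
    using *[of x y] *[of y x] assms by (cases "x \<le> y") (auto simp: abs_minus_commute)
qed

lemma abs_cos_diff_le: "\<bar>cos x - cos y\<bar> \<le> \<bar>x - y\<bar>" for x y :: real
proof -
  have "cos x - cos y = 2 * (sin ((x + y) / 2) * sin ((y - x) / 2))" by (simp add: cos_diff_cos)
  then have "\<bar>cos x - cos y\<bar> = 2 * (\<bar>sin ((x + y) / 2)\<bar> * \<bar>sin ((y - x) / 2)\<bar>)" by (simp add: abs_mult)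
  also have "\<dots> \<le> 2 * (1 * \<bar>(y - x) / 2\<bar>)"
    by (intro mult_left_mono mult_mono abs_sin_x_le_abs_x) auto
  finally show ?thesis by simp
qed


text \<open>A growing factor is absorbed by giving up half of the exponential rate. Applied to x =
  r^2 t, it removes t and leaves powers of r.\<close>

lemma mult_exp_minus_le:
  fixes d x :: real
  assumes "d > 0"
  shows "x * exp (- (d * x)) \<le> 2 / d * exp (- (d * x / 2))"
proof -
  have "d * x / 2 \<le> exp (d * x / 2)" using exp_ge_add_one_self[of "d * x / 2"] by linarith
  then have "x \<le> 2 / d * exp (d * x / 2)" using assms by (simp add: field_simps)
  then have "x * exp (- (d * x)) \<le> 2 / d * exp (d * x / 2) * exp (- (d * x))"
    by (rule mult_right_mono) simp
  also have "\<dots> = 2 / d * exp (- (d * x / 2))" by (simp add: mult.assoc exp_add[symmetric])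
  finally show ?thesis .
qed

definition diffusion_wave :: "real \<Rightarrow> real \<Rightarrow> real \<Rightarrow> real \<Rightarrow> real" where
  "diffusion_wave \<kappa> \<delta> r t = exp (- (\<kappa> * r\<^sup>2 * t)) - exp (- (\<delta> / 2 * r\<^sup>2 * t)) * cos (r * t)"

text \<open>By Vieta the remaining parameters follow from \<rho>: relative to the model, the decay
  rates are off by O(r^4), the frequency \<omega> by O(r^3) and the denominator Q by O(r^4).
  Multiplied by t, the exponent and phase errors are O(r^3 t); the exponential absorbs r^2 t and
  leaves one factor r. Division by Q, which is of size r^2, gives the final 1 / r.\<close>

lemma third_order_low_frequency:
  fixes a \<kappa> m :: real
  assumes pos: "\<kappa> > 0" "m > 0" "a > \<kappa>" and e: "a * \<kappa> \<le> m + \<kappa>\<^sup>2"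
  shows "\<exists>r0>0. \<exists>c>0. \<exists>C>0. r0 \<le> 1 \<and> (\<forall>r. 0 < r \<and> r \<le> r0 \<longrightarrow> (\<forall>v v1 v2 v3 :: real \<Rightarrow> complex.
    continuous_on {0..} v \<and> continuous_on {0..} v1 \<and> continuous_on {0..} v2 \<and>
    (\<forall>t>0. (v has_vector_derivative v1 t) (at t) \<and> (v1 has_vector_derivative v2 t) (at t) \<and>
       (v2 has_vector_derivative v3 t) (at t) \<and>
       v3 t + of_real (a * r\<^sup>2) * v2 t + of_real (r\<^sup>2 + m * r ^ 4) * v1 t + of_real (\<kappa> * r ^ 4) * v t = 0) \<longrightarrow>
    (\<forall>t\<ge>0. cmod (v t - of_real (diffusion_wave \<kappa> (a - \<kappa>) r t / r\<^sup>2) * v2 0)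
        \<le> C * exp (- (c * r\<^sup>2 * t)) * (cmod (v 0) + cmod (v1 0) + cmod (v2 0)) / r)))"
proof -
  define \<delta> where "\<delta> = a - \<kappa>"
  \<comment> \<open>A single constant that dominates all coefficients and is at least 1, so that
    lower powers of M may be replaced by higher ones.\<close>
  define M where "M = 1 + a + \<kappa> + m"
  \<comment> \<open>\<open>d * r\<^sup>2\<close> lies below all four rates involved, exact and
    model. The root \<rho> is known to be at least \<kappa> r^2 / 2 only, whence the factor 1 /
    2.\<close>
  define d where "d = min \<kappa> \<delta> / 2"
  \<comment> \<open>The factor 4 comes from Q \<ge> r^2 / 4, and \<open>24 * M\<^sup>2\<close> from
    replacing Q by r^2 in the profile.\<close>
  define C where "C = 4 * (26 * M\<^sup>2 + 12 * M ^ 3 / d) + 24 * M\<^sup>2"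
  \<comment> \<open>The bound 1 / (2 M) makes M r^2 \<le> r / 2 and 4 M^2 r^2 \<le> 1. The square
    root keeps the displacement of the real root below \<kappa> r^2 / 2.\<close>
  define r0 where "r0 = min 1 (min (1 / (2 * M)) (sqrt (\<kappa> / (4 * M ^ 3))))"
  have M: "1 \<le> M" "a \<le> M" "\<kappa> \<le> M" "m \<le> M" "0 < M" using pos by (auto simp: M_def)
  have \<delta>: "0 < \<delta>" using pos by (simp add: \<delta>_def)
  have d: "0 < d" "d \<le> \<kappa> / 2" "d \<le> \<delta> / 2" using pos \<delta> by (auto simp: d_def)
  have M2: "1 \<le> M\<^sup>2" "M \<le> M\<^sup>2" "M\<^sup>2 \<le> M ^ 3"
    using M power_increasing[of 0 2 M] power_increasing[of 1 2 M] power_increasing[of 2 3 M] by auto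
  have C: "C > 0" unfolding C_def using M d by (auto intro!: add_pos_nonneg mult_pos_pos)
  have r0: "0 < r0" "r0 \<le> 1" using M pos by (auto simp: r0_def)
  have main: "cmod (v t - of_real (diffusion_wave \<kappa> \<delta> r t / r\<^sup>2) * v2 0)
        \<le> C * exp (- (d / 2 * r\<^sup>2 * t)) * (cmod (v 0) + cmod (v1 0) + cmod (v2 0)) / r"
    if r: "0 < r" "r \<le> r0" and cont: "continuous_on {0..} v" "continuous_on {0..} v1" "continuous_on {0..} v2"
      and ode: "\<forall>t>0. (v has_vector_derivative v1 t) (at t) \<and> (v1 has_vector_derivative v2 t) (at t) \<and>
       (v2 has_vector_derivative v3 t) (at t) \<and>
       v3 t + of_real (a * r\<^sup>2) * v2 t + of_real (r\<^sup>2 + m * r ^ 4) * v1 t + of_real (\<kappa> * r ^ 4) * v t = 0"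
      and t: "t \<ge> 0" for r v v1 v2 v3 t
  proof -
    have r1: "r \<le> 1" "2 * M * r \<le> 1" using r M by (auto simp: r0_def field_simps)
    have Mr: "4 * M\<^sup>2 * r\<^sup>2 \<le> 1" using power_mono[OF r1(2), of 2] r M by (simp add: power_mult_distrib)
    have M3r: "4 * M ^ 3 * r\<^sup>2 \<le> \<kappa>"
    proof -
      have "r \<le> sqrt (\<kappa> / (4 * M ^ 3))" using r by (simp add: r0_def)
      then have "r\<^sup>2 \<le> \<kappa> / (4 * M ^ 3)" using r by (intro sqrt_ge_absD) simp
      then show ?thesis using M by (simp add: field_simps)
    qed
    have r4: "r ^ 4 = r\<^sup>2 * r\<^sup>2" "r ^ 3 = r\<^sup>2 * r" by (simp_all add: eval_nat_numeral)
    have r2: "0 < r\<^sup>2" "r\<^sup>2 \<le> r" "r\<^sup>2 \<le> 1" using r r1 by (auto simp: power2_eq_square mult_le_one mult_left_le)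
    have Mr1: "M * r\<^sup>2 \<le> r" "M * r\<^sup>2 \<le> 1 / 2"
    proof -
      have "M * r\<^sup>2 = (2 * M * r) * r / 2" by (simp add: power2_eq_square)
      also have "\<dots> \<le> 1 * r / 2" using r1 r by (intro divide_right_mono mult_right_mono) auto
      finally show "M * r\<^sup>2 \<le> r" "M * r\<^sup>2 \<le> 1 / 2" using r r1 by auto
    qed
    have ak: "4 * a * \<kappa> * r\<^sup>2 \<le> 1"
    proof -
      have "a * \<kappa> \<le> M * M" using M pos by (intro mult_mono) auto
      then have "4 * (a * \<kappa>) * r\<^sup>2 \<le> 4 * (M * M) * r\<^sup>2" by (intro mult_right_mono) auto
      with Mr show ?thesis by (simp add: power2_eq_square mult.assoc)
    qed
    have apos: "0 < a" using pos by simp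
    obtain \<rho> where \<rho>: "0 < \<rho>" "\<rho> \<le> \<kappa> * r\<^sup>2" "\<kappa> * r\<^sup>2 - \<rho> \<le> 2 * \<kappa> * (m + \<kappa>\<^sup>2 - a * \<kappa>) * r ^ 4"
      and root: "\<rho> ^ 3 - a * r\<^sup>2 * \<rho>\<^sup>2 + (r\<^sup>2 + m * r ^ 4) * \<rho> = \<kappa> * r ^ 4"
      using cubic_root_near[OF pos(1,2) apos e r(1) ak] by metis
    define \<theta> where "\<theta> = \<kappa> * r\<^sup>2 - \<rho>"
    have \<theta>0: "0 \<le> \<theta>" using \<rho> by (simp add: \<theta>_def)
    have \<theta>: "\<theta> \<le> 2 * M ^ 3 * r ^ 4"
    proof -
      have "m + \<kappa>\<^sup>2 - a * \<kappa> = m - \<kappa> * \<delta>" by (simp add: \<delta>_def power2_eq_square algebra_simps)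
      also have "\<dots> \<le> M" using M pos \<delta> mult_pos_pos[OF pos(1) \<delta>] by linarith
      also have "\<dots> \<le> M\<^sup>2" by (rule M2)
      finally have "\<kappa> * (m + \<kappa>\<^sup>2 - a * \<kappa>) \<le> M * M\<^sup>2" using M pos e by (intro mult_mono) auto
      then have "2 * (\<kappa> * (m + \<kappa>\<^sup>2 - a * \<kappa>)) * r ^ 4 \<le> 2 * (M * M\<^sup>2) * r ^ 4" by (intro mult_right_mono) auto
      with \<rho>(3) show ?thesis by (simp add: \<theta>_def power3_eq_cube power2_eq_square mult.assoc)
    qed
    have \<rho>_lower: "\<kappa> / 2 * r\<^sup>2 \<le> \<rho>"
    proof -
      have "2 * M ^ 3 * r ^ 4 = (4 * M ^ 3 * r\<^sup>2) * r\<^sup>2 / 2" unfolding r4(1) by simp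
      also have "\<dots> \<le> \<kappa> * r\<^sup>2 / 2" using M3r by (intro divide_right_mono mult_right_mono) auto
      finally show ?thesis using \<theta> by (simp add: \<theta>_def)
    qed
    have \<rho>M: "\<rho> \<le> M * r\<^sup>2" using \<rho>(2) mult_right_mono[OF M(3), of "r\<^sup>2"] by simp
    define \<beta> where "\<beta> = a * r\<^sup>2 - \<rho>"
    have \<beta>\<theta>: "\<beta> = \<delta> * r\<^sup>2 + \<theta>" by (simp add: \<beta>_def \<theta>_def \<delta>_def algebra_simps)
    have \<beta>0: "0 \<le> \<beta>" "\<delta> * r\<^sup>2 \<le> \<beta>" unfolding \<beta>\<theta> using \<theta>0 \<delta> by auto
    have \<beta>M: "\<beta> \<le> M * r\<^sup>2" using \<rho>(1) mult_right_mono[OF M(2), of "r\<^sup>2"] by (simp add: \<beta>_def)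
    \<comment> \<open>Vieta's formulas: \<open>\<beta>\<close> and \<open>\<eta>\<close> are the
      coefficients of the quadratic factor left after dividing out the real root.\<close>
    define \<eta> where "\<eta> = r\<^sup>2 + m * r ^ 4 - \<rho> * \<beta>"
    have prod: "x * y \<le> M\<^sup>2 * r ^ 4" if "0 \<le> x" "x \<le> M * r\<^sup>2" "0 \<le> y" "y \<le> M * r\<^sup>2" for x y
    proof -
      have "x * y \<le> (M * r\<^sup>2) * (M * r\<^sup>2)" using that by (intro mult_mono) auto
      also have "\<dots> = M\<^sup>2 * r ^ 4" by (simp add: eval_nat_numeral)
      finally show ?thesis .
    qed
    have \<rho>\<beta>: "0 \<le> \<rho> * \<beta>" "\<rho> * \<beta> \<le> M\<^sup>2 * r ^ 4" using \<rho>(1) \<beta>0 \<rho>M \<beta>M by (auto intro: prod)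
    have mr: "0 \<le> m * r ^ 4" "m * r ^ 4 \<le> M\<^sup>2 * r ^ 4" using pos M M2 by (auto intro!: mult_right_mono)
    have \<eta>: "\<bar>\<eta> - r\<^sup>2\<bar> \<le> M\<^sup>2 * r ^ 4" using \<rho>\<beta> mr by (auto simp: \<eta>_def abs_le_iff)
    have \<beta>\<beta>: "0 \<le> \<beta>\<^sup>2" "\<beta>\<^sup>2 \<le> M\<^sup>2 * r ^ 4" using prod[OF \<beta>0(1) \<beta>M \<beta>0(1) \<beta>M] by (auto simp: power2_eq_square)
    have \<rho>\<rho>: "0 \<le> \<rho>\<^sup>2" "\<rho>\<^sup>2 \<le> M\<^sup>2 * r ^ 4" using prod[OF less_imp_le[OF \<rho>(1)] \<rho>M less_imp_le[OF \<rho>(1)] \<rho>M] by (auto simp: power2_eq_square)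
    have Mr4: "M\<^sup>2 * r ^ 4 \<le> r\<^sup>2 / 4" "0 \<le> M\<^sup>2 * r ^ 4"
    proof -
      have "M\<^sup>2 * r ^ 4 = (4 * M\<^sup>2 * r\<^sup>2) * (r\<^sup>2 / 4)" by (simp add: eval_nat_numeral)
      also have "\<dots> \<le> 1 * (r\<^sup>2 / 4)" using Mr by (intro mult_right_mono) auto
      finally show "M\<^sup>2 * r ^ 4 \<le> r\<^sup>2 / 4" by simp
    qed simp
    define \<omega> where "\<omega> = sqrt (\<eta> - \<beta>\<^sup>2 / 4)"
    have disc: "\<bar>\<eta> - \<beta>\<^sup>2 / 4 - r\<^sup>2\<bar> \<le> 3 * M\<^sup>2 * r ^ 4" "r\<^sup>2 / 4 \<le> \<eta> - \<beta>\<^sup>2 / 4" "\<eta> - \<beta>\<^sup>2 / 4 \<le> 4 * r\<^sup>2"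
      using \<eta> \<beta>\<beta> Mr4 r2 unfolding abs_le_iff mult.assoc by - ((intro conjI)?; linarith)+
    have \<omega>2: "\<omega>\<^sup>2 = \<eta> - \<beta>\<^sup>2 / 4" unfolding \<omega>_def using disc(2) r2 by (intro real_sqrt_pow2) linarith
    have \<omega>: "r / 2 \<le> \<omega>" "\<omega> \<le> 2 * r"
      using real_sqrt_le_mono[OF disc(2)] real_sqrt_le_mono[OF disc(3)] r
      by (auto simp: \<omega>_def real_sqrt_divide real_sqrt_mult)
    have \<omega>pos: "0 < \<omega>" using \<omega> r by simp
    have \<omega>r: "\<bar>\<omega> - r\<bar> \<le> 3 * M\<^sup>2 * r ^ 3"
    proof -
      have "\<bar>\<omega> - r\<bar> * r \<le> \<bar>\<omega> - r\<bar> * (\<omega> + r)" using \<omega>pos by (intro mult_left_mono) auto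
      also have "\<dots> = \<bar>\<omega>\<^sup>2 - r\<^sup>2\<bar>" 
      proof -
        have "\<omega>\<^sup>2 - r\<^sup>2 = (\<omega> - r) * (\<omega> + r)" by (simp add: power2_eq_square algebra_simps)
        then show ?thesis using \<omega>pos r by (simp add: abs_mult)
      qed
      also have "\<dots> \<le> (3 * M\<^sup>2 * r ^ 3) * r" 
      proof -
        have "(3 * M\<^sup>2 * r ^ 3) * r = 3 * M\<^sup>2 * r ^ 4" by (simp add: eval_nat_numeral)
        then show ?thesis using disc(1) by (simp only: \<omega>2)
      qed

      finally show ?thesis using r by (subst (asm) mult_le_cancel_right) auto
    qed
    define Q where "Q = \<rho>\<^sup>2 - \<beta> * \<rho> + \<eta>"
    have Q: "\<bar>Q - r\<^sup>2\<bar> \<le> 3 * M\<^sup>2 * r ^ 4" "r\<^sup>2 / 4 \<le> Q"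
      using \<rho>\<rho> \<rho>\<beta> \<eta> Mr4 r2 unfolding Q_def mult.commute[of \<beta>] abs_le_iff mult.assoc
      by - ((intro conjI)?; linarith)+
    have Qpos: "0 < Q" using Q(2) r2 by linarith
    let ?N = "cmod (v 0) + cmod (v1 0) + cmod (v2 0)"
    define N where "N = ?N"
    have N: "cmod (v 0) \<le> N" "cmod (v1 0) \<le> N" "cmod (v2 0) \<le> N" "0 \<le> N" by (auto simp: N_def)
    define \<mu> where "\<mu> = Complex (- \<beta> / 2) \<omega>"
    define w0 where "w0 = v1 0 + of_real \<rho> * v 0"
    define w1 where "w1 = v2 0 + of_real \<rho> * v1 0"
    define A where "A = w1 - cnj \<mu> * w0"
    define B where "B = w1 - \<mu> * w0"
    \<comment> \<open>\<open>G\<close> is a common bound for all exponentials; \<open>G2\<close>,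
      with half the rate, is what remains after a factor r^2 t has been absorbed.\<close>
    define G where "G = exp (- (d * (r\<^sup>2 * t)))"
    define G2 where "G2 = exp (- (d * (r\<^sup>2 * t) / 2))"
    define E where "E = exp (- (\<beta> / 2 * t))"
    have r2t: "0 \<le> r\<^sup>2 * t" using t by simp
    have rate: "d * (r\<^sup>2 * t) \<le> \<rho> * t" "d * (r\<^sup>2 * t) \<le> \<beta> / 2 * t" "d * (r\<^sup>2 * t) \<le> \<kappa> * r\<^sup>2 * t"
      "d * (r\<^sup>2 * t) \<le> \<delta> / 2 * r\<^sup>2 * t"
    proof -
      have "0 \<le> d * r\<^sup>2" using d by simp
      then have "d * r\<^sup>2 \<le> \<rho>" "d * r\<^sup>2 \<le> \<beta> / 2" "d * r\<^sup>2 \<le> \<kappa> * r\<^sup>2" "d * r\<^sup>2 \<le> \<delta> / 2 * r\<^sup>2"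
        using mult_right_mono[OF d(2), of "r\<^sup>2"] mult_right_mono[OF d(3), of "r\<^sup>2"] \<rho>_lower \<beta>0(2) pos by auto
      from this[THEN mult_right_mono[OF _ t]] show "d * (r\<^sup>2 * t) \<le> \<rho> * t" "d * (r\<^sup>2 * t) \<le> \<beta> / 2 * t" "d * (r\<^sup>2 * t) \<le> \<kappa> * r\<^sup>2 * t"
      "d * (r\<^sup>2 * t) \<le> \<delta> / 2 * r\<^sup>2 * t" by (simp_all only: mult.assoc)
    qed
    have G: "exp (- \<rho> * t) \<le> G" "E \<le> G" "exp (- (\<kappa> * r\<^sup>2 * t)) \<le> G" "exp (- (\<delta> / 2 * r\<^sup>2 * t)) \<le> G" "0 < G" "G \<le> G2" "0 < E"
      using rate r2t d t by (auto simp: G_def G2_def E_def)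
    have rtG: "r\<^sup>2 * t * G \<le> 2 / d * G2"
      using mult_exp_minus_le[OF d(1), of "r\<^sup>2 * t"] by (simp add: G_def G2_def)
    have repr: "of_real Q * v t = of_real (exp (- \<rho> * t)) * (v2 0 + of_real \<beta> * v1 0 + of_real \<eta> * v 0)
      - (exp (\<mu> * of_real t) * A + exp (cnj \<mu> * of_real t) * B) / 2
      - of_real (\<beta> / 2 - \<rho>) * ((exp (\<mu> * of_real t) * A - exp (cnj \<mu> * of_real t) * B) / (2 * \<i> * of_real \<omega>))"
      unfolding Q_def A_def B_def w0_def w1_def \<mu>_def
    proof (rule third_order_solution[OF cont _ _ _ _ _ \<omega>2 t, where ?v3.0=v3])
      have eqs: "\<rho> + \<beta> = a * r\<^sup>2" "\<eta> + \<rho> * \<beta> = r\<^sup>2 + m * r ^ 4" "\<rho> * \<eta> = \<kappa> * r ^ 4"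
        using root by (auto simp: \<beta>_def \<eta>_def algebra_simps power2_eq_square power3_eq_cube)
      show "v3 t + of_real (\<rho> + \<beta>) * v2 t + of_real (\<eta> + \<rho> * \<beta>) * v1 t + of_real (\<rho> * \<eta>) * v t = 0" if "t > 0" for t
        unfolding eqs using ode that by blast
    qed (use ode \<omega>pos in auto)
    have \<mu>: "cmod \<mu> \<le> 3 * r"
      using cmod_le[of \<mu>] \<beta>0 \<beta>M Mr1 \<omega> \<omega>pos by (simp add: \<mu>_def)
    have exp\<mu>: "cmod (exp (\<mu> * of_real t)) = E" "cmod (exp (cnj \<mu> * of_real t)) = E"
      by (simp_all add: norm_exp_eq_Re \<mu>_def E_def)
    have exp_sum: "(exp (\<mu> * of_real t) + exp (cnj \<mu> * of_real t)) / 2 = of_real (E * cos (\<omega> * t))"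
    proof -
      have "exp (cnj \<mu> * of_real t) = cnj (exp (\<mu> * of_real t))" by (simp add: exp_cnj)
      then have "(exp (\<mu> * of_real t) + exp (cnj \<mu> * of_real t)) / 2 = of_real (Re (exp (\<mu> * of_real t)))"
        by (simp add: complex_add_cnj)
      also have "Re (exp (\<mu> * of_real t)) = E * cos (\<omega> * t)" by (simp add: Re_exp \<mu>_def E_def)
      finally show ?thesis .
    qed
    have w0: "cmod w0 \<le> 2 * N"
    proof -
      have "cmod w0 \<le> cmod (v1 0) + \<rho> * cmod (v 0)"
        unfolding w0_def using norm_triangle_ineq[of "v1 0" "of_real \<rho> * v 0"] \<rho>(1) by (simp add: norm_mult)
      also have "\<dots> \<le> N + 1 * N" using N \<rho>M Mr1 \<rho>(1) by (intro add_mono mult_mono) auto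
      finally show ?thesis by simp
    qed
    have AB: "cmod (w1 - x * w0 - v2 0) \<le> 7 * r * N" if "cmod x \<le> 3 * r" for x
    proof -
      have "w1 - x * w0 - v2 0 = of_real \<rho> * v1 0 - x * w0" by (simp add: w1_def)
      also have "cmod \<dots> \<le> \<rho> * cmod (v1 0) + cmod x * cmod w0"
        using norm_triangle_ineq4[of "of_real \<rho> * v1 0" "x * w0"] \<rho>(1) by (simp add: norm_mult)
      also have "\<dots> \<le> r * N + 3 * r * (2 * N)"
        using N \<rho>M Mr1 \<rho>(1) r that w0 by (intro add_mono mult_mono) auto
      also have "\<dots> = 7 * r * N" by simp
      finally show ?thesis .
    qed
    have A: "cmod (A - v2 0) \<le> 7 * r * N" and B: "cmod (B - v2 0) \<le> 7 * r * N"
      unfolding A_def B_def using \<mu> by (auto intro: AB)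
    have AB8: "cmod A \<le> 8 * N" "cmod B \<le> 8 * N"
    proof -
      have "7 * r * N \<le> 7 * 1 * N" using r1 r N by (intro mult_mono) auto
      then show "cmod A \<le> 8 * N" "cmod B \<le> 8 * N"
        using norm_triangle_sub[of A "v2 0"] norm_triangle_sub[of B "v2 0"] A B N by auto
    qed
    \<comment> \<open>Three remainders of relative size r: \<open>T1\<close> carries the first two
      data in the real mode, \<open>T2\<close> the replacement of the two oscillating amplitudes by
      the third datum, and \<open>T3\<close> the sine part, whose coefficient is of order r^2 and is
      divided only by \<omega>, of order r.\<close>
    define T1 where "T1 = of_real (exp (- \<rho> * t)) * (of_real \<beta> * v1 0 + of_real \<eta> * v 0)"
    define T2 where "T2 = (exp (\<mu> * of_real t) * (A - v2 0) + exp (cnj \<mu> * of_real t) * (B - v2 0)) / 2"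
    define T3 where "T3 = of_real (\<beta> / 2 - \<rho>) * ((exp (\<mu> * of_real t) * A - exp (cnj \<mu> * of_real t) * B) / (2 * \<i> * of_real \<omega>))"
    define D where "D = exp (- \<rho> * t) - E * cos (\<omega> * t)"
    have split: "of_real Q * v t = of_real D * v2 0 + T1 - T2 - T3"
    proof -
      have "(exp (\<mu> * of_real t) * A + exp (cnj \<mu> * of_real t) * B) / 2
          = T2 + (exp (\<mu> * of_real t) + exp (cnj \<mu> * of_real t)) / 2 * v2 0"
        by (simp add: T2_def algebra_simps add_divide_distrib diff_divide_distrib)
      then show ?thesis
        unfolding repr exp_sum T1_def T3_def[symmetric] D_def by (simp add: algebra_simps)
    qed
    have T1: "cmod T1 \<le> G * (3 * r * N)"
    proof -
      have "cmod (of_real \<beta> * v1 0 + of_real \<eta> * v 0) \<le> \<beta> * cmod (v1 0) + \<bar>\<eta>\<bar> * cmod (v 0)"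
        using norm_triangle_ineq[of "of_real \<beta> * v1 0" "of_real \<eta> * v 0"] \<beta>0 by (simp add: norm_mult)
      also have "\<dots> \<le> r * N + (2 * r) * N"
        using \<beta>0 \<beta>M Mr1 \<eta> Mr4 r2 N r by (intro add_mono mult_mono) auto
      also have "\<dots> = 3 * r * N" by simp
      finally have "exp (- \<rho> * t) * cmod (of_real \<beta> * v1 0 + of_real \<eta> * v 0) \<le> G * (3 * r * N)"
        using G r N by (intro mult_mono) auto
      then show ?thesis unfolding T1_def norm_mult[of "of_real (exp (- \<rho> * t))"] by simp
    qed
    have T2: "cmod T2 \<le> G * (7 * r * N)"
    proof -
      have "cmod T2 \<le> (E * cmod (A - v2 0) + E * cmod (B - v2 0)) / 2"
        unfolding T2_def using norm_triangle_ineq[of "exp (\<mu> * of_real t) * (A - v2 0)" "exp (cnj \<mu> * of_real t) * (B - v2 0)"]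
        unfolding norm_mult exp\<mu> by (simp add: norm_divide)
      also have "\<dots> \<le> (G * (7 * r * N) + G * (7 * r * N)) / 2"
        using A B G by (intro divide_right_mono add_mono mult_mono) auto
      finally show ?thesis by (simp add: algebra_simps)
    qed
    have T3: "cmod T3 \<le> G * (16 * M * r * N)"
    proof -
      have "cmod (exp (\<mu> * of_real t) * A - exp (cnj \<mu> * of_real t) * B) \<le> E * cmod A + E * cmod B"
        using norm_triangle_ineq4[of "exp (\<mu> * of_real t) * A" "exp (cnj \<mu> * of_real t) * B"] unfolding norm_mult exp\<mu> .
      also have "\<dots> \<le> G * (8 * N) + G * (8 * N)" using AB8 G by (intro add_mono mult_mono) auto
      finally have num: "cmod (exp (\<mu> * of_real t) * A - exp (cnj \<mu> * of_real t) * B) \<le> G * (16 * N)" by (simp add: algebra_simps)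
      have "cmod T3 = \<bar>\<beta> / 2 - \<rho>\<bar> * (cmod (exp (\<mu> * of_real t) * A - exp (cnj \<mu> * of_real t) * B) / (2 * \<omega>))"
        unfolding T3_def norm_mult norm_divide norm_of_real using \<omega>pos by simp
      also have "\<dots> \<le> (M * r\<^sup>2) * (G * (16 * N) / r)"
      proof (rule mult_mono)
        show "\<bar>\<beta> / 2 - \<rho>\<bar> \<le> M * r\<^sup>2" using \<beta>0 \<beta>M \<rho>M \<rho>(1) by (auto simp: abs_le_iff)
        show "cmod (exp (\<mu> * of_real t) * A - exp (cnj \<mu> * of_real t) * B) / (2 * \<omega>) \<le> G * (16 * N) / r"
          using num \<omega> r N G by (intro frac_le) auto
      qed (use M \<omega>pos in auto)
      also have "\<dots> = G * (16 * M * r * N)" using r by (simp add: power2_eq_square)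
      finally show ?thesis .
    qed
    define J where "J = diffusion_wave \<kappa> \<delta> r t"
    have DJ: "\<bar>D - J\<bar> \<le> 12 * M ^ 3 / d * r * G2"
    proof -
      have "\<bar>exp (- (\<rho> * t)) - exp (- (\<kappa> * r\<^sup>2 * t))\<bar> \<le> \<bar>\<rho> * t - \<kappa> * r\<^sup>2 * t\<bar> * G"
        unfolding G_def by (rule abs_exp_minus_le) (fact rate)+
      also have "\<bar>\<rho> * t - \<kappa> * r\<^sup>2 * t\<bar> = \<theta> * t" using \<theta>0 t by (simp add: \<theta>_def abs_mult flip: left_diff_distrib)
      finally have 1: "\<bar>exp (- (\<rho> * t)) - exp (- (\<kappa> * r\<^sup>2 * t))\<bar> \<le> \<theta> * t * G" .
      have "\<bar>exp (- (\<beta> / 2 * t)) - exp (- (\<delta> / 2 * r\<^sup>2 * t))\<bar> \<le> \<bar>\<beta> / 2 * t - \<delta> / 2 * r\<^sup>2 * t\<bar> * G"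
        unfolding G_def by (rule abs_exp_minus_le) (fact rate)+
      also have "\<bar>\<beta> / 2 * t - \<delta> / 2 * r\<^sup>2 * t\<bar> = \<theta> / 2 * t"
        using \<theta>0 t unfolding \<beta>\<theta> by (simp add: abs_mult add_divide_distrib algebra_simps)
      also have "\<dots> * G \<le> \<theta> * t * G" using \<theta>0 t G by (intro mult_right_mono) auto
      finally have 2: "\<bar>E - exp (- (\<delta> / 2 * r\<^sup>2 * t))\<bar> \<le> \<theta> * t * G" by (simp add: E_def)
      have 3: "\<bar>cos (\<omega> * t) - cos (r * t)\<bar> \<le> 3 * M\<^sup>2 * r ^ 3 * t"
      proof -
        have "\<bar>cos (\<omega> * t) - cos (r * t)\<bar> \<le> \<bar>\<omega> * t - r * t\<bar>" by (rule abs_cos_diff_le)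
        also have "\<dots> = \<bar>\<omega> - r\<bar> * t" using t by (simp add: abs_mult flip: left_diff_distrib)
        also have "\<dots> \<le> 3 * M\<^sup>2 * r ^ 3 * t" using \<omega>r t by (rule mult_right_mono)
        finally show ?thesis .
      qed
      have "D - J = (exp (- (\<rho> * t)) - exp (- (\<kappa> * r\<^sup>2 * t))) - (E - exp (- (\<delta> / 2 * r\<^sup>2 * t))) * cos (\<omega> * t)
          - exp (- (\<delta> / 2 * r\<^sup>2 * t)) * (cos (\<omega> * t) - cos (r * t))"
        by (simp add: D_def J_def diffusion_wave_def algebra_simps)
      also have "\<bar>\<dots>\<bar> \<le> \<bar>exp (- (\<rho> * t)) - exp (- (\<kappa> * r\<^sup>2 * t))\<bar> + \<bar>(E - exp (- (\<delta> / 2 * r\<^sup>2 * t))) * cos (\<omega> * t)\<bar>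
          + \<bar>exp (- (\<delta> / 2 * r\<^sup>2 * t)) * (cos (\<omega> * t) - cos (r * t))\<bar>"
        by linarith
      also have "\<dots> \<le> \<theta> * t * G + \<theta> * t * G * 1 + G * (3 * M\<^sup>2 * r ^ 3 * t)"
        unfolding abs_mult using 1 2 3 G \<theta>0 t by (intro add_mono mult_mono) auto
      also have "\<dots> = (2 * \<theta> + 3 * M\<^sup>2 * r ^ 3) * (t * G)" by (simp add: algebra_simps)
      also have "\<dots> \<le> (6 * M ^ 3 * r ^ 3) * (t * G)"
      proof (rule mult_right_mono)
        have "M ^ 3 * r ^ 4 \<le> M ^ 3 * (r ^ 3 / (2 * M))"
        proof (rule mult_left_mono)
          have "r ^ 4 * (2 * M) = r ^ 3 * (2 * M * r)" by (simp add: eval_nat_numeral)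
          also have "\<dots> \<le> r ^ 3 * 1" using r1 r by (intro mult_left_mono) auto
          finally show "r ^ 4 \<le> r ^ 3 / (2 * M)" using M by (simp add: pos_le_divide_eq)
        qed (use M in simp)
        moreover have "M ^ 3 * (r ^ 3 / (2 * M)) = M\<^sup>2 * r ^ 3 / 2" using M by (simp add: eval_nat_numeral)
        moreover have "M\<^sup>2 * r ^ 3 \<le> M ^ 3 * r ^ 3" using M2 r by (intro mult_right_mono) auto
        ultimately show "2 * \<theta> + 3 * M\<^sup>2 * r ^ 3 \<le> 6 * M ^ 3 * r ^ 3" using \<theta> \<theta>0 unfolding mult.assoc by linarith
      qed (use t G in simp)
      also have "\<dots> = 6 * M ^ 3 * r * (r\<^sup>2 * t * G)" by (simp add: eval_nat_numeral)
      also have "\<dots> \<le> 6 * M ^ 3 * r * (2 / d * G2)" using rtG M r by (intro mult_left_mono) auto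
      finally show ?thesis by (simp add: mult_ac)
    qed
    have Qv: "cmod (of_real Q * v t - of_real J * v2 0) \<le> (26 * M\<^sup>2 + 12 * M ^ 3 / d) * (r * N * G2)"
    proof -
      have "of_real Q * v t - of_real J * v2 0 = of_real (D - J) * v2 0 + T1 - T2 - T3"
        unfolding split by (simp add: algebra_simps)
      also have "cmod \<dots> \<le> \<bar>D - J\<bar> * cmod (v2 0) + cmod T1 + cmod T2 + cmod T3"
        using norm_triangle_ineq4[of "of_real (D - J) * v2 0 + T1 - T2" T3]
          norm_triangle_ineq4[of "of_real (D - J) * v2 0 + T1" T2]
          norm_triangle_ineq[of "of_real (D - J) * v2 0" T1]
        by (simp add: norm_mult del: of_real_diff)
      also have "\<dots> \<le> 12 * M ^ 3 / d * r * G2 * N + G2 * (3 * r * N) + G2 * (7 * r * N) + G2 * (16 * M * r * N)"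
      proof -
        have "G * x \<le> G2 * x" if "0 \<le> x" for x using G(6) that by (rule mult_right_mono)
        then have "G * (3 * r * N) \<le> G2 * (3 * r * N)" "G * (7 * r * N) \<le> G2 * (7 * r * N)" "G * (16 * M * r * N) \<le> G2 * (16 * M * r * N)"
          using r N M by auto
        moreover have "\<bar>D - J\<bar> * cmod (v2 0) \<le> 12 * M ^ 3 / d * r * G2 * N"
          using DJ N by (intro mult_mono) auto
        ultimately show ?thesis using T1 T2 T3 by linarith
      qed
      also have "\<dots> = (10 + 16 * M + 12 * M ^ 3 / d) * (r * N * G2)" by (simp add: algebra_simps)
      also have "\<dots> \<le> (26 * M\<^sup>2 + 12 * M ^ 3 / d) * (r * N * G2)"
        using M M2 r N G by (intro mult_right_mono) auto
      finally show ?thesis .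
    qed
    have J: "\<bar>J\<bar> \<le> 2 * G2"
    proof -
      have "\<bar>J\<bar> \<le> exp (- (\<kappa> * r\<^sup>2 * t)) + exp (- (\<delta> / 2 * r\<^sup>2 * t)) * \<bar>cos (r * t)\<bar>"
        unfolding J_def diffusion_wave_def by (rule order_trans[OF abs_triangle_ineq4]) (simp add: abs_mult)
      also have "\<dots> \<le> G2 + G2 * 1" using G by (intro add_mono mult_mono) auto
      finally show ?thesis by simp
    qed
    \<comment> \<open>The second term accounts for dividing the profile by r^2 instead of the exact
      denominator Q.\<close>
    have "v t - of_real (J / r\<^sup>2) * v2 0 = (of_real Q * v t - of_real J * v2 0) / of_real Q
        + of_real (J * (r\<^sup>2 - Q) / (Q * r\<^sup>2)) * v2 0"
      using Qpos r by (simp add: field_simps)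
    also have "cmod \<dots> \<le> cmod (of_real Q * v t - of_real J * v2 0) / Q + \<bar>J * (r\<^sup>2 - Q) / (Q * r\<^sup>2)\<bar> * cmod (v2 0)"
      using norm_triangle_ineq[of "(of_real Q * v t - of_real J * v2 0) / of_real Q" "of_real (J * (r\<^sup>2 - Q) / (Q * r\<^sup>2)) * v2 0"] Qpos
      by (simp only: norm_mult norm_divide norm_of_real abs_of_pos)
    also have "\<dots> \<le> (26 * M\<^sup>2 + 12 * M ^ 3 / d) * (r * N * G2) / (r\<^sup>2 / 4) + 24 * M\<^sup>2 * G2 / r * N"
    proof (intro add_mono mult_mono)
      show "cmod (of_real Q * v t - of_real J * v2 0) / Q \<le> (26 * M\<^sup>2 + 12 * M ^ 3 / d) * (r * N * G2) / (r\<^sup>2 / 4)"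
        using Qv Q(2) r order_trans[OF norm_ge_zero Qv] by (intro frac_le) auto
      have "\<bar>J * (r\<^sup>2 - Q) / (Q * r\<^sup>2)\<bar> = \<bar>J\<bar> * \<bar>Q - r\<^sup>2\<bar> / (Q * r\<^sup>2)"
        using Qpos by (simp add: abs_mult abs_minus_commute)
      also have "\<dots> \<le> (2 * G2) * (3 * M\<^sup>2 * r ^ 4) / (r\<^sup>2 / 4 * r\<^sup>2)"
        using J Q r G by (intro frac_le mult_mono mult_right_mono) auto
      also have "\<dots> = 24 * M\<^sup>2 * G2" using r by (simp add: eval_nat_numeral)
      also have "\<dots> \<le> 24 * M\<^sup>2 * G2 / r" using r r1 M G by (simp add: pos_le_divide_eq mult_left_le)
      finally show "\<bar>J * (r\<^sup>2 - Q) / (Q * r\<^sup>2)\<bar> \<le> 24 * M\<^sup>2 * G2 / r" .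
    qed (use N G M r in auto)
    also have "\<dots> = C * G2 * N / r" using r by (simp add: C_def field_simps power2_eq_square)
    finally show ?thesis
      unfolding J_def N_def G2_def by (simp add: mult_ac)
  qed
  show ?thesis unfolding \<delta>_def[symmetric]
    by (rule exI[of _ r0], rule conjI[OF r0(1)], rule exI[of _ "d / 2"], rule conjI[OF half_gt_zero[OF d(1)]],
        rule exI[of _ C], rule conjI[OF C], rule conjI[OF r0(2)], intro allI impI, elim conjE)
       (rule main; simp only:)
qed

text \<open>Expanding the symbol gives \<delta> + \<kappa> = b \<nu> + \<gamma> \<kappa> for the
  second derivative; in the r^4 coefficient of the first derivative the terms with \<kappa>^2
  cancel, leaving \<gamma> \<kappa> b \<nu>. One-sided derivatives at 0 serve only to give
  continuity there.\<close>

lemma blackstock_ode_third_order: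
  assumes "blackstock_ode b \<nu> \<gamma> \<kappa> r a0 a1 a2 v"
  obtains v1 v2 v3 where "continuous_on {0..} v" "continuous_on {0..} v1" "continuous_on {0..} v2"
    "\<forall>t>0. (v has_vector_derivative v1 t) (at t) \<and> (v1 has_vector_derivative v2 t) (at t) \<and>
       (v2 has_vector_derivative v3 t) (at t) \<and>
       v3 t + of_real ((b * \<nu> + \<gamma> * \<kappa>) * r\<^sup>2) * v2 t + of_real (r\<^sup>2 + \<gamma> * \<kappa> * b * \<nu> * r ^ 4) * v1 t
         + of_real (\<kappa> * r ^ 4) * v t = 0"
    "v 0 = a0" "v1 0 = a1" "v2 0 = a2"
proof -
  define \<delta> where "\<delta> = blackstock_delta b \<nu> \<gamma> \<kappa>"
  obtain v1 v2 v3 where d: "\<And>t. t \<ge> 0 \<Longrightarrow> (v has_vector_derivative v1 t) (at t within {0..})"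
      "\<And>t. t \<ge> 0 \<Longrightarrow> (v1 has_vector_derivative v2 t) (at t within {0..})"
      "\<And>t. t \<ge> 0 \<Longrightarrow> (v2 has_vector_derivative v3 t) (at t within {0..})"
    and ode: "\<And>t. t > 0 \<Longrightarrow> (v3 t + of_real (r\<^sup>2) * v1 t + of_real (\<delta> * r\<^sup>2) * v2 t)
               + of_real (\<kappa> * r\<^sup>2) * (v2 t + of_real (r\<^sup>2) * v t + of_real (\<delta> * r\<^sup>2) * v1 t)
               + of_real (\<kappa> * (\<gamma> - 1) * (b * \<nu> - \<kappa>) * r ^ 4) * v1 t = 0"
    and init: "v 0 = a0" "v1 0 = a1" "v2 0 = a2"
    using assms unfolding blackstock_ode_def Let_def \<delta>_def by blast
  have cont: "continuous_on {0..} v" "continuous_on {0..} v1" "continuous_on {0..} v2"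
    using d by (auto simp: continuous_on_eq_continuous_within intro: has_vector_derivative_continuous)
  have at: "at t within {0..} = at t" if "t > 0" for t :: real
    using that by (intro at_within_interior) simp
  have "v3 t + of_real ((b * \<nu> + \<gamma> * \<kappa>) * r\<^sup>2) * v2 t + of_real (r\<^sup>2 + \<gamma> * \<kappa> * b * \<nu> * r ^ 4) * v1 t
         + of_real (\<kappa> * r ^ 4) * v t = 0" if t: "t > 0" for t
  proof -
    have eqs: "(b * \<nu> + \<gamma> * \<kappa>) * r\<^sup>2 = \<delta> * r\<^sup>2 + \<kappa> * r\<^sup>2"
      "r\<^sup>2 + \<gamma> * \<kappa> * b * \<nu> * r ^ 4 = r\<^sup>2 + (\<kappa> * r\<^sup>2) * (\<delta> * r\<^sup>2) + \<kappa> * (\<gamma> - 1) * (b * \<nu> - \<kappa>) * r ^ 4"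
      "\<kappa> * r ^ 4 = (\<kappa> * r\<^sup>2) * r\<^sup>2"
      by (simp_all add: \<delta>_def blackstock_delta_def eval_nat_numeral algebra_simps)
    have "v3 t + of_real ((b * \<nu> + \<gamma> * \<kappa>) * r\<^sup>2) * v2 t + of_real (r\<^sup>2 + \<gamma> * \<kappa> * b * \<nu> * r ^ 4) * v1 t
         + of_real (\<kappa> * r ^ 4) * v t = (v3 t + of_real (r\<^sup>2) * v1 t + of_real (\<delta> * r\<^sup>2) * v2 t)
               + of_real (\<kappa> * r\<^sup>2) * (v2 t + of_real (r\<^sup>2) * v t + of_real (\<delta> * r\<^sup>2) * v1 t)
               + of_real (\<kappa> * (\<gamma> - 1) * (b * \<nu> - \<kappa>) * r ^ 4) * v1 t"
      unfolding eqs(1,2) eqs(3) of_real_add of_real_mult[of "\<kappa> * r\<^sup>2"] by (simp only: ring_distribs ac_simps)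
    with ode[OF t] show ?thesis by simp
  qed
  then show thesis
    using that[OF cont _ init] d at by (metis less_imp_le)
qed

text \<open>With a = b \<nu> + \<gamma> \<kappa> and m = \<gamma> \<kappa> b \<nu>, the difference m
  + \<kappa>^2 - a \<kappa> equals \<kappa> (\<gamma> - 1) (b \<nu> - \<kappa>); this is where
  \<kappa> \<le> b \<nu> enters. The damping \<delta> of the wave part is a - \<kappa>. The energy
  estimate is applied with R = r^2, from the radius \<open>r0\<close> found at low frequency
  onwards.\<close>

lemma blackstock_pointwise:
  fixes b \<nu> \<gamma> \<kappa> :: real
  assumes pos: "0 < b" "0 < \<nu>" "0 < \<kappa>" "\<kappa> \<le> b * \<nu>" "1 < \<gamma>"
  obtains r0 c C where "0 < r0" "r0 \<le> 1" "0 < c" "0 < C"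
    "\<And>r a0 a1 a2 v t. \<lbrakk>blackstock_ode b \<nu> \<gamma> \<kappa> r a0 a1 a2 v; 0 < r; r \<le> r0; 0 \<le> t\<rbrakk> \<Longrightarrow>
       cmod (v t - of_real (diffusion_wave \<kappa> (blackstock_delta b \<nu> \<gamma> \<kappa>) r t / r\<^sup>2) * a2)
         \<le> C * exp (- (c * r\<^sup>2 * t)) * (cmod a0 + cmod a1 + cmod a2) / r"
    "\<And>r a0 a1 a2 v t. \<lbrakk>blackstock_ode b \<nu> \<gamma> \<kappa> r a0 a1 a2 v; r0 \<le> r; 0 \<le> t\<rbrakk> \<Longrightarrow>
       cmod (v t) \<le> C * exp (- c * t) * (cmod a0 + cmod a1 + cmod a2)"
proof -
  define a where "a = b * \<nu> + \<gamma> * \<kappa>"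
  define m where "m = \<gamma> * \<kappa> * b * \<nu>"
  have bn: "0 < b * \<nu>" and gk: "\<kappa> < \<gamma> * \<kappa>" using pos by auto
  have ma: "0 < m" "\<kappa> < a" unfolding m_def a_def using pos bn gk by (auto, linarith)
  have \<delta>: "blackstock_delta b \<nu> \<gamma> \<kappa> = a - \<kappa>" by (simp add: blackstock_delta_def a_def algebra_simps)
  have "0 \<le> \<kappa> * (\<gamma> - 1) * (b * \<nu> - \<kappa>)" using pos by simp
  then have e: "a * \<kappa> \<le> m + \<kappa>\<^sup>2"
    by (simp add: a_def m_def algebra_simps power2_eq_square)
  obtain r0 c1 C1 where r0: "0 < r0" "r0 \<le> 1" and c1: "0 < c1" "0 < C1" and low: "\<And>r v v1 v2 v3 t.
     \<lbrakk>0 < r; r \<le> r0; continuous_on {0..} v; continuous_on {0..} v1; continuous_on {0..} v2;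
    \<forall>t>0. (v has_vector_derivative v1 t) (at t) \<and> (v1 has_vector_derivative v2 t) (at t) \<and>
       (v2 has_vector_derivative v3 t) (at t) \<and>
       v3 t + of_real (a * r\<^sup>2) * v2 t + of_real (r\<^sup>2 + m * r ^ 4) * v1 t + of_real (\<kappa> * r ^ 4) * v t = 0; 0 \<le> t\<rbrakk> \<Longrightarrow>
    cmod (v t - of_real (diffusion_wave \<kappa> (a - \<kappa>) r t / r\<^sup>2) * v2 0)
        \<le> C1 * exp (- (c1 * r\<^sup>2 * t)) * (cmod (v 0) + cmod (v1 0) + cmod (v2 0)) / r"
    using third_order_low_frequency[OF pos(3) ma e] by metis
  have R0: "0 < r0\<^sup>2" using r0 by simp
  obtain c2 C2 where c2: "0 < c2" "0 < C2" and high: "\<And>R v v1 v2 v3 t.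
     \<lbrakk>r0\<^sup>2 \<le> R; continuous_on {0..} v; continuous_on {0..} v1; continuous_on {0..} v2;
    \<forall>t>0. (v has_vector_derivative v1 t) (at t) \<and> (v1 has_vector_derivative v2 t) (at t) \<and>
       (v2 has_vector_derivative v3 t) (at t) \<and>
       v3 t + of_real (a * R) * v2 t + of_real (R + m * R\<^sup>2) * v1 t + of_real (\<kappa> * R\<^sup>2) * v t = 0; 0 \<le> t\<rbrakk> \<Longrightarrow>
    cmod (v t) \<le> C2 * exp (- c2 * t) * (cmod (v 0) + cmod (v1 0) + cmod (v2 0))"
    using third_order_decay[OF pos(3) ma R0] by metis
  define c where "c = min c1 c2"
  define C where "C = max C1 C2"
  show thesis
  proof (rule that[of r0 c C])
    show "0 < c" "0 < C" using c1 c2 by (auto simp: c_def C_def)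
    fix r a0 a1 a2 v t assume v: "blackstock_ode b \<nu> \<gamma> \<kappa> r a0 a1 a2 v" and t: "0 \<le> (t::real)"
    obtain v1 v2 v3 where cont: "continuous_on {0..} v" "continuous_on {0..} v1" "continuous_on {0..} v2"
      and ode: "\<forall>t>0. (v has_vector_derivative v1 t) (at t) \<and> (v1 has_vector_derivative v2 t) (at t) \<and>
       (v2 has_vector_derivative v3 t) (at t) \<and>
       v3 t + of_real (a * r\<^sup>2) * v2 t + of_real (r\<^sup>2 + m * r ^ 4) * v1 t + of_real (\<kappa> * r ^ 4) * v t = 0"
      and init: "v 0 = a0" "v1 0 = a1" "v2 0 = a2"
      using blackstock_ode_third_order[OF v] unfolding a_def m_def by metis
    {
      assume r: "0 < r" "r \<le> r0"
      have "cmod (v t - of_real (diffusion_wave \<kappa> (blackstock_delta b \<nu> \<gamma> \<kappa>) r t / r\<^sup>2) * a2)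
         \<le> C1 * exp (- (c1 * r\<^sup>2 * t)) * (cmod a0 + cmod a1 + cmod a2) / r"
        using low[OF r cont ode t] unfolding init \<delta> .
      also have "\<dots> \<le> C * exp (- (c * r\<^sup>2 * t)) * (cmod a0 + cmod a1 + cmod a2) / r"
        using r t c1 by (intro divide_right_mono mult_mono mult_right_mono) (auto simp: c_def C_def intro!: mult_right_mono)
      finally show "cmod (v t - of_real (diffusion_wave \<kappa> (blackstock_delta b \<nu> \<gamma> \<kappa>) r t / r\<^sup>2) * a2)
         \<le> C * exp (- (c * r\<^sup>2 * t)) * (cmod a0 + cmod a1 + cmod a2) / r" .
    }
    assume r: "r0 \<le> r"
    have "r0\<^sup>2 \<le> r\<^sup>2" using r r0 by (intro power_mono) auto
    moreover have r4: "(r\<^sup>2)\<^sup>2 = r ^ 4" by simp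
    ultimately have "cmod (v t) \<le> C2 * exp (- c2 * t) * (cmod (v 0) + cmod (v1 0) + cmod (v2 0))"
      using ode by (intro high[OF _ cont _ t, where ?v3.0=v3 and R="r\<^sup>2"]) (simp_all only: r4)
    then have "cmod (v t) \<le> C2 * exp (- c2 * t) * (cmod a0 + cmod a1 + cmod a2)"
      unfolding init .
    also have "\<dots> \<le> C * exp (- c * t) * (cmod a0 + cmod a1 + cmod a2)"
      using t c2 by (intro mult_mono mult_right_mono) (auto simp: c_def C_def intro!: mult_right_mono)
    finally show "cmod (v t) \<le> C * exp (- c * t) * (cmod a0 + cmod a1 + cmod a2)" .
  qed (use r0 in auto)
qed

section \<open>Radial integrals\<close>

lemma nn_integral_power_Icc:
  fixes a b :: real
  assumes "0 \<le> a" "a \<le> b"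
  shows "(\<integral>\<^sup>+r. ennreal (r ^ j) * indicator {a..b} r \<partial>lborel) = ennreal ((b ^ Suc j - a ^ Suc j) / real (Suc j))"
proof -
  have "(\<integral>\<^sup>+r. ennreal (r ^ j) * indicator {a..b} r \<partial>lborel) = ennreal (b ^ Suc j / real (Suc j) - a ^ Suc j / real (Suc j))"
    by (rule nn_integral_FTC_Icc)
       (use assms in \<open>auto intro!: derivative_eq_intros simp del: power_Suc\<close>)
  then show ?thesis by (simp add: diff_divide_distrib)
qed

lemma nn_integral_inverse_power_atLeast:
  fixes a :: real
  assumes a: "0 < a"
  shows "(\<integral>\<^sup>+r. ennreal (1 / r ^ Suc (Suc j)) * indicator {a..} r \<partial>lborel) = ennreal (1 / (real (Suc j) * a ^ Suc j))"
proof -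
  have "(\<integral>\<^sup>+r. ennreal (1 / r ^ Suc (Suc j)) * indicator {a..} r \<partial>lborel)
      = ennreal (0 - (- (1 / (real (Suc j) * a ^ Suc j))))"
  proof (rule nn_integral_FTC_atLeast)
    fix x assume "a \<le> x"
    then have x: "0 < x" using a by simp
    then show "0 \<le> 1 / x ^ Suc (Suc j)" by simp
    have "((\<lambda>r. - (inverse (r ^ Suc j) / real (Suc j))) has_real_derivative
        - (- (inverse (x ^ Suc j) * (real (Suc j) * x ^ j) * inverse (x ^ Suc j)) / real (Suc j))) (at x)"
      using x by (auto intro!: derivative_eq_intros simp del: power_Suc)
    also have "- (- (inverse (x ^ Suc j) * (real (Suc j) * x ^ j) * inverse (x ^ Suc j)) / real (Suc j)) = 1 / x ^ Suc (Suc j)"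
      using x by (simp add: field_simps del: of_nat_Suc)
    also have "(\<lambda>r. - (inverse (r ^ Suc j) / real (Suc j))) = (\<lambda>r. - (1 / (real (Suc j) * r ^ Suc j)))"
      by (simp add: fun_eq_iff divide_inverse mult.commute)
    finally show "((\<lambda>r. - (1 / (real (Suc j) * r ^ Suc j))) has_real_derivative 1 / x ^ Suc (Suc j)) (at x)" .
  next
    have "filterlim (\<lambda>r::real. r ^ Suc j) at_top at_top"
      using filterlim_pow_at_top[OF zero_less_Suc filterlim_ident] .
    then have "filterlim (\<lambda>r::real. real (Suc j) * r ^ Suc j) at_top at_top"
      by (rule filterlim_tendsto_pos_mult_at_top[OF tendsto_const, rotated]) simp
    then have "((\<lambda>r::real. inverse (real (Suc j) * r ^ Suc j)) \<longlongrightarrow> 0) at_top"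
      by (rule tendsto_inverse_0_at_top)
    from tendsto_minus[OF this] show "((\<lambda>r::real. - (1 / (real (Suc j) * r ^ Suc j))) \<longlongrightarrow> 0) at_top"
      by (simp add: divide_inverse)
  qed measurable
  then show ?thesis by simp
qed

text \<open>From (1 + x / p)^p \<le> exp x. Power decay of a chosen order replaces exact Gaussian
  moments, since only the power of t matters.\<close>

lemma exp_minus_le_inverse_power:
  fixes x :: real
  assumes x: "0 < x" and p: "0 < p"
  shows "exp (- x) \<le> real p ^ p / x ^ p"
proof -
  have "(x / real p) ^ p \<le> (1 + x / real p) ^ p"
    using x p by (intro power_mono) auto
  also have "\<dots> \<le> exp x" using x p by (intro exp_ge_one_plus_x_over_n_power_n) auto
  finally have "x ^ p / real p ^ p \<le> exp x" by (simp add: power_divide)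
  then have "1 / exp x \<le> 1 / (x ^ p / real p ^ p)" using x p by (intro divide_left_mono) auto
  then show ?thesis by (simp add: exp_minus divide_inverse mult.commute)
qed

text \<open>The integral is split at r = 1 / sqrt t. Below, the exponential is at most 1; above, it
  is at most a multiple of (r^2 t)^-(j+1), so the integrand decays like r^-(j+2). Both pieces scale
  like t^-((j+1)/2).\<close>

lemma nn_integral_gauss_moment_le:
  fixes c t :: real
  assumes c: "0 < c" and t: "0 < t"
  shows "(\<integral>\<^sup>+r. ennreal (exp (- (c * r\<^sup>2 * t)) * r ^ j) * indicator {0<..} r \<partial>lborel)
    \<le> ennreal ((1 + (real (Suc j) / c) ^ Suc j) * (1 / sqrt t) ^ Suc j)"
proof -
  define s where "s = 1 / sqrt t"
  define K where "K = (real (Suc j) / c) ^ Suc j"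
  have s: "0 < s" "s\<^sup>2 * t = 1" using t by (auto simp: s_def power_divide)
  have K: "0 < K" using c by (simp add: K_def)
  have "(\<integral>\<^sup>+r. ennreal (exp (- (c * r\<^sup>2 * t)) * r ^ j) * indicator {0<..} r \<partial>lborel)
      \<le> (\<integral>\<^sup>+r. ennreal (r ^ j) * indicator {0..s} r + ennreal (K * s ^ (2 * Suc j)) * (ennreal (1 / r ^ Suc (Suc j)) * indicator {s..} r) \<partial>lborel)"
  proof (rule nn_integral_mono)
    fix r :: real
    show "ennreal (exp (- (c * r\<^sup>2 * t)) * r ^ j) * indicator {0<..} r
        \<le> ennreal (r ^ j) * indicator {0..s} r + ennreal (K * s ^ (2 * Suc j)) * (ennreal (1 / r ^ Suc (Suc j)) * indicator {s..} r)"
    proof (cases "0 < r")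
      case r: True
      show ?thesis
      proof (cases "r \<le> s")
        case True
        have "exp (- (c * r\<^sup>2 * t)) * r ^ j \<le> 1 * r ^ j"
          using c t r by (intro mult_right_mono) auto
        then have "ennreal (exp (- (c * r\<^sup>2 * t)) * r ^ j) * indicator {0<..} r \<le> ennreal (r ^ j) * indicator {0..s} r"
          using True r by (simp add: ennreal_leI)
        then show ?thesis by (simp add: add_increasing2)
      next
        case False
        have "exp (- (c * r\<^sup>2 * t)) * r ^ j \<le> real (Suc j) ^ Suc j / (c * r\<^sup>2 * t) ^ Suc j * r ^ j"
          using c t r by (intro mult_right_mono exp_minus_le_inverse_power) auto
        also have "\<dots> = K * s ^ (2 * Suc j) * (1 / r ^ Suc (Suc j))"
        proof -
          have "s ^ (2 * Suc j) * t ^ Suc j = 1"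
            unfolding power_mult power_mult_distrib[symmetric] s by simp
          then have ts: "s ^ (2 * Suc j) = 1 / t ^ Suc j" using t by (simp add: field_simps)
          have "r ^ (2 * Suc j) = r ^ j * r ^ Suc (Suc j)"
            unfolding power_add[symmetric] by (rule arg_cong[where f="\<lambda>k. r ^ k"]) simp
          then have r_pow: "(r\<^sup>2) ^ Suc j = r ^ j * r ^ Suc (Suc j)" by (simp only: power_mult)
          show ?thesis unfolding K_def ts power_mult_distrib power_divide r_pow using r
            by (simp add: field_simps del: power_Suc of_nat_Suc)
        qed
        finally show ?thesis using False r s K
          by (auto simp: ennreal_mult[symmetric] intro!: ennreal_leI)
      qed
    qed simp
  qed
  also have "\<dots> = ennreal ((s ^ Suc j - 0 ^ Suc j) / real (Suc j)) + ennreal (K * s ^ (2 * Suc j)) * ennreal (1 / (real (Suc j) * s ^ Suc j))"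
    using s by (subst nn_integral_add, simp, simp, subst nn_integral_cmult, simp)
      (simp only: nn_integral_power_Icc nn_integral_inverse_power_atLeast order_refl less_imp_le)
  also have "\<dots> = ennreal (s ^ Suc j / real (Suc j) + K * s ^ (2 * Suc j) * (1 / (real (Suc j) * s ^ Suc j)))"
    using s K by (simp add: ennreal_mult[symmetric] del: power_Suc)
  also have "s ^ Suc j / real (Suc j) + K * s ^ (2 * Suc j) * (1 / (real (Suc j) * s ^ Suc j)) = (1 + K) * s ^ Suc j / real (Suc j)"
  proof -
    have "s ^ (2 * Suc j) = s ^ Suc j * s ^ Suc j" by (simp only: mult_2 power_add)
    then show ?thesis using s by (simp add: field_simps del: power_Suc of_nat_Suc)
  qed
  also have "\<dots> \<le> (1 + K) * s ^ Suc j"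
  proof -
    have "0 \<le> (1 + K) * s ^ Suc j" using s K by simp
    then show ?thesis by (simp add: divide_le_eq mult_left_le_one_le mult_le_cancel_left1 del: power_Suc)
  qed
  finally show ?thesis by (simp add: K_def s_def ennreal_leI del: power_Suc)
qed

text \<open>Polar coordinates for radial functions without a surface measure: the image of Lebesgue
  measure under the norm and the claimed density agree on half-lines, by the volume of
  balls.\<close>

lemma nn_integral_radial:
  fixes h :: "real \<Rightarrow> ennreal"
  assumes [measurable]: "h \<in> borel_measurable borel"
  shows "(\<integral>\<^sup>+x. h (norm (x::'a::euclidean_space)) \<partial>lebesgue)
    = ennreal (real DIM('a) * unit_ball_vol (real DIM('a))) * (\<integral>\<^sup>+r. h r * ennreal (r ^ (DIM('a) - 1)) * indicator {0<..} r \<partial>lborel)"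
proof -
  define n where "n = DIM('a)"
  have n: "0 < n" by (simp add: n_def)
  define k where "k = real n * unit_ball_vol (real n)"
  have k: "0 < k" using n by (simp add: k_def)
  let ?M = "distr (lborel :: 'a measure) borel norm"
  let ?N = "density lborel (\<lambda>r. ennreal (k * r ^ (n - 1)) * indicator {0<..} r)"
  have emM: "emeasure ?M {..a} = (if a < 0 then 0 else ennreal (unit_ball_vol (real n) * a ^ n))" for a
  proof -
    have "norm -` {..a} \<inter> space lborel = cball (0::'a) a" by auto
    then show ?thesis by (simp add: emeasure_distr emeasure_cball n_def)
  qed
  have "?M = ?N"
  proof (rule measure_eqI_generator_eq[where E="range atMost" and \<Omega>=UNIV and A="\<lambda>i. {..real i}"])
    show "Int_stable (range (atMost :: real \<Rightarrow> _))"
      by (auto simp: Int_stable_def intro!: image_eqI[where x="min _ _"])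
    show "sets ?M = sigma_sets UNIV (range atMost)" "sets ?N = sigma_sets UNIV (range atMost)"
      by (simp_all add: borel_eq_atMost)
    show "(\<Union>i. {..real i}) = UNIV" by (auto intro: real_arch_simple)
    show "emeasure ?M {..real i} \<noteq> \<infinity>" for i by (simp add: emM)
    fix X :: "real set" assume "X \<in> range atMost"
    then obtain a where X: "X = {..a}" by auto
    show "emeasure ?M X = emeasure ?N X"
    proof (cases "a < 0")
      case True
      have "emeasure ?N {..a} = nn_integral lborel (\<lambda>_::real. 0)"
        using True by (subst emeasure_density, simp, simp) (intro nn_integral_cong, auto split: split_indicator)
      with True show ?thesis by (simp add: X emM)
    next
      case False
      \<comment> \<open>The density lives on r > 0 whereas the power integral is over a closed
        interval; the point 0 is null.\<close>
      have "AE r in lborel. r \<noteq> (0::real)" by (rule AE_lborel_singleton)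
      then have "emeasure ?N {..a} = (\<integral>\<^sup>+r. ennreal k * (ennreal (r ^ (n - 1)) * indicator {0..a} r) \<partial>lborel)"
        using k by (subst emeasure_density, simp, simp)
          (intro nn_integral_cong_AE, auto elim!: eventually_mono simp: indicator_def ennreal_mult)
      also have "\<dots> = ennreal k * ennreal ((a ^ Suc (n - 1) - 0 ^ Suc (n - 1)) / real (Suc (n - 1)))"
        using False by (subst nn_integral_cmult, simp, subst nn_integral_power_Icc) auto
      also have "\<dots> = ennreal (unit_ball_vol (real n) * a ^ n)"
        using False k n by (simp add: ennreal_mult[symmetric] k_def)
      finally show ?thesis using False by (simp add: X emM)
    qed
  qed auto
  have "(\<integral>\<^sup>+x. h (norm (x::'a)) \<partial>lebesgue) = (\<integral>\<^sup>+r. h r \<partial>?M)"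
    by (simp add: nn_integral_completion nn_integral_distr)
  also have "\<dots> = (\<integral>\<^sup>+r. ennreal k * (h r * ennreal (r ^ (n - 1)) * indicator {0<..} r) \<partial>lborel)"
    unfolding \<open>?M = ?N\<close> using k
    by (subst nn_integral_density) (auto intro!: nn_integral_cong simp: indicator_def ennreal_mult mult_ac)
  also have "\<dots> = ennreal k * (\<integral>\<^sup>+r. h r * ennreal (r ^ (n - 1)) * indicator {0<..} r \<partial>lborel)"
    by (rule nn_integral_cmult) simp
  finally show ?thesis by (simp add: k_def n_def)
qed

section \<open>The squared growth function\<close>

lemma D_tilde_sq_3: "t > 0 \<Longrightarrow> (D_tilde 3 t)\<^sup>2 = t"
  by (simp add: D_tilde_def power2_eq_square powr_add[symmetric])

lemma D_tilde_sq_4: "t \<ge> 1 \<Longrightarrow> (D_tilde 4 t)\<^sup>2 = ln (exp 1 + (t - 1))"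
  by (simp add: D_tilde_def add_increasing2)

lemma D_tilde_sq_ge5:
  assumes "5 \<le> n" "t > 0"
  shows "(D_tilde n t)\<^sup>2 = (1 / sqrt t) ^ (n - 4)"
proof -
  have "(D_tilde n t)\<^sup>2 = t powr (2 - real n / 2)"
    using assms by (simp add: D_tilde_def power2_eq_square powr_add[symmetric])
  also have "2 - real n / 2 = - (1 / 2) * real (n - 4)" using assms by (simp add: of_nat_diff field_simps)
  also have "t powr \<dots> = (t powr - (1 / 2)) powr real (n - 4)"
    by (simp only: powr_powr)
  also have "\<dots> = (t powr - (1 / 2)) ^ (n - 4)"
    using assms by (intro powr_realpow) auto
  also have "t powr - (1 / 2) = 1 / sqrt t"
    by (simp only: powr_minus_divide powr_half_sqrt less_imp_le[OF assms(2)])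
  finally show ?thesis .
qed

lemma ln_exp1_bounds:
  fixes t :: real
  assumes "t \<ge> 1"
  shows "1 \<le> ln (exp 1 + (t - 1))" "ln t \<le> ln (exp 1 + (t - 1))"
proof -
  have "ln (exp 1) \<le> ln (exp 1 + (t - 1))" using assms by (subst ln_le_cancel_iff) (auto intro: add_pos_nonneg)
  then show "1 \<le> ln (exp 1 + (t - 1))" by simp
  have "(1::real) \<le> exp 1" by simp
  then show "ln t \<le> ln (exp 1 + (t - 1))" using assms by (subst ln_le_cancel_iff) (auto intro: add_pos_nonneg)
qed

text \<open>The left-hand side is the order of the squared error integral. In every dimension it is
  at least a factor 1 / t below the squared rate, and this gain drives the lower bound.\<close>

lemma D_tilde_sq_ge_power:
  assumes "3 \<le> n" "t \<ge> 1"
  shows "(1 / sqrt t) ^ (n - 2) \<le> (D_tilde n t)\<^sup>2 / t"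
proof -
  have t: "t > 0" using assms by simp
  have s2: "(1 / sqrt t)\<^sup>2 = 1 / t" using t by (simp add: power_divide)
  consider "n = 3" | "n = 4" | "5 \<le> n" using assms by linarith
  then show ?thesis
  proof cases
    case 1
    then show ?thesis using assms by (simp add: D_tilde_sq_3)
  next
    case 2
    then show ?thesis using assms ln_exp1_bounds(1)[of t] s2 by (simp add: D_tilde_sq_4 divide_right_mono)
  next
    case 3
    then have "n - 2 = (n - 4) + 2" by simp
    then have "(1 / sqrt t) ^ (n - 2) = (1 / sqrt t) ^ (n - 4) * (1 / t)" by (simp only: power_add s2)
    then show ?thesis using D_tilde_sq_ge5[OF 3 t] by simp
  qed
qed

text \<open>Against the radial weight, 1 / r^2 leaves the power r^(n-3), which is integrable at 0
  because n \<ge> 3.\<close>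

lemma error_integral_le:
  assumes n: "3 \<le> n" and c: "0 < c"
  shows "\<exists>C>0. \<forall>t\<ge>1. (\<integral>\<^sup>+r. ennreal ((exp (- (c * r\<^sup>2 * t)) / r)\<^sup>2 * r ^ (n - 1)) * indicator {0<..} r \<partial>lborel)
     \<le> ennreal (C / t * (D_tilde n t)\<^sup>2)"
proof -
  define C where "C = 1 + (real (Suc (n - 3)) / (2 * c)) ^ Suc (n - 3)"
  have C: "C > 0" using c by (simp add: C_def add_pos_nonneg)
  have "(\<integral>\<^sup>+r. ennreal ((exp (- (c * r\<^sup>2 * t)) / r)\<^sup>2 * r ^ (n - 1)) * indicator {0<..} r \<partial>lborel)
     \<le> ennreal (C / t * (D_tilde n t)\<^sup>2)" if t: "t \<ge> 1" for t
  proof -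
    have "(exp (- (c * r\<^sup>2 * t)) / r)\<^sup>2 * r ^ (n - 1) = exp (- (2 * c * r\<^sup>2 * t)) * r ^ (n - 3)" if "r > 0" for r
    proof -
      have "n - 1 = (n - 3) + 2" using n by simp
      then have "r ^ (n - 1) = r ^ (n - 3) * r\<^sup>2" by (simp only: power_add)
      moreover have "(exp (- (c * r\<^sup>2 * t)))\<^sup>2 = exp (- (2 * c * r\<^sup>2 * t))"
        using exp_double[of "- (c * r\<^sup>2 * t)"] by (simp add: mult.assoc)
      ultimately show ?thesis using that by (simp add: power_divide)
    qed
    then have "(\<integral>\<^sup>+r. ennreal ((exp (- (c * r\<^sup>2 * t)) / r)\<^sup>2 * r ^ (n - 1)) * indicator {0<..} r \<partial>lborel)
      = (\<integral>\<^sup>+r. ennreal (exp (- (2 * c * r\<^sup>2 * t)) * r ^ (n - 3)) * indicator {0<..} r \<partial>lborel)"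
      by (intro nn_integral_cong) (auto simp: indicator_def)
    also have "\<dots> \<le> ennreal (C * (1 / sqrt t) ^ Suc (n - 3))"
      unfolding C_def using c t by (intro nn_integral_gauss_moment_le) auto
    also have "C * (1 / sqrt t) ^ Suc (n - 3) \<le> C * ((D_tilde n t)\<^sup>2 / t)"
    proof -
      have "Suc (n - 3) = n - 2" using n by simp
      then show ?thesis using D_tilde_sq_ge_power[OF n t] C by (simp only: mult_le_cancel_left_pos)
    qed
    finally show ?thesis by (simp add: ennreal_leI mult_ac)
  qed
  then show ?thesis using C by blast
qed

section \<open>The diffusion-wave profile: pointwise bounds and radial integrals\<close>

lemma exp_rate_mono:
  fixes k k' r t :: real
  assumes "0 \<le> t" "k \<le> k'"
  shows "exp (- (k' * r\<^sup>2 * t)) \<le> exp (- (k * r\<^sup>2 * t))"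
proof -
  have "k * (r\<^sup>2 * t) \<le> k' * (r\<^sup>2 * t)" using assms by (intro mult_right_mono) auto
  then show ?thesis by (simp only: exp_le_cancel_iff neg_le_iff_le mult.assoc)
qed

lemma diffusion_wave_le:
  assumes "0 \<le> t" "\<kappa> \<le> \<delta> / 2"
  shows "\<bar>diffusion_wave \<kappa> \<delta> r t\<bar> \<le> 2 * exp (- (\<kappa> * r\<^sup>2 * t))"
proof -
  have "exp (- (\<delta> / 2 * r\<^sup>2 * t)) \<le> exp (- (\<kappa> * r\<^sup>2 * t))"
    by (rule exp_rate_mono[OF assms])
  then have "exp (- (\<delta> / 2 * r\<^sup>2 * t)) * \<bar>cos (r * t)\<bar> \<le> exp (- (\<kappa> * r\<^sup>2 * t)) * 1"
    by (intro mult_mono) auto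
  then show ?thesis
    unfolding diffusion_wave_def
    using abs_triangle_ineq4[of "exp (- (\<kappa> * r\<^sup>2 * t))" "exp (- (\<delta> / 2 * r\<^sup>2 * t)) * cos (r * t)"]
    by (simp add: abs_mult)
qed

lemma one_minus_cos_le: "1 - cos x \<le> x\<^sup>2 / 2" for x :: real
proof -
  have "1 - cos x = 2 * (sin (x / 2))\<^sup>2" using cos_double_sin[of "x / 2"] by simp
  also have "\<dots> \<le> 2 * (x / 2)\<^sup>2"
    using power_mono[OF abs_sin_x_le_abs_x[of "x / 2"] abs_ge_zero, of 2] by (intro mult_left_mono) (auto simp: power_divide)
  finally show ?thesis by (simp add: power_divide)
qed

text \<open>At r = 0 the two terms of the profile cancel, and the deviations of both exponentials
  and of the cosine from 1 are of second order in r. This compensates the division by r^2 in the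
  region r \<le> 1 / t.\<close>

lemma diffusion_wave_le_small:
  assumes t: "1 \<le> t" and pos: "0 \<le> \<kappa>" "0 \<le> \<delta>"
  shows "\<bar>diffusion_wave \<kappa> \<delta> r t\<bar> \<le> (\<kappa> + \<delta> + 1) * t\<^sup>2 * r\<^sup>2"
proof -
  define A where "A = exp (- (\<kappa> * r\<^sup>2 * t))"
  define B where "B = exp (- (\<delta> / 2 * r\<^sup>2 * t))"
  have A: "0 \<le> 1 - A" "1 - A \<le> \<kappa> * r\<^sup>2 * t"
    using exp_ge_add_one_self[of "- (\<kappa> * r\<^sup>2 * t)"] pos t by (auto simp: A_def)
  have B: "0 \<le> 1 - B" "1 - B \<le> \<delta> / 2 * r\<^sup>2 * t"
    using exp_ge_add_one_self[of "- (\<delta> / 2 * r\<^sup>2 * t)"] pos t by (auto simp: B_def)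
  have "diffusion_wave \<kappa> \<delta> r t = (1 - cos (r * t)) + (1 - B) * cos (r * t) - (1 - A)"
    by (simp add: diffusion_wave_def A_def B_def algebra_simps)
  also have "\<bar>\<dots>\<bar> \<le> \<bar>1 - cos (r * t)\<bar> + \<bar>(1 - B) * cos (r * t)\<bar> + \<bar>1 - A\<bar>" by linarith
  also have "\<dots> \<le> (r * t)\<^sup>2 / 2 + (1 - B) * 1 + (1 - A)"
  proof (intro add_mono)
    show "\<bar>1 - cos (r * t)\<bar> \<le> (r * t)\<^sup>2 / 2" using one_minus_cos_le[of "r * t"] by simp
    show "\<bar>(1 - B) * cos (r * t)\<bar> \<le> (1 - B) * 1"
      unfolding abs_mult using B by (intro mult_mono) auto
  qed (use A in simp)
  also have "\<dots> \<le> (r * t)\<^sup>2 / 2 + \<delta> / 2 * r\<^sup>2 * t + \<kappa> * r\<^sup>2 * t" using A B by simp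
  also have "\<dots> \<le> t\<^sup>2 * r\<^sup>2 + \<delta> * r\<^sup>2 * t\<^sup>2 + \<kappa> * r\<^sup>2 * t\<^sup>2"
  proof (intro add_mono)
    have tt: "t \<le> t\<^sup>2" using t by (simp add: power2_eq_square)
    show "(r * t)\<^sup>2 / 2 \<le> t\<^sup>2 * r\<^sup>2" by (simp add: power_mult_distrib)
    show "\<kappa> * r\<^sup>2 * t \<le> \<kappa> * r\<^sup>2 * t\<^sup>2" using tt pos by (intro mult_left_mono) auto
    have "\<delta> / 2 * r\<^sup>2 * t \<le> \<delta> * r\<^sup>2 * t" using pos t by simp
    also have "\<dots> \<le> \<delta> * r\<^sup>2 * t\<^sup>2" using tt pos by (intro mult_left_mono) auto
    finally show "\<delta> / 2 * r\<^sup>2 * t \<le> \<delta> * r\<^sup>2 * t\<^sup>2" .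
  qed
  finally show ?thesis by (simp add: algebra_simps)
qed

text \<open>The wave factor is at most the diffusion factor. If the cosine is nonnegative, replacing
  one factor by the other gives the bound even without the 1 / 2; if it is negative, the diffusion
  term alone suffices, and the 1 / 2 compensates for 1 - cos reaching 2.\<close>

lemma diffusion_wave_ge:
  assumes "0 \<le> t" "\<kappa> \<le> \<delta> / 2"
  shows "exp (- (\<kappa> * r\<^sup>2 * t)) * (1 - cos (r * t)) / 2 \<le> diffusion_wave \<kappa> \<delta> r t"
proof -
  define A where "A = exp (- (\<kappa> * r\<^sup>2 * t))"
  define B where "B = exp (- (\<delta> / 2 * r\<^sup>2 * t))"
  have AB: "B \<le> A" "0 < B" unfolding A_def B_def using exp_rate_mono[OF assms] by auto
  have "A * (1 - cos (r * t)) / 2 \<le> A - B * cos (r * t)"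
  proof (cases "0 \<le> cos (r * t)")
    case True
    have "B * cos (r * t) \<le> A * cos (r * t)" using AB True by (intro mult_right_mono) auto
    moreover have "A * cos (r * t) \<le> A * 1" using AB by (intro mult_left_mono) auto
    moreover have "A * (1 - cos (r * t)) / 2 = A / 2 - A * cos (r * t) / 2"
      by (simp add: algebra_simps diff_divide_distrib)
    ultimately show ?thesis by linarith
  next
    case False
    then have "B * cos (r * t) \<le> 0" using AB by (intro mult_nonneg_nonpos) auto
    moreover have "A * (1 - cos (r * t)) \<le> A * 2" using AB cos_ge_minus_one[of "r * t"] by (intro mult_left_mono) auto
    ultimately show ?thesis by simp
  qed
  then show ?thesis by (simp add: diffusion_wave_def A_def B_def)
qed

lemma diffusion_wave_measurable [measurable]: "(\<lambda>r. diffusion_wave \<kappa> \<delta> r t) \<in> borel_measurable borel"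
  unfolding diffusion_wave_def by measurable

lemma nn_integral_inverse_Icc:
  fixes a b :: real
  assumes "0 < a" "a \<le> b"
  shows "(\<integral>\<^sup>+r. ennreal (1 / r) * indicator {a..b} r \<partial>lborel) = ennreal (ln b - ln a)"
  by (rule nn_integral_FTC_Icc) (use assms in \<open>auto intro!: derivative_eq_intros simp: divide_inverse\<close>)

lemma ennreal_le_add3:
  fixes a b c x :: ennreal
  shows "x \<le> a \<Longrightarrow> x \<le> a + (b + c)" "x \<le> b \<Longrightarrow> x \<le> a + (b + c)" "x \<le> c \<Longrightarrow> x \<le> a + (b + c)"
proof -
  have "a \<le> a + (b + c)" "b \<le> a + (b + c)" "c \<le> a + (b + c)"
    using add_mono[OF order_refl[of a] zero_le[of "b + c"]] add_mono[OF zero_le[of a] add_mono[OF order_refl[of b] zero_le[of c]]]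
      add_mono[OF zero_le[of a] add_mono[OF zero_le[of b] order_refl[of c]]] by simp_all
  then show "x \<le> a \<Longrightarrow> x \<le> a + (b + c)" "x \<le> b \<Longrightarrow> x \<le> a + (b + c)" "x \<le> c \<Longrightarrow> x \<le> a + (b + c)"
    by (blast intro: order_trans)+
qed

text \<open>For n = 3 the integral is split at 1 / t, and both parts have size t. For n = 4 the
  range between 1 / t and 1 / sqrt t contributes the integral of 4 / r, hence a logarithm, while the
  rest is bounded. For n \<ge> 5 the singularity r^-4 is integrable against the radial weight and
  the Gaussian moment bound suffices.\<close>

lemma diffusion_wave_integral_le:
  assumes n: "3 \<le> n" and \<kappa>: "0 < \<kappa>" "\<kappa> \<le> \<delta> / 2"
  shows "\<exists>C>0. \<forall>t\<ge>1. (\<integral>\<^sup>+r. ennreal ((diffusion_wave \<kappa> \<delta> r t / r\<^sup>2)\<^sup>2 * r ^ (n - 1)) * indicator {0<..} r \<partial>lborel)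
     \<le> ennreal (C * (D_tilde n t)\<^sup>2)"
proof -
  define K where "K = \<kappa> + \<delta> + 1"
  have K: "0 < K" using \<kappa> by (simp add: K_def)
  define J where "J t r = diffusion_wave \<kappa> \<delta> r t / r\<^sup>2" for t r
  have J1: "(J t r)\<^sup>2 \<le> K\<^sup>2 * t ^ 4" if "1 \<le> t" "0 < r" for t r
  proof -
    have "\<bar>J t r\<bar> \<le> K * t\<^sup>2"
      using diffusion_wave_le_small[OF that(1), of \<kappa> \<delta> r] \<kappa> that(2) by (simp add: J_def K_def pos_divide_le_eq)
    from power_mono[OF this abs_ge_zero, of 2] show ?thesis by (simp add: power_mult_distrib)
  qed
  have J2: "(J t r)\<^sup>2 \<le> 4 * exp (- (2 * \<kappa> * r\<^sup>2 * t)) / r ^ 4" if "1 \<le> t" "0 < r" for t r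
  proof -
    have "\<bar>J t r\<bar> \<le> 2 * exp (- (\<kappa> * r\<^sup>2 * t)) / r\<^sup>2"
      using diffusion_wave_le[of t \<kappa> \<delta> r] \<kappa> that by (simp add: J_def divide_right_mono)
    from power_mono[OF this abs_ge_zero, of 2] show ?thesis
      using exp_double[of "- (\<kappa> * r\<^sup>2 * t)"] by (simp add: power_mult_distrib power_divide mult.assoc)
  qed
  have J3: "(J t r)\<^sup>2 \<le> 4 / r ^ 4" if "1 \<le> t" "0 < r" for t r
  proof -
    have "4 * exp (- (2 * \<kappa> * r\<^sup>2 * t)) / r ^ 4 \<le> 4 * 1 / r ^ 4"
      using \<kappa> that by (intro divide_right_mono mult_left_mono) auto
    with J2[OF that] show ?thesis by simp
  qed
  consider "n = 3" | "n = 4" | "5 \<le> n" using n by linarith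
  then have "\<exists>C>0. \<forall>t\<ge>1. (\<integral>\<^sup>+r. ennreal ((J t r)\<^sup>2 * r ^ (n - 1)) * indicator {0<..} r \<partial>lborel)
     \<le> ennreal (C * (D_tilde n t)\<^sup>2)"
  proof cases
    case 1
    have "(\<integral>\<^sup>+r. ennreal ((J t r)\<^sup>2 * r ^ (n - 1)) * indicator {0<..} r \<partial>lborel) \<le> ennreal ((K\<^sup>2 / 3 + 4) * (D_tilde n t)\<^sup>2)"
      if t: "t \<ge> 1" for t
    proof -
      have "(\<integral>\<^sup>+r. ennreal ((J t r)\<^sup>2 * r ^ (n - 1)) * indicator {0<..} r \<partial>lborel)
        \<le> (\<integral>\<^sup>+r. ennreal (K\<^sup>2 * t ^ 4) * (ennreal (r ^ 2) * indicator {0..1 / t} r)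
            + ennreal 4 * (ennreal (1 / r ^ Suc (Suc 0)) * indicator {1 / t..} r) \<partial>lborel)"
      proof (rule nn_integral_mono)
        fix r
        show "ennreal ((J t r)\<^sup>2 * r ^ (n - 1)) * indicator {0<..} r \<le> ennreal (K\<^sup>2 * t ^ 4) * (ennreal (r ^ 2) * indicator {0..1 / t} r)
            + ennreal 4 * (ennreal (1 / r ^ Suc (Suc 0)) * indicator {1 / t..} r)"
        proof (cases "0 < r")
          case r: True
          show ?thesis
          proof (cases "r \<le> 1 / t")
            case True
            have "(J t r)\<^sup>2 * r\<^sup>2 \<le> K\<^sup>2 * t ^ 4 * r\<^sup>2" using J1[OF t r] by (rule mult_right_mono) simp
            then show ?thesis using True r 1 by (auto simp: ennreal_mult[symmetric] ennreal_leI intro!: add_increasing2)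
          next
            case False
            have "(J t r)\<^sup>2 * r\<^sup>2 \<le> 4 / r ^ 4 * r\<^sup>2" using J3[OF t r] by (rule mult_right_mono) simp
            also have "\<dots> = 4 * (1 / r ^ Suc (Suc 0))" using r by (simp add: eval_nat_numeral)
            finally show ?thesis using False r 1 by (auto simp: ennreal_mult[symmetric] ennreal_leI simp del: power_Suc ennreal_numeral)
          qed
        qed simp
      qed
      also have "\<dots> = ennreal (K\<^sup>2 * t ^ 4) * ennreal (((1 / t) ^ Suc 2 - 0 ^ Suc 2) / real (Suc 2))
          + ennreal 4 * ennreal (1 / (real (Suc 0) * (1 / t) ^ Suc 0))"
        using t by (subst nn_integral_add, simp, simp, subst nn_integral_cmult, simp, subst nn_integral_cmult, simp)
          (subst nn_integral_power_Icc, simp, simp, subst nn_integral_inverse_power_atLeast, simp, simp)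
      also have "\<dots> = ennreal (K\<^sup>2 * t ^ 4 * ((1 / t) ^ 3 / 3) + 4 * t)"
        using t K by (simp add: ennreal_mult[symmetric] numeral_3_eq_3[symmetric] flip: ennreal_numeral)
      also have "K\<^sup>2 * t ^ 4 * ((1 / t) ^ 3 / 3) + 4 * t = (K\<^sup>2 / 3 + 4) * (D_tilde n t)\<^sup>2"
      proof -
        have "(D_tilde n t)\<^sup>2 = t" using D_tilde_sq_3 t 1 by simp
        then show ?thesis using t by (simp only:) (simp add: field_simps eval_nat_numeral)
      qed
      finally show ?thesis .
    qed
    then show ?thesis using K by (intro exI[of _ "K\<^sup>2 / 3 + 4"]) (simp add: add_nonneg_pos)
  next
    case 2
    have "(\<integral>\<^sup>+r. ennreal ((J t r)\<^sup>2 * r ^ (n - 1)) * indicator {0<..} r \<partial>lborel) \<le> ennreal ((K\<^sup>2 / 4 + 2 + 1 / \<kappa>) * (D_tilde n t)\<^sup>2)"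
      if t: "t \<ge> 1" for t
    proof -
      define s where "s = 1 / sqrt t"
      have s: "0 < s" "1 / t \<le> s" "s\<^sup>2 = 1 / t"
      proof -
        have "sqrt t \<le> t" using t by (intro real_le_lsqrt) (auto simp: power2_eq_square)
        then show "0 < s" "1 / t \<le> s" "s\<^sup>2 = 1 / t"
          using t by (auto simp: s_def power_divide intro!: divide_left_mono)
      qed
      have lns: "ln s = - (ln t / 2)" using t by (simp add: s_def ln_div ln_sqrt)
      have "(\<integral>\<^sup>+r. ennreal ((J t r)\<^sup>2 * r ^ (n - 1)) * indicator {0<..} r \<partial>lborel)
        \<le> (\<integral>\<^sup>+r. ennreal (K\<^sup>2 * t ^ 4) * (ennreal (r ^ 3) * indicator {0..1 / t} r)
            + (ennreal 4 * (ennreal (1 / r) * indicator {1 / t..s} r)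
            + ennreal (2 / (\<kappa> * t)) * (ennreal (1 / r ^ Suc (Suc 1)) * indicator {s..} r)) \<partial>lborel)"
      proof (rule nn_integral_mono)
        fix r
        show "ennreal ((J t r)\<^sup>2 * r ^ (n - 1)) * indicator {0<..} r \<le> ennreal (K\<^sup>2 * t ^ 4) * (ennreal (r ^ 3) * indicator {0..1 / t} r)
            + (ennreal 4 * (ennreal (1 / r) * indicator {1 / t..s} r)
            + ennreal (2 / (\<kappa> * t)) * (ennreal (1 / r ^ Suc (Suc 1)) * indicator {s..} r))"
        proof (cases "0 < r")
          case r: True
          have lhs: "ennreal ((J t r)\<^sup>2 * r ^ (n - 1)) * indicator {0<..} r = ennreal ((J t r)\<^sup>2 * r ^ 3)"
            using r \<open>n = 4\<close> by simp
          consider "r \<le> 1 / t" | "1 / t < r" "r \<le> s" | "s < r" by linarith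
          then show ?thesis
          proof cases
            case 1
            have "(J t r)\<^sup>2 * r ^ 3 \<le> K\<^sup>2 * t ^ 4 * r ^ 3" using J1[OF t r] r by (intro mult_right_mono) auto
            then have "ennreal ((J t r)\<^sup>2 * r ^ 3) \<le> ennreal (K\<^sup>2 * t ^ 4) * (ennreal (r ^ 3) * indicator {0..1 / t} r)"
              using 1 r by (simp add: ennreal_mult[symmetric] ennreal_leI)
            then show ?thesis unfolding lhs by (rule ennreal_le_add3(1))
          next
            case 2
            have "(J t r)\<^sup>2 * r ^ 3 \<le> 4 / r ^ 4 * r ^ 3" using J3[OF t r] r by (intro mult_right_mono) auto
            also have "\<dots> = 4 * (1 / r)" using r by (simp add: eval_nat_numeral)
            finally have "ennreal ((J t r)\<^sup>2 * r ^ 3) \<le> ennreal 4 * (ennreal (1 / r) * indicator {1 / t..s} r)"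
              using 2 r by (simp add: ennreal_mult[symmetric] ennreal_leI del: ennreal_numeral)
            then show ?thesis unfolding lhs by (rule ennreal_le_add3(2))
          next
            case 3
            have "(J t r)\<^sup>2 * r ^ 3 \<le> 4 * exp (- (2 * \<kappa> * r\<^sup>2 * t)) / r ^ 4 * r ^ 3"
              using J2[OF t r] r by (intro mult_right_mono) auto
            \<comment> \<open>The crude bound exp(-x) \<le> 1 / x already makes the integrand decay
              like r^-3 beyond 1 / sqrt t.\<close>
            also have "\<dots> \<le> 4 * (real 1 ^ 1 / (2 * \<kappa> * r\<^sup>2 * t) ^ 1) / r ^ 4 * r ^ 3"
              using \<kappa> r t by (intro mult_right_mono divide_right_mono mult_left_mono exp_minus_le_inverse_power) auto
            also have "\<dots> = 2 / (\<kappa> * t) * (1 / r ^ Suc (Suc 1))" using r \<kappa> t by (simp add: field_simps eval_nat_numeral)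
            finally have "ennreal ((J t r)\<^sup>2 * r ^ 3) \<le> ennreal (2 / (\<kappa> * t)) * (ennreal (1 / r ^ Suc (Suc 1)) * indicator {s..} r)"
              using 3 r \<kappa> t by (simp add: ennreal_mult[symmetric] ennreal_leI del: power_Suc)
            then show ?thesis unfolding lhs by (rule ennreal_le_add3(3))
          qed
        qed simp
      qed
      also have "\<dots> = ennreal (K\<^sup>2 * t ^ 4) * ennreal (((1 / t) ^ Suc 3 - 0 ^ Suc 3) / real (Suc 3))
          + (ennreal 4 * ennreal (ln s - ln (1 / t)) + ennreal (2 / (\<kappa> * t)) * ennreal (1 / (real (Suc 1) * s ^ Suc 1)))"
        using t s by (subst nn_integral_add, simp, simp, subst nn_integral_add, simp, simp,
            subst nn_integral_cmult, simp, subst nn_integral_cmult, simp, subst nn_integral_cmult, simp)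
          (subst nn_integral_power_Icc, simp, simp, subst nn_integral_inverse_power_atLeast, simp, subst nn_integral_inverse_Icc, simp_all)
      also have "\<dots> = ennreal (K\<^sup>2 * t ^ 4 * ((1 / t) ^ 4 / 4) + (4 * (ln s - ln (1 / t)) + 2 / (\<kappa> * t) * (1 / (2 * s\<^sup>2))))"
      proof -
        have "0 \<le> ln s - ln (1 / t)" using s t by simp
        then show ?thesis using t K \<kappa> s by (simp add: ennreal_mult[symmetric] eval_nat_numeral flip: ennreal_numeral)
      qed
      also have "K\<^sup>2 * t ^ 4 * ((1 / t) ^ 4 / 4) + (4 * (ln s - ln (1 / t)) + 2 / (\<kappa> * t) * (1 / (2 * s\<^sup>2))) = K\<^sup>2 / 4 + 2 * ln t + 1 / \<kappa>"
        using t \<kappa> unfolding s(3) lns by (simp add: ln_div power_divide)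
      \<comment> \<open>For n = 4 the squared rate is at least 1 and at least ln t, so it covers the
        bounded parts as well as the logarithm.\<close>
      also have "\<dots> \<le> K\<^sup>2 / 4 * (D_tilde n t)\<^sup>2 + 2 * (D_tilde n t)\<^sup>2 + 1 / \<kappa> * (D_tilde n t)\<^sup>2"
        using ln_exp1_bounds[OF t] \<kappa> unfolding \<open>n = 4\<close> D_tilde_sq_4[OF t]
        by (intro add_mono) (auto simp: mult_le_cancel_left1 divide_right_mono)
      finally show ?thesis by (simp add: ennreal_leI algebra_simps)
    qed
    then show ?thesis using K \<kappa> by (intro exI[of _ "K\<^sup>2 / 4 + 2 + 1 / \<kappa>"]) (simp add: add_nonneg_pos add_pos_pos)
  next
    case 3
    define C where "C = 4 * (1 + (real (Suc (n - 5)) / (2 * \<kappa>)) ^ Suc (n - 5))"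
    have C: "C > 0" using \<kappa> by (simp add: C_def add_pos_nonneg)
    have "(\<integral>\<^sup>+r. ennreal ((J t r)\<^sup>2 * r ^ (n - 1)) * indicator {0<..} r \<partial>lborel) \<le> ennreal (C * (D_tilde n t)\<^sup>2)"
      if t: "t \<ge> 1" for t
    proof -
      have "(\<integral>\<^sup>+r. ennreal ((J t r)\<^sup>2 * r ^ (n - 1)) * indicator {0<..} r \<partial>lborel)
        \<le> (\<integral>\<^sup>+r. ennreal 4 * (ennreal (exp (- (2 * \<kappa> * r\<^sup>2 * t)) * r ^ (n - 5)) * indicator {0<..} r) \<partial>lborel)"
      proof (rule nn_integral_mono)
        fix r
        show "ennreal ((J t r)\<^sup>2 * r ^ (n - 1)) * indicator {0<..} r
          \<le> ennreal 4 * (ennreal (exp (- (2 * \<kappa> * r\<^sup>2 * t)) * r ^ (n - 5)) * indicator {0<..} r)"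
        proof (cases "0 < r")
          case r: True
          have "n - 1 = (n - 5) + 4" using 3 by simp
          then have rn: "r ^ (n - 1) = r ^ (n - 5) * r ^ 4" by (simp only: power_add)
          have "(J t r)\<^sup>2 * r ^ (n - 1) \<le> 4 * exp (- (2 * \<kappa> * r\<^sup>2 * t)) / r ^ 4 * r ^ (n - 1)"
            using J2[OF t r] r by (intro mult_right_mono) auto
          also have "\<dots> = 4 * (exp (- (2 * \<kappa> * r\<^sup>2 * t)) * r ^ (n - 5))" unfolding rn using r by simp
          finally show ?thesis using r by (simp add: ennreal_mult[symmetric] ennreal_leI del: ennreal_numeral)
        qed simp
      qed
      also have "\<dots> = ennreal 4 * (\<integral>\<^sup>+r. ennreal (exp (- (2 * \<kappa> * r\<^sup>2 * t)) * r ^ (n - 5)) * indicator {0<..} r \<partial>lborel)"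
        by (rule nn_integral_cmult) simp
      also have "\<dots> \<le> ennreal 4 * ennreal ((1 + (real (Suc (n - 5)) / (2 * \<kappa>)) ^ Suc (n - 5)) * (1 / sqrt t) ^ Suc (n - 5))"
        using \<kappa> t by (intro mult_left_mono nn_integral_gauss_moment_le) auto
      also have "\<dots> = ennreal (C * (1 / sqrt t) ^ Suc (n - 5))"
        using \<kappa> t by (subst ennreal_mult[symmetric]) (simp_all add: C_def mult.assoc)
      also have "Suc (n - 5) = n - 4" using 3 by simp
      finally show ?thesis using t by (simp add: D_tilde_sq_ge5[OF 3])
    qed
    then show ?thesis using C by blast
  qed
  then show ?thesis unfolding J_def .
qed

text \<open>
  The oscillation is harmless because \<open>(1 - cos x)\<^sup>2 \<ge> 1 - 2 cos x\<close> and \<open>cos x / x\<close> has a bounded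
  primitive at infinity.
\<close>

lemma log_oscillation_integral_ge:
  fixes a b t :: real
  assumes "0 < t" "0 < a" "a \<le> b"
  shows "ennreal (ln b - ln a - 4 / (a * t))
    \<le> (\<integral>\<^sup>+r. ennreal ((1 - cos (r * t))\<^sup>2 / r) * indicator {a..b} r \<partial>lborel)"
proof -
  define f where "f r = (1 - cos (r * t))\<^sup>2 / r" for r
  \<comment> \<open>The second term is the start of a primitive of -2 cos(r t) / r; its remainder 2
    sin(r t) / (r^2 t) has no sign. The derivative -2 / (r^2 t) of the last term outweighs it, so
    the derivative of H lies below the integrand.\<close>
  define H where "H r = ln r - 2 * sin (r * t) / (r * t) + 2 / (r * t)" for r
  define H' where "H' r = 1 / r - 2 * cos (r * t) / r + 2 * sin (r * t) / (r\<^sup>2 * t) - 2 / (r\<^sup>2 * t)" for r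
  have pos: "0 < r" if "r \<in> {a..b}" for r using that assms by simp
  have H: "(H' has_integral (H b - H a)) {a..b}"
  proof (rule fundamental_theorem_of_calculus[OF assms(3)])
    fix r assume "r \<in> {a..b}"
    from pos[OF this] have "(H has_real_derivative H' r) (at r)"
      unfolding H_def H'_def using assms
      by (auto intro!: derivative_eq_intros simp: field_simps power2_eq_square)
    then show "(H has_vector_derivative H' r) (at r within {a..b})"
      by (simp add: has_real_derivative_iff_has_vector_derivative has_vector_derivative_at_within)
  qed
  have "continuous_on {a..b} f"
    unfolding f_def using assms by (intro continuous_intros) auto
  then have f: "(f has_integral integral {a..b} f) {a..b}"
    by (intro integrable_integral integrable_continuous_interval)
  have "H b - H a \<le> integral {a..b} f"
  proof (rule has_integral_le[OF H f])
    fix r assume "r \<in> {a..b}"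
    from pos[OF this] have r: "0 < r" .
    have "2 * sin (r * t) / (r\<^sup>2 * t) \<le> 2 / (r\<^sup>2 * t)"
      using assms r by (intro divide_right_mono) auto
    then have "H' r \<le> 1 / r - 2 * cos (r * t) / r" by (simp add: H'_def)
    also have "\<dots> = (1 - 2 * cos (r * t)) / r" by (simp add: diff_divide_distrib)
    also have "\<dots> \<le> f r"
      unfolding f_def using r by (intro divide_right_mono) (auto simp: power2_eq_square algebra_simps)
    finally show "H' r \<le> f r" .
  qed
  moreover have "ln b \<le> H b"
  proof -
    have "2 * sin (b * t) / (b * t) \<le> 2 / (b * t)" using assms by (intro divide_right_mono) auto
    then show ?thesis by (simp add: H_def)
  qed
  moreover have "H a \<le> ln a + 4 / (a * t)"
  proof -
    have "- 2 \<le> 2 * sin (a * t)" using sin_ge_minus_one[of "a * t"] by linarith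
    then have "- 2 / (a * t) \<le> 2 * sin (a * t) / (a * t)" using assms by (intro divide_right_mono) auto
    then show ?thesis by (simp add: H_def)
  qed
  ultimately have "ln b - ln a - 4 / (a * t) \<le> integral {a..b} f" by simp
  moreover have "ennreal (integral {a..b} f) = (\<integral>\<^sup>+r. ennreal (f r) * indicator {a..b} r \<partial>lborel)"
  proof -
    have "(\<integral>\<^sup>+r. ennreal (indicator {a..b} r * f r) \<partial>lborel) = ennreal (integral {a..b} f)"
      using assms by (intro nn_integral_has_integral_lebesgue[OF _ f]) (auto simp: f_def)
    moreover have "ennreal (indicator {a..b} r * f r) = ennreal (f r) * indicator {a..b} r" for r
      by (auto simp: indicator_def)
    ultimately show ?thesis by simp
  qed
  ultimately show ?thesis unfolding f_def[symmetric] by (metis ennreal_leI)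
qed

lemma nn_integral_ge_const_Icc:
  fixes a b c :: real
  assumes "a \<le> b" "0 \<le> c" "\<And>r. a \<le> r \<Longrightarrow> r \<le> b \<Longrightarrow> ennreal c \<le> f r"
  shows "ennreal (c * (b - a)) \<le> (\<integral>\<^sup>+r. f r \<partial>lborel)"
proof -
  have "ennreal (c * (b - a)) = (\<integral>\<^sup>+r. ennreal c * indicator {a..b} r \<partial>lborel)"
    using assms by (simp add: nn_integral_cmult_indicator ennreal_mult)
  also have "\<dots> \<le> (\<integral>\<^sup>+r. f r \<partial>lborel)"
    using assms(3) by (intro nn_integral_mono) (auto simp: indicator_def)
  finally show ?thesis .
qed

text \<open>The integral is restricted to the dominant range. For n = 3, r t runs through [1, 2],
  where the cosine stays below cos 1. For n = 4 the cosine oscillates over the whole range and is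
  handled by \<open>log_oscillation_integral_ge\<close>. For n \<ge> 5, r^2 t runs through [1, 4],
  where the strict inequality \<kappa> < \<delta> / 2 separates the two exponentials whatever the
  cosine does.\<close>

lemma diffusion_wave_integral_ge:
  assumes n: "3 \<le> n" and \<kappa>: "0 < \<kappa>" "\<kappa> < \<delta> / 2" and r0: "0 < r0"
  shows "\<exists>c>0. \<forall>\<^sub>F t in at_top. ennreal (c * (D_tilde n t)\<^sup>2)
     \<le> (\<integral>\<^sup>+r. ennreal ((diffusion_wave \<kappa> \<delta> r t / r\<^sup>2)\<^sup>2 * r ^ (n - 1)) * indicator {0<..r0} r \<partial>lborel)"
proof -
  define J where "J t r = diffusion_wave \<kappa> \<delta> r t" for t r
  have J_ge: "exp (- \<kappa>) * (1 - cos (r * t)) / 2 \<le> J t r" if "0 \<le> t" "r\<^sup>2 * t \<le> 1" for t r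
  proof -
    have "\<kappa> * (r\<^sup>2 * t) \<le> \<kappa> * 1" using that \<kappa> by (intro mult_left_mono) auto
    then have "exp (- \<kappa>) * (1 - cos (r * t)) / 2 \<le> exp (- (\<kappa> * r\<^sup>2 * t)) * (1 - cos (r * t)) / 2"
      by (intro divide_right_mono mult_right_mono) (auto simp: mult.assoc)
    also have "\<dots> \<le> J t r" unfolding J_def using that \<kappa> by (intro diffusion_wave_ge) auto
    finally show ?thesis .
  qed
  consider "n = 3" | "n = 4" | "5 \<le> n" using n by linarith
  then have "\<exists>c>0. \<forall>\<^sub>F t in at_top. ennreal (c * (D_tilde n t)\<^sup>2)
     \<le> (\<integral>\<^sup>+r. ennreal ((J t r / r\<^sup>2)\<^sup>2 * r ^ (n - 1)) * indicator {0<..r0} r \<partial>lborel)"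
  proof cases
    case 1
    define q where "q = exp (- \<kappa>) * (1 - cos 1) / 2"
    have "cos 1 < cos (0::real)" using pi_gt3 by (intro cos_monotone_0_pi) auto
    then have q: "0 < q" by (simp add: q_def)
    have "\<forall>\<^sub>F t in at_top. ennreal (q\<^sup>2 / 4 * (D_tilde n t)\<^sup>2)
     \<le> (\<integral>\<^sup>+r. ennreal ((J t r / r\<^sup>2)\<^sup>2 * r ^ (n - 1)) * indicator {0<..r0} r \<partial>lborel)"
      \<comment> \<open>From t \<ge> 4 one gets r^2 t \<le> 1 on the interval [1 / t, 2 / t]; the
        other entry places that interval below \<open>r0\<close>.\<close>
      using eventually_ge_at_top[of "max 4 (2 / r0)"]
    proof eventually_elim
      case (elim t)
      then have t: "4 \<le> t" "2 / t \<le> r0" using r0 by (auto simp: field_simps)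
      have "ennreal (q\<^sup>2 * t\<^sup>2 / 4 * (2 / t - 1 / t)) \<le> (\<integral>\<^sup>+r. ennreal ((J t r / r\<^sup>2)\<^sup>2 * r ^ (n - 1)) * indicator {0<..r0} r \<partial>lborel)"
      proof (rule nn_integral_ge_const_Icc)
        fix r assume r: "1 / t \<le> r" "r \<le> 2 / t"
        have rt: "1 \<le> r * t" "r * t \<le> 2" using r t by (auto simp: field_simps)
        have rpos: "0 < r" using r t by (smt (verit) divide_pos_pos)
        have "r\<^sup>2 * t = (r * t)\<^sup>2 / t" using t by (simp add: power2_eq_square)
        also have "\<dots> \<le> 2\<^sup>2 / t" using rt t by (intro divide_right_mono power_mono) auto
        also have "\<dots> \<le> 1" using t by simp
        finally have "r\<^sup>2 * t \<le> 1" .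
        then have "exp (- \<kappa>) * (1 - cos (r * t)) / 2 \<le> J t r" using t by (intro J_ge) auto
        moreover have "cos (r * t) \<le> cos 1" using rt pi_gt3 by (intro cos_monotone_0_pi_le) auto
        ultimately have "q \<le> J t r" unfolding q_def
          by (smt (verit) divide_right_mono mult_left_mono exp_ge_zero)
        have "q * t / 2 \<le> q / r"
        proof -
          have "q * (r * t) \<le> q * 2" using rt q by (intro mult_left_mono) auto
          then show ?thesis using rpos by (simp add: field_simps)
        qed
        also have "\<dots> \<le> J t r / r" using \<open>q \<le> J t r\<close> rpos by (intro divide_right_mono) auto
        finally have "(q * t / 2)\<^sup>2 \<le> (J t r / r)\<^sup>2" using q t by (intro power_mono) auto
        also have "(J t r / r)\<^sup>2 = (J t r / r\<^sup>2)\<^sup>2 * r ^ (n - 1)" using 1 rpos by (simp add: power_divide power2_eq_square)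
        finally have "q\<^sup>2 * t\<^sup>2 / 4 \<le> (J t r / r\<^sup>2)\<^sup>2 * r ^ (n - 1)" by (simp add: power_divide power_mult_distrib)
        then show "ennreal (q\<^sup>2 * t\<^sup>2 / 4) \<le> ennreal ((J t r / r\<^sup>2)\<^sup>2 * r ^ (n - 1)) * indicator {0<..r0} r"
          using rpos r t by (simp add: ennreal_leI)
      qed (use t in \<open>auto simp: divide_right_mono\<close>)
      also have "q\<^sup>2 * t\<^sup>2 / 4 * (2 / t - 1 / t) = q\<^sup>2 / 4 * (D_tilde n t)\<^sup>2"
      proof -
        have "(D_tilde n t)\<^sup>2 = t" using D_tilde_sq_3 t 1 by simp
        then show ?thesis using t by (simp only:) (simp add: field_simps power2_eq_square)
      qed
      finally show ?case .
    qed
    then show ?thesis using q by (intro exI[of _ "q\<^sup>2 / 4"]) simp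
  next
    case 2
    define q where "q = (exp (- \<kappa>) / 2)\<^sup>2"
    have q: "0 < q" by (simp add: q_def)
    have "\<forall>\<^sub>F t in at_top. ennreal (q / 8 * (D_tilde n t)\<^sup>2)
     \<le> (\<integral>\<^sup>+r. ennreal ((J t r / r\<^sup>2)\<^sup>2 * r ^ (n - 1)) * indicator {0<..r0} r \<partial>lborel)"
      \<comment> \<open>The integral is at least ln t / 2 - 4 up to a constant factor. For ln t
        \<ge> 16 this is at least ln t / 4, and the squared rate is at most 2 ln t; hence the factor
        1 / 8.\<close>
      using eventually_ge_at_top[of "max (exp 16) (1 / r0\<^sup>2)"]
    proof eventually_elim
      case (elim t)
      have t16: "exp 16 \<le> t" using elim by simp
      have t1: "exp 1 \<le> t" "1 \<le> t" by (rule order_trans[OF _ t16], simp)+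
      then have t: "exp 16 \<le> t" "exp 1 \<le> t" "1 \<le> t" "0 < t" using t16 by auto
      define s where "s = 1 / sqrt t"
      have s: "0 < s" "1 / t \<le> s" "s\<^sup>2 * t = 1" "s \<le> r0"
      proof -
        have "sqrt t \<le> t" using t by (intro real_le_lsqrt) (auto simp: power2_eq_square)
        then show "0 < s" "1 / t \<le> s" "s\<^sup>2 * t = 1"
          using t by (auto simp: s_def power_divide intro!: divide_left_mono)
        have "sqrt (1 / r0\<^sup>2) \<le> sqrt t" using elim by simp
        then have "1 / r0 \<le> sqrt t" using r0 by (simp add: real_sqrt_divide)
        then show "s \<le> r0" using r0 t by (simp add: s_def field_simps)
      qed
      have "ennreal q * ennreal (ln s - ln (1 / t) - 4 / (1 / t * t))
        \<le> ennreal q * (\<integral>\<^sup>+r. ennreal ((1 - cos (r * t))\<^sup>2 / r) * indicator {1 / t..s} r \<partial>lborel)"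
        using t s by (intro mult_left_mono log_oscillation_integral_ge) auto
      also have "\<dots> = (\<integral>\<^sup>+r. ennreal q * (ennreal ((1 - cos (r * t))\<^sup>2 / r) * indicator {1 / t..s} r) \<partial>lborel)"
        by (rule nn_integral_cmult[symmetric]) simp
      also have "\<dots> \<le> (\<integral>\<^sup>+r. ennreal ((J t r / r\<^sup>2)\<^sup>2 * r ^ (n - 1)) * indicator {0<..r0} r \<partial>lborel)"
      proof (rule nn_integral_mono)
        fix r
        show "ennreal q * (ennreal ((1 - cos (r * t))\<^sup>2 / r) * indicator {1 / t..s} r)
          \<le> ennreal ((J t r / r\<^sup>2)\<^sup>2 * r ^ (n - 1)) * indicator {0<..r0} r"
        proof (cases "r \<in> {1 / t..s}")
          case True
          have "0 < 1 / t" using t by simp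
          moreover have "1 / t \<le> r" using True by simp
          ultimately have r: "0 < r" "r \<le> s" using True by (simp_all only: order_less_le_trans atLeastAtMost_iff)
          have "r\<^sup>2 * t \<le> s\<^sup>2 * t" using r t by (intro mult_right_mono power_mono) auto
          then have "r\<^sup>2 * t \<le> 1" using s by simp
          then have "exp (- \<kappa>) / 2 * (1 - cos (r * t)) \<le> J t r" using t J_ge[of t r] by simp
          then have "(exp (- \<kappa>) / 2 * (1 - cos (r * t)))\<^sup>2 \<le> (J t r)\<^sup>2" by (intro power_mono) auto
          then have "q * (1 - cos (r * t))\<^sup>2 / r \<le> (J t r)\<^sup>2 / r"
            using r by (intro divide_right_mono) (auto simp: q_def power_mult_distrib power_divide)
          also have "(J t r)\<^sup>2 / r = (J t r / r\<^sup>2)\<^sup>2 * r ^ (n - 1)"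
            using r 2 by (simp add: power_divide eval_nat_numeral)
          finally show ?thesis using r s True q by (simp add: ennreal_mult[symmetric] ennreal_leI)
        qed simp
      qed
      finally have main: "ennreal q * ennreal (ln s - ln (1 / t) - 4 / (1 / t * t))
        \<le> (\<integral>\<^sup>+r. ennreal ((J t r / r\<^sup>2)\<^sup>2 * r ^ (n - 1)) * indicator {0<..r0} r \<partial>lborel)" .
      have lnt: "16 \<le> ln t" using t ln_ge_iff[of t 16] by simp
      have "exp 1 + (t - 1) \<le> t * t"
      proof -
        have "2 * t \<le> t * t" using t exp_ge_add_one_self[of 16] by (intro mult_right_mono) auto
        then show ?thesis using t by linarith
      qed
      then have "ln (exp 1 + (t - 1)) \<le> ln (t * t)" using t by (subst ln_le_cancel_iff) (auto intro: add_pos_nonneg)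
      then have D: "(D_tilde n t)\<^sup>2 \<le> 2 * ln t" using t 2 D_tilde_sq_4[OF t(3)] by (simp add: ln_mult)
      have "ln s - ln (1 / t) - 4 / (1 / t * t) = ln t / 2 - 4" using t by (simp add: s_def ln_div ln_sqrt)
      then have "(D_tilde n t)\<^sup>2 / 8 \<le> ln s - ln (1 / t) - 4 / (1 / t * t)" using D lnt by simp
      then have "q * ((D_tilde n t)\<^sup>2 / 8) \<le> q * (ln s - ln (1 / t) - 4 / (1 / t * t))" using q by (intro mult_left_mono) auto
      then have "ennreal (q / 8 * (D_tilde n t)\<^sup>2) \<le> ennreal (q * (ln s - ln (1 / t) - 4 / (1 / t * t)))"
        by (intro ennreal_leI) simp
      also have "\<dots> = ennreal q * ennreal (ln s - ln (1 / t) - 4 / (1 / t * t))" using q by (intro ennreal_mult') simp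
      also note main
      finally show ?case .
    qed
    then show ?thesis using q by (intro exI[of _ "q / 8"]) simp
  next
    case 3
    \<comment> \<open>With x = r^2 t in [1, 4], the common exponential is smallest at x = 4 and the
      gap between the two rates is smallest at x = 1.\<close>
    define q where "q = exp (- (4 * \<kappa>)) * (1 - exp (- (\<delta> / 2 - \<kappa>)))"
    have q: "0 < q" using \<kappa> by (simp add: q_def)
    have "\<forall>\<^sub>F t in at_top. ennreal (q\<^sup>2 * (D_tilde n t)\<^sup>2)
     \<le> (\<integral>\<^sup>+r. ennreal ((J t r / r\<^sup>2)\<^sup>2 * r ^ (n - 1)) * indicator {0<..r0} r \<partial>lborel)"
      using eventually_ge_at_top[of "max 1 (4 / r0\<^sup>2)"]
    proof eventually_elim
      case (elim t)
      then have t: "0 < t" by simp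
      define s where "s = 1 / sqrt t"
      have s: "0 < s" "s\<^sup>2 * t = 1" "2 * s \<le> r0"
      proof -
        show "0 < s" "s\<^sup>2 * t = 1" using t by (auto simp: s_def power_divide)
        have "sqrt (4 / r0\<^sup>2) \<le> sqrt t" using elim by simp
        then have "2 / r0 \<le> sqrt t" using r0 by (simp add: real_sqrt_divide)
        then show "2 * s \<le> r0" using r0 t by (simp add: s_def field_simps)
      qed
      have "ennreal (q\<^sup>2 * s ^ (n - 5) * (2 * s - s)) \<le> (\<integral>\<^sup>+r. ennreal ((J t r / r\<^sup>2)\<^sup>2 * r ^ (n - 1)) * indicator {0<..r0} r \<partial>lborel)"
      proof (rule nn_integral_ge_const_Icc)
        fix r assume r: "s \<le> r" "r \<le> 2 * s"
        have rpos: "0 < r" using r s by simp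
        define x where "x = r\<^sup>2 * t"
        have x: "1 \<le> x" "x \<le> 4"
        proof -
          have "s\<^sup>2 * t \<le> r\<^sup>2 * t" "r\<^sup>2 * t \<le> (2 * s)\<^sup>2 * t" using r s t by (intro mult_right_mono power_mono; simp)+
          then show "1 \<le> x" "x \<le> 4" using s by (auto simp: x_def power_mult_distrib)
        qed
        have "q \<le> exp (- (\<kappa> * x)) * (1 - exp (- ((\<delta> / 2 - \<kappa>) * x)))"
          unfolding q_def
        proof (rule mult_mono)
          show "exp (- (4 * \<kappa>)) \<le> exp (- (\<kappa> * x))" using x \<kappa> by simp
          have "(\<delta> / 2 - \<kappa>) * 1 \<le> (\<delta> / 2 - \<kappa>) * x" using x \<kappa> by (intro mult_left_mono) auto
          then show "1 - exp (- (\<delta> / 2 - \<kappa>)) \<le> 1 - exp (- ((\<delta> / 2 - \<kappa>) * x))" by simp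
        qed (use \<kappa> in auto)
        also have "\<dots> = exp (- (\<kappa> * x)) - exp (- (\<delta> / 2 * x)) * 1"
          by (simp add: right_diff_distrib exp_add[symmetric] algebra_simps)
        also have "\<dots> \<le> exp (- (\<kappa> * x)) - exp (- (\<delta> / 2 * x)) * cos (r * t)"
          by (intro diff_left_mono mult_left_mono) auto
        also have "\<dots> = J t r" by (simp add: J_def diffusion_wave_def x_def mult.assoc)
        finally have "q\<^sup>2 \<le> (J t r)\<^sup>2" using q by (intro power_mono) auto
        then have "q\<^sup>2 * s ^ (n - 5) \<le> (J t r)\<^sup>2 * r ^ (n - 5)" using r s by (intro mult_mono) (simp_all add: power_mono)
        also have "\<dots> = (J t r / r\<^sup>2)\<^sup>2 * r ^ (n - 1)"
        proof -
          have "n - 1 = (n - 5) + 4" using 3 by simp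
          then have "r ^ (n - 1) = r ^ (n - 5) * r ^ 4" by (simp only: power_add)
          then show ?thesis using rpos by (simp add: power_divide)
        qed
        finally show "ennreal (q\<^sup>2 * s ^ (n - 5)) \<le> ennreal ((J t r / r\<^sup>2)\<^sup>2 * r ^ (n - 1)) * indicator {0<..r0} r"
          using rpos r s by (simp add: ennreal_leI)
      qed (use s in auto)
      also have "q\<^sup>2 * s ^ (n - 5) * (2 * s - s) = q\<^sup>2 * (D_tilde n t)\<^sup>2"
      proof -
        have "n - 4 = Suc (n - 5)" using 3 by simp
        then have "(D_tilde n t)\<^sup>2 = s * s ^ (n - 5)" using D_tilde_sq_ge5[OF 3 t] by (simp add: s_def)
        then show ?thesis by simp
      qed
      finally show ?case .
    qed
    then show ?thesis using q by (intro exI[of _ "q\<^sup>2"]) simp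
  qed
  then show ?thesis unfolding J_def .
qed

section \<open>The optimal decay rate\<close>

lemma cmod_fourier_L1_le_L11:
  assumes "in_L11 f"
  shows "cmod (fourier_L1 f \<xi>) \<le> L11_norm f"
proof -
  have "(LINT x|lebesgue. cmod (f x)) \<le> L11_norm f"
    unfolding L11_norm_def using assms
    by (intro integral_mono) (auto simp: in_L11_def algebra_simps)
  with cmod_fourier_L1_le[of f \<xi>] show ?thesis by simp
qed

text \<open>From |exp(i s) - 1| \<le> |s|: the first moment pays for the factor |\<xi>|.\<close>

lemma cmod_fourier_L1_diff_mean_le:
  assumes f: "in_L11 f"
  shows "cmod (fourier_L1 f \<xi> - mean_P f) \<le> norm \<xi> * L11_norm f"
proof -
  have int: "integrable lebesgue f" and int1: "integrable lebesgue (\<lambda>x. (1 + norm x) * cmod (f x))"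
    using f by (auto simp: in_L11_def)
  have "fourier_L1 f \<xi> - mean_P f = (LINT x|lebesgue. exp (- \<i> * complex_of_real (x \<bullet> \<xi>)) * f x - f x)"
    unfolding fourier_L1_def mean_P_def
    by (rule Bochner_Integration.integral_diff[symmetric, OF integrable_fourier_integrand[OF int] int])
  also have "cmod \<dots> \<le> (LINT x|lebesgue. norm \<xi> * ((1 + norm x) * cmod (f x)))"
  proof (rule order_trans[OF integral_norm_bound integral_mono])
    show "integrable lebesgue (\<lambda>x. cmod (exp (- \<i> * complex_of_real (x \<bullet> \<xi>)) * f x - f x))"
      by (intro integrable_norm Bochner_Integration.integrable_diff integrable_fourier_integrand int)
    show "integrable lebesgue (\<lambda>x. norm \<xi> * ((1 + norm x) * cmod (f x)))"
      by (intro integrable_mult_right int1)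
    fix x
    have "exp (- \<i> * complex_of_real (x \<bullet> \<xi>)) * f x - f x = (iexp (- (x \<bullet> \<xi>)) - 1) * f x"
      by (simp add: algebra_simps)
    then have "cmod (exp (- \<i> * complex_of_real (x \<bullet> \<xi>)) * f x - f x) = cmod (iexp (- (x \<bullet> \<xi>)) - 1) * cmod (f x)"
      by (simp only: norm_mult)
    also have "\<dots> \<le> \<bar>x \<bullet> \<xi>\<bar> * cmod (f x)"
      using iexp_approx1[of "- (x \<bullet> \<xi>)" 0] by (intro mult_right_mono) auto
    also have "\<dots> \<le> ((1 + norm x) * norm \<xi>) * cmod (f x)"
    proof (rule mult_right_mono)
      have "\<bar>x \<bullet> \<xi>\<bar> \<le> norm x * norm \<xi>" by (rule Cauchy_Schwarz_ineq2)
      also have "\<dots> \<le> (1 + norm x) * norm \<xi>" by (intro mult_right_mono) auto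
      finally show "\<bar>x \<bullet> \<xi>\<bar> \<le> (1 + norm x) * norm \<xi>" .
    qed simp
    finally show "cmod (exp (- \<i> * complex_of_real (x \<bullet> \<xi>)) * f x - f x) \<le> norm \<xi> * ((1 + norm x) * cmod (f x))"
      by (simp add: mult_ac)
  qed
  also have "\<dots> = norm \<xi> * L11_norm f" by (simp add: L11_norm_def)
  finally show ?thesis .
qed

lemma L2_norm_nonneg [simp]: "0 \<le> L2_norm f"
  by (simp add: L2_norm_def)

lemma L11_norm_nonneg [simp]: "0 \<le> L11_norm f"
  unfolding L11_norm_def by (intro Bochner_Integration.integral_nonneg) simp

lemma L2sq_eq_L2_norm:
  assumes "in_L2 f"
  shows "L2sq f = ennreal ((L2_norm f)\<^sup>2)"
  using assms by (simp add: in_L2_def L2sq_eq_integral L2_norm_def)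

lemma is_fourier_L2_norm_bounds:
  fixes f g :: "'a::euclidean_space \<Rightarrow> complex"
  assumes "is_fourier_L2 f g"
  shows "L2_norm g \<le> sqrt (2 * (2 * pi) ^ DIM('a)) * L2_norm f"
    and "L2_norm f \<le> sqrt (8 / (2 * pi) ^ DIM('a)) * L2_norm g"
proof -
  have f: "in_L2 f" and g: "in_L2 g" using assms by (auto simp: is_fourier_L2_def)
  define C where "C = (2 * pi) ^ DIM('a)"
  have C: "0 < C" by (simp add: C_def)
  have "ennreal ((L2_norm g)\<^sup>2) \<le> ennreal (2 * C * (L2_norm f)\<^sup>2)"
    using is_fourier_L2_bounds(1)[OF assms] C unfolding L2sq_eq_L2_norm[OF f] L2sq_eq_L2_norm[OF g] C_def
    by (subst ennreal_mult) auto
  then have "(L2_norm g)\<^sup>2 \<le> 2 * C * (L2_norm f)\<^sup>2" using C by (subst (asm) ennreal_le_iff) auto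
  from real_sqrt_le_mono[OF this] show "L2_norm g \<le> sqrt (2 * (2 * pi) ^ DIM('a)) * L2_norm f"
    unfolding real_sqrt_mult[of "2 * C"] C_def[symmetric] by simp
  have "ennreal (C * (L2_norm f)\<^sup>2) \<le> ennreal (8 * (L2_norm g)\<^sup>2)"
    using is_fourier_L2_bounds(2)[OF assms] C unfolding L2sq_eq_L2_norm[OF f] L2sq_eq_L2_norm[OF g] C_def
    by (subst (1 2) ennreal_mult) auto
  then have "C * (L2_norm f)\<^sup>2 \<le> 8 * (L2_norm g)\<^sup>2" by (subst (asm) ennreal_le_iff) auto
  then have "(L2_norm f)\<^sup>2 \<le> 8 / C * (L2_norm g)\<^sup>2" using C by (simp add: field_simps)
  from real_sqrt_le_mono[OF this] show "L2_norm f \<le> sqrt (8 / (2 * pi) ^ DIM('a)) * L2_norm g"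
    unfolding real_sqrt_mult[of "8 / C"] C_def[symmetric] by simp
qed

lemma nn_integral_radial_on:
  fixes g :: "real \<Rightarrow> real"
  assumes [measurable]: "g \<in> borel_measurable borel" and g: "\<And>r. 0 \<le> g r" and r0: "0 < r0"
  shows "(\<integral>\<^sup>+\<xi>. ennreal (g (norm (\<xi>::'a::euclidean_space))) * indicator {0<..r0} (norm \<xi>) \<partial>lebesgue)
    = ennreal (real DIM('a) * unit_ball_vol (real DIM('a))) *
      (\<integral>\<^sup>+r. ennreal (g r * r ^ (DIM('a) - 1)) * indicator {0<..r0} r \<partial>lborel)"
proof -
  have "(\<integral>\<^sup>+\<xi>. ennreal (g (norm (\<xi>::'a))) * indicator {0<..r0} (norm \<xi>) \<partial>lebesgue)
    = ennreal (real DIM('a) * unit_ball_vol (real DIM('a))) *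
      (\<integral>\<^sup>+r. ennreal (g r) * indicator {0<..r0} r * ennreal (r ^ (DIM('a) - 1)) * indicator {0<..} r \<partial>lborel)"
    by (rule nn_integral_radial) measurable
  also have "(\<integral>\<^sup>+r. ennreal (g r) * indicator {0<..r0} r * ennreal (r ^ (DIM('a) - 1)) * indicator {0<..} r \<partial>lborel)
      = (\<integral>\<^sup>+r. ennreal (g r * r ^ (DIM('a) - 1)) * indicator {0<..r0} r \<partial>lborel)"
    using g by (intro nn_integral_cong) (auto simp: indicator_def ennreal_mult)
  finally show ?thesis .
qed

lemma D_tilde_nonneg: "1 \<le> t \<Longrightarrow> 0 \<le> D_tilde n t"
  using ln_exp1_bounds(1)[of t] by (simp add: D_tilde_def)

text \<open>The high frequencies are negligible. The power n - 2 is chosen to match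
  \<open>D_tilde_sq_ge_power\<close>.\<close>

lemma exp_minus_le_D_tilde:
  assumes n: "3 \<le> n" and c: "0 < c"
  shows "\<exists>C>0. \<forall>t\<ge>1. exp (- c * t) \<le> C * (D_tilde n t)\<^sup>2"
proof -
  define p where "p = n - 2"
  have p: "0 < p" using n by (simp add: p_def)
  define C where "C = real p ^ p / c ^ p"
  have C: "0 < C" using p c by (simp add: C_def)
  have "exp (- c * t) \<le> C * (D_tilde n t)\<^sup>2" if t: "1 \<le> t" for t
  proof -
    have st: "1 \<le> sqrt t" using t by simp
    have "exp (- (c * t)) \<le> real p ^ p / (c * t) ^ p"
      using c t p by (intro exp_minus_le_inverse_power) auto
    also have "\<dots> = C * (1 / t) ^ p" by (simp add: C_def power_mult_distrib power_divide)
    also have "\<dots> \<le> C * (1 / sqrt t) ^ p"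
    proof -
      have "sqrt t \<le> t" using t by (intro real_le_lsqrt) (auto simp: power2_eq_square)
      then have "1 / t \<le> 1 / sqrt t" using t by (intro divide_left_mono) auto
      then show ?thesis using C t by (intro mult_left_mono power_mono) auto
    qed
    also have "\<dots> \<le> C * ((D_tilde n t)\<^sup>2 / t)"
      unfolding p_def using D_tilde_sq_ge_power[OF n t] C by (intro mult_left_mono) auto
    also have "\<dots> \<le> C * ((D_tilde n t)\<^sup>2 / 1)" using t C by (intro mult_left_mono divide_left_mono) auto
    finally show ?thesis by simp
  qed
  with C show ?thesis by blast
qed

text \<open>Everything is estimated on the Fourier side. For the upper bound the low frequencies are
  controlled by the profile and the error weight, the high ones by exponential decay and the upper
  Plancherel inequality for the data. For the lower bound only the ball of radius \<open>r0\<close>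
  is kept, and the mean times the profile is compared with the solution there.\<close>

lemma blackstock_L2_estimate:
  fixes b \<nu> \<gamma> \<kappa> :: real
  assumes dim: "3 \<le> DIM('a::euclidean_space)"
    and pos: "0 < b" "0 < \<nu>" "0 < \<kappa>" "1 < \<gamma>" and \<kappa>: "2 * \<kappa> < b * \<nu>"
  shows "\<exists>c>0. \<exists>C>0. \<forall>(\<psi>0 :: 'a \<Rightarrow> complex) \<psi>1 \<psi>2 \<psi>.
       in_L2 \<psi>0 \<and> in_L11 \<psi>0 \<and> in_L2 \<psi>1 \<and> in_L11 \<psi>1 \<and> in_L2 \<psi>2 \<and> in_L11 \<psi>2 \<and>
       mean_P \<psi>2 \<noteq> 0 \<and> blackstock_solution b \<nu> \<gamma> \<kappa> \<psi>0 \<psi>1 \<psi>2 \<psi> \<longrightarrow>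
       (\<forall>\<^sub>F t in at_top.
          c * D_tilde DIM('a) t * cmod (mean_P \<psi>2) \<le> L2_norm (\<psi> t) \<and>
          L2_norm (\<psi> t) \<le> C * D_tilde DIM('a) t * (L2_L11_norm \<psi>0 + L2_L11_norm \<psi>1 + L2_L11_norm \<psi>2))"
proof -
  define n where "n = DIM('a)"
  have n: "3 \<le> n" using dim by (simp add: n_def)
  define k where "k = real n * unit_ball_vol (real n)"
  have k: "0 < k" using n by (simp add: k_def)
  define \<delta> where "\<delta> = blackstock_delta b \<nu> \<gamma> \<kappa>"
  have \<kappa>\<delta>: "\<kappa> < \<delta> / 2"
  proof -
    have "0 < (\<gamma> - 1) * \<kappa>" using pos by simp
    then show ?thesis using \<kappa> by (simp add: \<delta>_def blackstock_delta_def)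
  qed
  have \<kappa>b: "\<kappa> \<le> b * \<nu>" using \<kappa> pos by linarith
  obtain r0 c1 C1 where r0: "0 < r0" "r0 \<le> 1" and c1: "0 < c1" "0 < C1"
    and low: "\<And>r a0 a1 a2 v t. \<lbrakk>blackstock_ode b \<nu> \<gamma> \<kappa> r a0 a1 a2 v; 0 < r; r \<le> r0; 0 \<le> t\<rbrakk> \<Longrightarrow>
       cmod (v t - of_real (diffusion_wave \<kappa> \<delta> r t / r\<^sup>2) * a2)
         \<le> C1 * exp (- (c1 * r\<^sup>2 * t)) * (cmod a0 + cmod a1 + cmod a2) / r"
    and high: "\<And>r a0 a1 a2 v t. \<lbrakk>blackstock_ode b \<nu> \<gamma> \<kappa> r a0 a1 a2 v; r0 \<le> r; 0 \<le> t\<rbrakk> \<Longrightarrow>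
       cmod (v t) \<le> C1 * exp (- c1 * t) * (cmod a0 + cmod a1 + cmod a2)"
    using blackstock_pointwise[OF pos(1,2,3) \<kappa>b pos(4)] unfolding \<delta>_def by metis
  \<comment> \<open>Two errors are measured by the same weight \<open>E\<close>: the expansion error
    with rate \<open>c1\<close>, and the replacement of the transform of \<psi>2 by its mean, which
    inherits the rate \<kappa> of the profile. The latter costs the extra 2 in
    \<open>C2\<close>.\<close>
  define c2 where "c2 = min c1 \<kappa>"
  define C2 where "C2 = C1 + 2"
  have c2: "0 < c2" "0 < C2" using c1 pos by (auto simp: c2_def C2_def)
  define J where "J t r = diffusion_wave \<kappa> \<delta> r t / r\<^sup>2" for t r
  define E where "E t r = exp (- (c2 * r\<^sup>2 * t)) / r" for t r
  have J_meas [measurable]: "J t \<in> borel_measurable borel" for t unfolding J_def[abs_def] by measurable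
  have E_meas [measurable]: "E t \<in> borel_measurable borel" for t unfolding E_def[abs_def] by measurable
  define W where "W t = (\<integral>\<^sup>+\<xi>. ennreal ((J t (norm (\<xi>::'a)))\<^sup>2) * indicator {0<..r0} (norm \<xi>) \<partial>lebesgue)" for t
  define V where "V t = (\<integral>\<^sup>+\<xi>. ennreal ((E t (norm (\<xi>::'a)))\<^sup>2) * indicator {0<..r0} (norm \<xi>) \<partial>lebesgue)" for t
  define D where "D t = (D_tilde n t)\<^sup>2" for t
  have W_eq: "W t = ennreal k * (\<integral>\<^sup>+r. ennreal ((J t r)\<^sup>2 * r ^ (n - 1)) * indicator {0<..r0} r \<partial>lborel)" for t
    unfolding W_def k_def n_def by (rule nn_integral_radial_on[OF _ _ r0(1)]) auto
  have V_eq: "V t = ennreal k * (\<integral>\<^sup>+r. ennreal ((E t r)\<^sup>2 * r ^ (n - 1)) * indicator {0<..r0} r \<partial>lborel)" for t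
    unfolding V_def k_def n_def by (rule nn_integral_radial_on[OF _ _ r0(1)]) auto
  obtain CW where CW: "0 < CW" and W_le': "\<And>t. 1 \<le> t \<Longrightarrow>
      (\<integral>\<^sup>+r. ennreal ((J t r)\<^sup>2 * r ^ (n - 1)) * indicator {0<..} r \<partial>lborel) \<le> ennreal (CW * D t)"
    using diffusion_wave_integral_le[OF n pos(3) less_imp_le[OF \<kappa>\<delta>]] unfolding J_def D_def by blast
  obtain CV where CV: "0 < CV" and V_le': "\<And>t. 1 \<le> t \<Longrightarrow>
      (\<integral>\<^sup>+r. ennreal ((E t r)\<^sup>2 * r ^ (n - 1)) * indicator {0<..} r \<partial>lborel) \<le> ennreal (CV / t * D t)"
    using error_integral_le[OF n c2(1)] unfolding E_def D_def by blast
  obtain cW where cW: "0 < cW" and W_ge': "\<forall>\<^sub>F t in at_top. ennreal (cW * D t)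
      \<le> (\<integral>\<^sup>+r. ennreal ((J t r)\<^sup>2 * r ^ (n - 1)) * indicator {0<..r0} r \<partial>lborel)"
    using diffusion_wave_integral_ge[OF n pos(3) \<kappa>\<delta> r0(1)] unfolding J_def D_def by blast
  obtain Ce where Ce: "0 < Ce" and exp_le: "\<And>t. 1 \<le> t \<Longrightarrow> exp (- (2 * c1) * t) \<le> Ce * D t"
    using exp_minus_le_D_tilde[OF n, of "2 * c1"] c1 unfolding D_def by auto
  have D0: "0 \<le> D t" for t by (simp add: D_def)
  have W_le: "W t \<le> ennreal (k * CW * D t)" if "1 \<le> t" for t
  proof -
    have "W t \<le> ennreal k * (\<integral>\<^sup>+r. ennreal ((J t r)\<^sup>2 * r ^ (n - 1)) * indicator {0<..} r \<partial>lborel)"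
      unfolding W_eq by (intro mult_left_mono nn_integral_mono) (auto simp: indicator_def)
    also have "\<dots> \<le> ennreal k * ennreal (CW * D t)" by (intro mult_left_mono W_le' that) simp
    also have "\<dots> = ennreal (k * CW * D t)" using k CW D0 by (simp add: ennreal_mult[symmetric] mult.assoc)
    finally show ?thesis .
  qed
  have V_le: "V t \<le> ennreal (k * CV / t * D t)" if "1 \<le> t" for t
  proof -
    have "V t \<le> ennreal k * (\<integral>\<^sup>+r. ennreal ((E t r)\<^sup>2 * r ^ (n - 1)) * indicator {0<..} r \<partial>lborel)"
      unfolding V_eq by (intro mult_left_mono nn_integral_mono) (auto simp: indicator_def)
    also have "\<dots> \<le> ennreal k * ennreal (CV / t * D t)" by (intro mult_left_mono V_le' that) simp
    also have "\<dots> = ennreal (k * CV / t * D t)" using k CV D0 that by (simp add: ennreal_mult[symmetric] mult.assoc)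
    finally show ?thesis .
  qed
  have W_ge: "\<forall>\<^sub>F t in at_top. ennreal (k * cW * D t) \<le> W t"
    using W_ge'
  proof eventually_elim
    case (elim t)
    have "ennreal (k * cW * D t) = ennreal k * ennreal (cW * D t)"
      using k cW D0 by (simp add: ennreal_mult[symmetric] mult.assoc)
    also have "\<dots> \<le> W t" unfolding W_eq using elim by (intro mult_left_mono) auto
    finally show ?case .
  qed
  define P where "P = (2 * pi) ^ n"
  have P: "0 < P" by (simp add: P_def)
  \<comment> \<open>The three summands are the profile, the low-frequency error and the high
    frequencies.\<close>
  define K where "K = 2 * k * CW + 2 * C2\<^sup>2 * k * CV + 3 * C1\<^sup>2 * Ce * P"
  have K: "0 < K" unfolding K_def using k CW c2 CV c1 Ce P by (intro add_pos_pos mult_pos_pos) auto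
  \<comment> \<open>The 1 / 2 is the loss in the lower bound on the Fourier side, and
    \<open>sqrt (2 * P)\<close> the Plancherel factor for returning to the solution itself.\<close>
  define c where "c = sqrt (k * cW) / 2 / sqrt (2 * P)"
  define C where "C = sqrt (8 / P) * sqrt K"
  have c: "0 < c" using k cW P by (simp add: c_def)
  have C: "0 < C" using K P by (simp add: C_def)
  have main: "\<forall>\<^sub>F t in at_top. c * D_tilde n t * cmod (mean_P \<psi>2) \<le> L2_norm (\<psi> t) \<and>
          L2_norm (\<psi> t) \<le> C * D_tilde n t * (L2_L11_norm \<psi>0 + L2_L11_norm \<psi>1 + L2_L11_norm \<psi>2)"
    if data: "in_L2 \<psi>0" "in_L11 \<psi>0" "in_L2 \<psi>1" "in_L11 \<psi>1" "in_L2 \<psi>2" "in_L11 \<psi>2"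
      and m: "mean_P \<psi>2 \<noteq> 0" and sol: "blackstock_solution b \<nu> \<gamma> \<kappa> \<psi>0 \<psi>1 \<psi>2 \<psi>"
    for \<psi>0 \<psi>1 \<psi>2 :: "'a \<Rightarrow> complex" and \<psi>
  proof -
    obtain u where ode: "\<And>\<xi>. blackstock_ode b \<nu> \<gamma> \<kappa> (norm \<xi>)
               (fourier_L1 \<psi>0 \<xi>) (fourier_L1 \<psi>1 \<xi>) (fourier_L1 \<psi>2 \<xi>) (\<lambda>t. u t \<xi>)"
      and four: "\<And>t. t \<ge> 0 \<Longrightarrow> is_fourier_L2 (\<psi> t) (u t)"
      using sol unfolding blackstock_solution_def by blast
    define N where "N = L2_L11_norm \<psi>0 + L2_L11_norm \<psi>1 + L2_L11_norm \<psi>2"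
    define A where "A \<xi> = cmod (fourier_L1 \<psi>0 \<xi>) + cmod (fourier_L1 \<psi>1 \<xi>) + cmod (fourier_L1 \<psi>2 \<xi>)" for \<xi>
    define p where "p = cmod (mean_P \<psi>2)"
    have p: "0 < p" using m by (simp add: p_def)
    have N11: "L11_norm \<psi>0 + L11_norm \<psi>1 + L11_norm \<psi>2 \<le> N"
      unfolding N_def L2_L11_norm_def using L2_norm_nonneg[of \<psi>0] L2_norm_nonneg[of \<psi>1] L2_norm_nonneg[of \<psi>2] by linarith
    have N0: "0 \<le> N" unfolding N_def L2_L11_norm_def by simp
    have A_le: "A \<xi> \<le> N" for \<xi>
      unfolding A_def using cmod_fourier_L1_le_L11[OF data(2), of \<xi>] cmod_fourier_L1_le_L11[OF data(4), of \<xi>]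
        cmod_fourier_L1_le_L11[OF data(6), of \<xi>] N11 by linarith
    have a2_le: "cmod (fourier_L1 \<psi>2 \<xi>) \<le> N" for \<xi>
      using A_le[of \<xi>] norm_ge_zero[of "fourier_L1 \<psi>0 \<xi>"] norm_ge_zero[of "fourier_L1 \<psi>1 \<xi>"] unfolding A_def by linarith
    have mean: "cmod (fourier_L1 \<psi>2 \<xi> - mean_P \<psi>2) \<le> norm \<xi> * N" for \<xi>
    proof -
      have "L11_norm \<psi>2 \<le> N" using N11 L11_norm_nonneg[of \<psi>0] L11_norm_nonneg[of \<psi>1] by linarith
      then show ?thesis using cmod_fourier_L1_diff_mean_le[OF data(6), of \<xi>] mult_left_mono[of "L11_norm \<psi>2" N "norm \<xi>"] by simp
    qed
    have ints: "integrable lebesgue \<psi>0" "integrable lebesgue \<psi>1" "integrable lebesgue \<psi>2"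
      using data by (auto simp: in_L11_def)
    have F_meas [measurable]: "fourier_L1 \<psi>0 \<in> borel_measurable lebesgue" "fourier_L1 \<psi>1 \<in> borel_measurable lebesgue"
      "fourier_L1 \<psi>2 \<in> borel_measurable lebesgue"
      using ints by (auto intro: fourier_L1_measurable borel_measurable_integrable)
    have lowE: "C1 * exp (- (c1 * r\<^sup>2 * t)) * A \<xi> / r \<le> C1 * N * E t r" if "0 < r" "0 \<le> t" for r t \<xi>
    proof -
      have "exp (- (c1 * r\<^sup>2 * t)) \<le> exp (- (c2 * r\<^sup>2 * t))" by (rule exp_rate_mono) (use that in \<open>auto simp: c2_def\<close>)
      then have "C1 * exp (- (c1 * r\<^sup>2 * t)) * A \<xi> \<le> C1 * exp (- (c2 * r\<^sup>2 * t)) * N"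
        using A_le[of \<xi>] c1 N0 by (intro mult_mono) (auto simp: A_def)
      from divide_right_mono[OF this, of r] show ?thesis using that by (simp add: E_def mult_ac)
    qed
    have E0: "0 \<le> E t r" if "0 < r" for t r using that by (simp add: E_def)
    have sq_le: "x\<^sup>2 \<le> 2 * y\<^sup>2 + 2 * z\<^sup>2" if "0 \<le> x" "x \<le> y + z" for x y z :: real
    proof -
      have "x\<^sup>2 \<le> (y + z)\<^sup>2" using that by (intro power_mono) auto
      also have "\<dots> \<le> 2 * y\<^sup>2 + 2 * z\<^sup>2" using sum_squares_bound[of y z] by (simp add: power2_sum)
      finally show ?thesis .
    qed
    have upper_low: "(cmod (u t \<xi>))\<^sup>2 \<le> 2 * N\<^sup>2 * (J t (norm \<xi>))\<^sup>2 + 2 * C2\<^sup>2 * N\<^sup>2 * (E t (norm \<xi>))\<^sup>2"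
      if "0 \<le> t" "0 < norm \<xi>" "norm \<xi> \<le> r0" for t \<xi>
    proof -
      have "cmod (u t \<xi> - of_real (J t (norm \<xi>)) * fourier_L1 \<psi>2 \<xi>) \<le> C1 * N * E t (norm \<xi>)"
        using low[OF ode that(2,3,1)] lowE[OF that(2,1), of \<xi>] unfolding J_def A_def by simp
      also have "\<dots> \<le> C2 * N * E t (norm \<xi>)" using N0 E0[OF that(2)] by (intro mult_right_mono) (auto simp: C2_def)
      finally have 1: "cmod (u t \<xi> - of_real (J t (norm \<xi>)) * fourier_L1 \<psi>2 \<xi>) \<le> C2 * N * E t (norm \<xi>)" .
      have 2: "cmod (of_real (J t (norm \<xi>)) * fourier_L1 \<psi>2 \<xi>) \<le> N * \<bar>J t (norm \<xi>)\<bar>"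
        using mult_right_mono[OF a2_le[of \<xi>], of "\<bar>J t (norm \<xi>)\<bar>"] by (simp add: norm_mult mult.commute)
      have "cmod (u t \<xi>) \<le> N * \<bar>J t (norm \<xi>)\<bar> + C2 * N * E t (norm \<xi>)"
        using norm_triangle_sub[of "u t \<xi>" "of_real (J t (norm \<xi>)) * fourier_L1 \<psi>2 \<xi>"] 1 2 by linarith
      from sq_le[OF norm_ge_zero this] show ?thesis by (simp add: power_mult_distrib mult.assoc)
    qed
    have lower_low: "p\<^sup>2 * (J t (norm \<xi>))\<^sup>2 \<le> 2 * (cmod (u t \<xi>))\<^sup>2 + 2 * C2\<^sup>2 * N\<^sup>2 * (E t (norm \<xi>))\<^sup>2"
      if t: "0 \<le> t" and r: "0 < norm \<xi>" "norm \<xi> \<le> r0" for t \<xi>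
    proof -
      have 1: "cmod (u t \<xi> - of_real (J t (norm \<xi>)) * fourier_L1 \<psi>2 \<xi>) \<le> C1 * N * E t (norm \<xi>)"
        using low[OF ode r t] lowE[OF r(1) t, of \<xi>] unfolding J_def A_def by simp
      \<comment> \<open>The factor |\<xi>| gained by comparing with the mean turns the singularity 1
        / r^2 of the profile into the 1 / r of \<open>E\<close>.\<close>
      have 2: "\<bar>J t (norm \<xi>)\<bar> * cmod (fourier_L1 \<psi>2 \<xi> - mean_P \<psi>2) \<le> 2 * N * E t (norm \<xi>)"
      proof -
        have "\<bar>diffusion_wave \<kappa> \<delta> (norm \<xi>) t\<bar> \<le> 2 * exp (- (\<kappa> * (norm \<xi>)\<^sup>2 * t))"
          using t \<kappa>\<delta> by (intro diffusion_wave_le) auto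
        also have "\<dots> \<le> 2 * exp (- (c2 * (norm \<xi>)\<^sup>2 * t))"
          by (intro mult_left_mono exp_rate_mono) (use t in \<open>auto simp: c2_def\<close>)
        finally have "\<bar>J t (norm \<xi>)\<bar> \<le> 2 * exp (- (c2 * (norm \<xi>)\<^sup>2 * t)) / (norm \<xi>)\<^sup>2"
          by (simp add: J_def divide_right_mono)
        then have "\<bar>J t (norm \<xi>)\<bar> * cmod (fourier_L1 \<psi>2 \<xi> - mean_P \<psi>2)
            \<le> 2 * exp (- (c2 * (norm \<xi>)\<^sup>2 * t)) / (norm \<xi>)\<^sup>2 * (norm \<xi> * N)"
          using mean[of \<xi>] by (intro mult_mono) auto
        also have "\<dots> = 2 * N * E t (norm \<xi>)" using r by (simp add: E_def power2_eq_square)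
        finally show ?thesis .
      qed
      have "of_real (J t (norm \<xi>)) * mean_P \<psi>2 = u t \<xi> - (u t \<xi> - of_real (J t (norm \<xi>)) * fourier_L1 \<psi>2 \<xi>)
          - of_real (J t (norm \<xi>)) * (fourier_L1 \<psi>2 \<xi> - mean_P \<psi>2)"
        by (simp add: algebra_simps)
      also have "cmod \<dots> \<le> cmod (u t \<xi>) + cmod (u t \<xi> - of_real (J t (norm \<xi>)) * fourier_L1 \<psi>2 \<xi>)
          + \<bar>J t (norm \<xi>)\<bar> * cmod (fourier_L1 \<psi>2 \<xi> - mean_P \<psi>2)"
        by (intro order_trans[OF norm_triangle_ineq4] add_mono norm_triangle_ineq4) (simp add: norm_mult)
      also have "\<dots> \<le> cmod (u t \<xi>) + C2 * N * E t (norm \<xi>)"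
        using 1 2 by (simp add: C2_def algebra_simps)
      finally have "\<bar>J t (norm \<xi>)\<bar> * p \<le> cmod (u t \<xi>) + C2 * N * E t (norm \<xi>)"
        by (simp add: norm_mult p_def)
      from sq_le[OF _ this] show ?thesis using p by (simp add: power_mult_distrib mult_ac)
    qed
    have upper_high: "(cmod (u t \<xi>))\<^sup>2 \<le> 3 * C1\<^sup>2 * exp (- (2 * c1) * t)
        * ((cmod (fourier_L1 \<psi>0 \<xi>))\<^sup>2 + (cmod (fourier_L1 \<psi>1 \<xi>))\<^sup>2 + (cmod (fourier_L1 \<psi>2 \<xi>))\<^sup>2)"
      if "0 \<le> t" "r0 \<le> norm \<xi>" for t \<xi>
    proof -
      have "cmod (u t \<xi>) \<le> C1 * exp (- c1 * t) * A \<xi>"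
        using high[OF ode that(2,1)] unfolding A_def .
      then have "(cmod (u t \<xi>))\<^sup>2 \<le> (C1 * exp (- c1 * t) * A \<xi>)\<^sup>2" by (intro power_mono) auto
      also have "\<dots> = C1\<^sup>2 * exp (- (2 * c1) * t) * (A \<xi>)\<^sup>2"
        using exp_double[of "- c1 * t"] by (simp add: power_mult_distrib mult.assoc)
      also have "\<dots> \<le> C1\<^sup>2 * exp (- (2 * c1) * t) * (3 * ((cmod (fourier_L1 \<psi>0 \<xi>))\<^sup>2 + (cmod (fourier_L1 \<psi>1 \<xi>))\<^sup>2 + (cmod (fourier_L1 \<psi>2 \<xi>))\<^sup>2))"
      proof (rule mult_left_mono)
        have "(x + y + z)\<^sup>2 \<le> 3 * (x\<^sup>2 + y\<^sup>2 + z\<^sup>2)" for x y z :: real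
          using sum_squares_bound[of x y] sum_squares_bound[of x z] sum_squares_bound[of y z]
          by (simp add: power2_sum algebra_simps)
        then show "(A \<xi>)\<^sup>2 \<le> 3 * ((cmod (fourier_L1 \<psi>0 \<xi>))\<^sup>2 + (cmod (fourier_L1 \<psi>1 \<xi>))\<^sup>2 + (cmod (fourier_L1 \<psi>2 \<xi>))\<^sup>2)"
          unfolding A_def .
      qed simp
      finally show ?thesis by (simp only: mult_ac)
    qed
    have u_L2: "in_L2 (u t)" if "0 \<le> t" for t using four[OF that] by (simp add: is_fourier_L2_def)
    have norm_meas [measurable]: "(\<lambda>\<xi>::'a. norm \<xi>) \<in> borel_measurable lebesgue"
      by (rule measurable_completion) simp
    have upper: "L2_norm (u t) \<le> sqrt K * D_tilde n t * N" if t: "1 \<le> t" for t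
    proof -
      have t0: "0 \<le> t" using t by simp
      have "L2sq (u t) \<le> (\<integral>\<^sup>+\<xi>. (ennreal (2 * N\<^sup>2) * (ennreal ((J t (norm \<xi>))\<^sup>2) * indicator {0<..r0} (norm \<xi>))
          + ennreal (2 * C2\<^sup>2 * N\<^sup>2) * (ennreal ((E t (norm \<xi>))\<^sup>2) * indicator {0<..r0} (norm \<xi>)))
          + ennreal (3 * C1\<^sup>2 * exp (- (2 * c1) * t)) * (ennreal ((cmod (fourier_L1 \<psi>0 \<xi>))\<^sup>2)
              + ennreal ((cmod (fourier_L1 \<psi>1 \<xi>))\<^sup>2) + ennreal ((cmod (fourier_L1 \<psi>2 \<xi>))\<^sup>2)) \<partial>lebesgue)"
        unfolding L2sq_def
      proof (rule nn_integral_mono_AE)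
        \<comment> \<open>The expansion divides by r and says nothing at frequency 0, which is a
          null set.\<close>
        have "AE \<xi> in lebesgue. \<xi> \<noteq> (0::'a)"
          using AE_lborel_singleton[of "0::'a"] by (rule AE_completion)
        then show "AE \<xi> in lebesgue. ennreal ((cmod (u t \<xi>))\<^sup>2) \<le> (ennreal (2 * N\<^sup>2) * (ennreal ((J t (norm \<xi>))\<^sup>2) * indicator {0<..r0} (norm \<xi>))
          + ennreal (2 * C2\<^sup>2 * N\<^sup>2) * (ennreal ((E t (norm \<xi>))\<^sup>2) * indicator {0<..r0} (norm \<xi>)))
          + ennreal (3 * C1\<^sup>2 * exp (- (2 * c1) * t)) * (ennreal ((cmod (fourier_L1 \<psi>0 \<xi>))\<^sup>2)
              + ennreal ((cmod (fourier_L1 \<psi>1 \<xi>))\<^sup>2) + ennreal ((cmod (fourier_L1 \<psi>2 \<xi>))\<^sup>2))"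
        proof eventually_elim
          case (elim \<xi>)
          show ?case
          proof (cases "norm \<xi> \<le> r0")
            case True
            have "ennreal ((cmod (u t \<xi>))\<^sup>2) \<le> ennreal (2 * N\<^sup>2 * (J t (norm \<xi>))\<^sup>2 + 2 * C2\<^sup>2 * N\<^sup>2 * (E t (norm \<xi>))\<^sup>2)"
              using upper_low[OF t0 _ True] elim by (intro ennreal_leI) simp
            also have "\<dots> = ennreal (2 * N\<^sup>2) * ennreal ((J t (norm \<xi>))\<^sup>2) + ennreal (2 * C2\<^sup>2 * N\<^sup>2) * ennreal ((E t (norm \<xi>))\<^sup>2)"
              by (subst ennreal_plus, simp, simp, subst (1 2) ennreal_mult, simp_all)
            finally show ?thesis using True elim by (simp add: add_increasing2)
          next
            case False
            have "ennreal ((cmod (u t \<xi>))\<^sup>2) \<le> ennreal (3 * C1\<^sup>2 * exp (- (2 * c1) * t)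
                * ((cmod (fourier_L1 \<psi>0 \<xi>))\<^sup>2 + (cmod (fourier_L1 \<psi>1 \<xi>))\<^sup>2 + (cmod (fourier_L1 \<psi>2 \<xi>))\<^sup>2))"
              using upper_high[OF t0] False by (intro ennreal_leI) simp
            also have "\<dots> = ennreal (3 * C1\<^sup>2 * exp (- (2 * c1) * t)) * (ennreal ((cmod (fourier_L1 \<psi>0 \<xi>))\<^sup>2)
              + ennreal ((cmod (fourier_L1 \<psi>1 \<xi>))\<^sup>2) + ennreal ((cmod (fourier_L1 \<psi>2 \<xi>))\<^sup>2))"
              by (subst ennreal_mult) simp_all
            finally show ?thesis by (rule order_trans) (simp add: add_increasing)
          qed
        qed
      qed
      also have "\<dots> = (ennreal (2 * N\<^sup>2) * W t + ennreal (2 * C2\<^sup>2 * N\<^sup>2) * V t)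
          + ennreal (3 * C1\<^sup>2 * exp (- (2 * c1) * t)) * (L2sq (fourier_L1 \<psi>0) + L2sq (fourier_L1 \<psi>1) + L2sq (fourier_L1 \<psi>2))"
        unfolding W_def V_def L2sq_def by (simp add: nn_integral_add nn_integral_cmult)
      also have "\<dots> \<le> (ennreal (2 * N\<^sup>2) * ennreal (k * CW * D t) + ennreal (2 * C2\<^sup>2 * N\<^sup>2) * ennreal (k * CV * D t))
          + ennreal (3 * C1\<^sup>2 * (Ce * D t)) * ennreal (P * N\<^sup>2)"
      proof (intro add_mono mult_mono ennreal_leI mult_left_mono)
        show "W t \<le> ennreal (k * CW * D t)" by (rule W_le[OF t])
        have "k * CV / t * D t \<le> k * CV / 1 * D t" using t k CV D0 by (intro mult_right_mono divide_left_mono) auto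
        then show "V t \<le> ennreal (k * CV * D t)" using V_le[OF t] by (auto intro: order_trans ennreal_leI)
        show "exp (- (2 * c1) * t) \<le> Ce * D t" by (rule exp_le[OF t])
        have "L2sq (fourier_L1 \<psi>0) + L2sq (fourier_L1 \<psi>1) + L2sq (fourier_L1 \<psi>2)
            \<le> ennreal P * ennreal ((L2_norm \<psi>0)\<^sup>2) + ennreal P * ennreal ((L2_norm \<psi>1)\<^sup>2) + ennreal P * ennreal ((L2_norm \<psi>2)\<^sup>2)"
          unfolding P_def n_def L2sq_eq_L2_norm[OF data(1), symmetric] L2sq_eq_L2_norm[OF data(3), symmetric] L2sq_eq_L2_norm[OF data(5), symmetric]
          by (intro add_mono Plancherel_le ints)
        also have "\<dots> = ennreal (P * ((L2_norm \<psi>0)\<^sup>2 + (L2_norm \<psi>1)\<^sup>2 + (L2_norm \<psi>2)\<^sup>2))"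
          using P by (simp add: ennreal_mult[symmetric] ennreal_plus[symmetric] distrib_left del: ennreal_plus)
        also have "\<dots> \<le> ennreal (P * N\<^sup>2)"
        proof (intro ennreal_leI mult_left_mono)
          have "(L2_norm \<psi>0)\<^sup>2 + (L2_norm \<psi>1)\<^sup>2 + (L2_norm \<psi>2)\<^sup>2 \<le> (L2_norm \<psi>0 + L2_norm \<psi>1 + L2_norm \<psi>2)\<^sup>2"
            by (simp add: power2_eq_square algebra_simps)
          also have "\<dots> \<le> N\<^sup>2" unfolding N_def L2_L11_norm_def
            using L11_norm_nonneg[of \<psi>0] L11_norm_nonneg[of \<psi>1] L11_norm_nonneg[of \<psi>2] by (intro power_mono) auto
          finally show "(L2_norm \<psi>0)\<^sup>2 + (L2_norm \<psi>1)\<^sup>2 + (L2_norm \<psi>2)\<^sup>2 \<le> N\<^sup>2" .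
        qed (use P in simp)
        finally show "L2sq (fourier_L1 \<psi>0) + L2sq (fourier_L1 \<psi>1) + L2sq (fourier_L1 \<psi>2) \<le> ennreal (P * N\<^sup>2)" .
      qed auto
      also have "\<dots> = ennreal (K * D t * N\<^sup>2)"
      proof -
        have nn: "0 \<le> k * CW * D t" "0 \<le> k * CV * D t" "0 \<le> 3 * C1\<^sup>2 * (Ce * D t)" "0 \<le> P * N\<^sup>2"
          using k CW CV D0[of t] Ce P by auto
        have "(ennreal (2 * N\<^sup>2) * ennreal (k * CW * D t) + ennreal (2 * C2\<^sup>2 * N\<^sup>2) * ennreal (k * CV * D t))
          + ennreal (3 * C1\<^sup>2 * (Ce * D t)) * ennreal (P * N\<^sup>2)
          = ennreal (2 * N\<^sup>2 * (k * CW * D t) + 2 * C2\<^sup>2 * N\<^sup>2 * (k * CV * D t) + 3 * C1\<^sup>2 * (Ce * D t) * (P * N\<^sup>2))"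
          using nn by (simp only: ennreal_mult[symmetric] ennreal_plus[symmetric] mult_nonneg_nonneg add_nonneg_nonneg zero_le_power2 zero_le_numeral)
        also have "2 * N\<^sup>2 * (k * CW * D t) + 2 * C2\<^sup>2 * N\<^sup>2 * (k * CV * D t) + 3 * C1\<^sup>2 * (Ce * D t) * (P * N\<^sup>2) = K * D t * N\<^sup>2"
          by (simp add: K_def algebra_simps)
        finally show ?thesis .
      qed
      finally have "(L2_norm (u t))\<^sup>2 \<le> K * D t * N\<^sup>2"
        unfolding L2sq_eq_L2_norm[OF u_L2[OF t0]] using K D0[of t] by (subst (asm) ennreal_le_iff) auto
      also have "\<dots> = (sqrt K * D_tilde n t * N)\<^sup>2" using K by (simp add: power_mult_distrib D_def)
      finally show ?thesis
        using K D_tilde_nonneg[OF t] N0 by (intro power2_le_imp_le[of "L2_norm (u t)"]) auto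
    qed
    have lower_int: "ennreal (p\<^sup>2) * W t \<le> 2 * L2sq (u t) + ennreal (2 * C2\<^sup>2 * N\<^sup>2) * V t" if t0: "0 \<le> t" for t
    proof -
      have [measurable]: "u t \<in> borel_measurable lebesgue" using u_L2[OF t0] by (simp add: in_L2_def)
      have "ennreal (p\<^sup>2) * W t = (\<integral>\<^sup>+\<xi>. ennreal (p\<^sup>2) * (ennreal ((J t (norm (\<xi>::'a)))\<^sup>2) * indicator {0<..r0} (norm \<xi>)) \<partial>lebesgue)"
        unfolding W_def by (rule nn_integral_cmult[symmetric]) measurable
      also have "\<dots> \<le> (\<integral>\<^sup>+\<xi>. 2 * ennreal ((cmod (u t \<xi>))\<^sup>2) + ennreal (2 * C2\<^sup>2 * N\<^sup>2) * (ennreal ((E t (norm \<xi>))\<^sup>2) * indicator {0<..r0} (norm \<xi>)) \<partial>lebesgue)"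
      proof (rule nn_integral_mono)
        fix \<xi> :: 'a
        show "ennreal (p\<^sup>2) * (ennreal ((J t (norm \<xi>))\<^sup>2) * indicator {0<..r0} (norm \<xi>))
            \<le> 2 * ennreal ((cmod (u t \<xi>))\<^sup>2) + ennreal (2 * C2\<^sup>2 * N\<^sup>2) * (ennreal ((E t (norm \<xi>))\<^sup>2) * indicator {0<..r0} (norm \<xi>))"
        proof (cases "norm \<xi> \<in> {0<..r0}")
          case True
          then have "ennreal (p\<^sup>2 * (J t (norm \<xi>))\<^sup>2) \<le> ennreal (2 * (cmod (u t \<xi>))\<^sup>2 + 2 * C2\<^sup>2 * N\<^sup>2 * (E t (norm \<xi>))\<^sup>2)"
            using lower_low[OF t0] by (intro ennreal_leI) simp
          also have "\<dots> = ennreal 2 * ennreal ((cmod (u t \<xi>))\<^sup>2) + ennreal (2 * C2\<^sup>2 * N\<^sup>2) * ennreal ((E t (norm \<xi>))\<^sup>2)"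
            by (subst ennreal_plus, simp, simp, subst (1 2) ennreal_mult, simp_all)
          finally show ?thesis using True by (simp add: ennreal_mult)
        qed simp
      qed
      also have "\<dots> = 2 * L2sq (u t) + ennreal (2 * C2\<^sup>2 * N\<^sup>2) * V t"
        unfolding V_def L2sq_def by (simp add: nn_integral_add nn_integral_cmult)
      finally show ?thesis .
    qed
    \<comment> \<open>From this time on, the squared error is at most half of the squared profile.
      The data enter only here, through the ratio of \<open>N\<close> to \<open>p\<close>, so the
      constant of the lower bound stays free of them.\<close>
    define T where "T = 4 * C2\<^sup>2 * N\<^sup>2 * k * CV / (p\<^sup>2 * k * cW)"
    have lower: "\<forall>\<^sub>F t in at_top. sqrt (k * cW) / 2 * D_tilde n t * p \<le> L2_norm (u t)"
      using W_ge eventually_ge_at_top[of "max 1 T"]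
    proof eventually_elim
      case (elim t)
      then have t: "1 \<le> t" "T \<le> t" and t0: "0 \<le> t" by auto
      have "ennreal (p\<^sup>2 * (k * cW * D t)) = ennreal (p\<^sup>2) * ennreal (k * cW * D t)" by (rule ennreal_mult') simp
      also have "\<dots> \<le> ennreal (p\<^sup>2) * W t" by (intro mult_left_mono elim) simp
      also have "\<dots> \<le> 2 * L2sq (u t) + ennreal (2 * C2\<^sup>2 * N\<^sup>2) * V t" by (rule lower_int[OF t0])
      also have "\<dots> \<le> 2 * L2sq (u t) + ennreal (2 * C2\<^sup>2 * N\<^sup>2) * ennreal (k * CV / t * D t)"
        by (intro add_left_mono mult_left_mono V_le[OF t(1)]) simp
      also have "\<dots> = ennreal (2 * (L2_norm (u t))\<^sup>2 + 2 * C2\<^sup>2 * N\<^sup>2 * (k * CV / t * D t))"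
      proof -
        have Y: "0 \<le> k * CV / t * D t" using k CV t D0 by simp
        have a: "0 \<le> 2 * C2\<^sup>2 * N\<^sup>2" by simp
        have "ennreal (2 * (L2_norm (u t))\<^sup>2 + 2 * C2\<^sup>2 * N\<^sup>2 * (k * CV / t * D t))
            = ennreal (2 * (L2_norm (u t))\<^sup>2) + ennreal (2 * C2\<^sup>2 * N\<^sup>2) * ennreal (k * CV / t * D t)"
          unfolding ennreal_mult[OF a Y, symmetric] by (rule ennreal_plus[OF _ mult_nonneg_nonneg[OF a Y]]) simp
        then show ?thesis unfolding L2sq_eq_L2_norm[OF u_L2[OF t0]] by (simp add: ennreal_mult)
      qed
      finally have "p\<^sup>2 * (k * cW * D t) \<le> 2 * (L2_norm (u t))\<^sup>2 + 2 * C2\<^sup>2 * N\<^sup>2 * (k * CV / t * D t)"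
        using k CV t D0[of t] by (subst (asm) ennreal_le_iff) auto
      moreover have "2 * C2\<^sup>2 * N\<^sup>2 * (k * CV / t * D t) \<le> p\<^sup>2 * (k * cW * D t) / 2"
      proof -
        have "4 * C2\<^sup>2 * N\<^sup>2 * k * CV \<le> t * (p\<^sup>2 * k * cW)"
          using t(2) p k cW by (simp add: T_def pos_divide_le_eq)
        then have "4 * C2\<^sup>2 * N\<^sup>2 * k * CV * (D t / (2 * t)) \<le> t * (p\<^sup>2 * k * cW) * (D t / (2 * t))"
          using D0[of t] t by (intro mult_right_mono) auto
        then show ?thesis using t by (simp add: field_simps)
      qed
      ultimately have le: "p\<^sup>2 * (k * cW * D t) / 4 \<le> (L2_norm (u t))\<^sup>2" by linarith
      have eq: "(sqrt (k * cW) / 2 * D_tilde n t * p)\<^sup>2 = p\<^sup>2 * (k * cW * D t) / 4"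
        using k cW by (simp add: power_mult_distrib power_divide D_def)
      show ?case
        by (rule power2_le_imp_le[OF _ L2_norm_nonneg]) (unfold eq, rule le)
    qed
    show ?thesis
      using lower eventually_ge_at_top[of 1]
    proof eventually_elim
      case (elim t)
      then have t0: "0 \<le> t" by simp
      have f: "L2_norm (u t) \<le> sqrt (2 * P) * L2_norm (\<psi> t)" "L2_norm (\<psi> t) \<le> sqrt (8 / P) * L2_norm (u t)"
        using is_fourier_L2_norm_bounds[OF four[OF t0]] by (auto simp: P_def n_def)
      have "sqrt (k * cW) / 2 * D_tilde n t * p \<le> sqrt (2 * P) * L2_norm (\<psi> t)"
        using elim(1) f(1) by simp
      then have "sqrt (k * cW) / 2 * D_tilde n t * p / sqrt (2 * P) \<le> L2_norm (\<psi> t)"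
        using P by (subst pos_divide_le_eq) (auto simp: mult.commute)
      moreover have "sqrt (k * cW) / 2 * D_tilde n t * p / sqrt (2 * P) = c * D_tilde n t * p"
        by (simp add: c_def)
      moreover have "sqrt (8 / P) * L2_norm (u t) \<le> sqrt (8 / P) * (sqrt K * D_tilde n t * N)"
        using upper[OF elim(2)] P by (intro mult_left_mono) auto
      moreover have "sqrt (8 / P) * (sqrt K * D_tilde n t * N) = C * D_tilde n t * N" by (simp add: C_def)
      ultimately show ?case using f(2) unfolding p_def N_def by linarith
    qed
  qed
  show ?thesis unfolding n_def[symmetric]
    by (rule exI[of _ c], rule conjI[OF c], rule exI[of _ C], rule conjI[OF C], intro allI impI, elim conjE, rule main)
qed

theorem theorem2p3:
  fixes b \<nu> \<gamma> :: real
  assumes "CARD('n::finite) \<ge> 3"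
    and "b > 0" and "\<nu> > 0" and "1 < \<gamma>" and "\<gamma> \<le> 5 / 3"
  shows "\<exists>\<kappa>0>0. \<forall>\<kappa>. 0 < \<kappa> \<and> \<kappa> < \<kappa>0 \<longrightarrow>
    (\<exists>c>0. \<exists>C>0. \<forall>(\<psi>0 :: real ^ 'n \<Rightarrow> complex) \<psi>1 \<psi>2 \<psi>.
       in_L2 \<psi>0 \<and> in_L11 \<psi>0 \<and> in_L2 \<psi>1 \<and> in_L11 \<psi>1 \<and> in_L2 \<psi>2 \<and> in_L11 \<psi>2 \<and>
       cmod (mean_P \<psi>2) \<noteq> 0 \<and>
       blackstock_solution b \<nu> \<gamma> \<kappa> \<psi>0 \<psi>1 \<psi>2 \<psi> \<longrightarrow>
       (\<forall>\<^sub>F t in at_top.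
          c * D_tilde CARD('n) t * cmod (mean_P \<psi>2) \<le> L2_norm (\<psi> t) \<and>
          L2_norm (\<psi> t) \<le> C * D_tilde CARD('n) t *
            (L2_L11_norm \<psi>0 + L2_L11_norm \<psi>1 + L2_L11_norm \<psi>2)))"
proof (rule exI[of _ "b * \<nu> / 2"], intro conjI allI impI)
  show "0 < b * \<nu> / 2" using assms by simp
  fix \<kappa> assume \<kappa>: "0 < \<kappa> \<and> \<kappa> < b * \<nu> / 2"
  have dim: "3 \<le> DIM(real ^ 'n)" using assms(1) by simp
  \<comment> \<open>Because \<delta> = b \<nu> + (\<gamma> - 1) \<kappa> exceeds b \<nu>, this gives
    \<kappa> < \<delta> / 2, and it also implies the sign condition \<kappa> \<le> b \<nu>.\<close>
  have "2 * \<kappa> < b * \<nu>" using \<kappa> by simp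
  from blackstock_L2_estimate[OF dim assms(2,3) conjunct1[OF \<kappa>] assms(4) this]
  show "\<exists>c>0. \<exists>C>0. \<forall>(\<psi>0 :: real ^ 'n \<Rightarrow> complex) \<psi>1 \<psi>2 \<psi>.
       in_L2 \<psi>0 \<and> in_L11 \<psi>0 \<and> in_L2 \<psi>1 \<and> in_L11 \<psi>1 \<and> in_L2 \<psi>2 \<and> in_L11 \<psi>2 \<and>
       cmod (mean_P \<psi>2) \<noteq> 0 \<and>
       blackstock_solution b \<nu> \<gamma> \<kappa> \<psi>0 \<psi>1 \<psi>2 \<psi> \<longrightarrow>
       (\<forall>\<^sub>F t in at_top.
          c * D_tilde CARD('n) t * cmod (mean_P \<psi>2) \<le> L2_norm (\<psi> t) \<and>
          L2_norm (\<psi> t) \<le> C * D_tilde CARD('n) t *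
            (L2_L11_norm \<psi>0 + L2_L11_norm \<psi>1 + L2_L11_norm \<psi>2))"
    by simp
qed

end
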